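(* Let $\lambda>0$ and let $u_0\in H^1(\mathbb{S})$ be such that $y_0:=\mu(u_0)-u_{0,xx}\in M^+(\mathbb{S})$. Then the weakly dissipative $\mu$HS initial value problem $$\begin{cases}\mu(u)_t-u_{txx}+2\mu(u)u_x-2u_xu_{xx}-uu_{xxx}+\lambda(\mu(u)-u_{xx})=0, & t>0,\ x\in\mathbb{R},\\ u(0,x)=u_0(x), & x\in\mathbb{R},\\ u(t,x+1)=u(t,x), & t\ge 0,\ x\in\mathbb{R},\end{cases}$$ has an admissible global weak solution $u$ (as defined in the context). Moreover, $$u\in L^\infty_{loc}(\mathbb{R}^+;W^{1,\infty}(\mathbb{S}))\cap H^1_{loc}(\mathbb{R}^+\times\mathbb{S}).$$ Furthermore, $y(t,\cdot)=\mu(u(t,\cdot))-u_{xx}(t,\cdot)\in M^+(\mathbb{S})$ for a.e. $t\in\mathbb{R}^+$, and it is uniformly bounded, i.e. there is a constant $C$ with $\|y(t,\cdot)\|_{M(\mathbb{S})}\le C$ for a.e. $t\in\mathbb{R}^+$.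
   Context: Notation: $\mathbb{S}=\mathbb{R}/\mathbb{Z}$ is the circle of length one; functions on $\mathbb{S}$ are identified with $1$-periodic functions on $\mathbb{R}$. $\mathbb{R}^+=\mathbb{R}_+=[0,\infty)$. For a function $u$ on $\mathbb{S}$ (or $u(t,\cdot)$), $\mu(u)=\int_{\mathbb{S}}u\,dx$ is its mean. $M(\mathbb{S})$ is the space of Radon measures on $\mathbb{S}$ with bounded total variation (with the total variation norm), and $M^+(\mathbb{S})$ is the subset of positive measures. Derivatives are in the sense of distributions. The subscript $loc$ in $L^\infty_{loc}(\mathbb{R}^+;\cdot)$ and $H^1_{loc}(\mathbb{R}^+\times\mathbb{S})$ means that the restriction to $[0,T]$ (respectively $[0,T]\times\mathbb{S}$) lies in the corresponding space for every $T>0$. Definition (admissible global weak solution). A function $u\in C(\mathbb{R}^+\times\mathbb{S})\cap L^\infty(\mathbb{R}^+;H^1(\mathbb{S}))$ is an admissible global weak solution of the problem if: (i) $u$ satisfies the equation in the sense of distributions, in the equivalent nonlocal form $$u_t+uu_x=-\partial_x g*\Big(2\mu(u_0)e^{-\lambda t}u+\tfrac12u_x^2\Big)-\lambda u,$$ where $*$ is convolution on $\mathbb{S}$ in $x$ and $g$ is the $1$-periodic function with $g(x)=\frac12x(x-1)+\frac{13}{12}$ for $x\in[0,1)$ (the Green's function of $A=\mu-\partial_x^2$, i.e. $A^{-1}w=g*w$); (ii) $u(t,\cdot)\to u_0$ as $t\to0^+$ in the sense of distributions; (iii) for all $t\ge0$, $\mu(u(t,\cdot))=\mu(u_0)e^{-\lambda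 t}$ and $\|u_x(t,\cdot)\|_{L^2(\mathbb{S})}=e^{-\lambda t}\|u_{0,x}\|_{L^2(\mathbb{S})}$. *)

theory Defs
  imports "HOL-Probability.Essential_Supremum" "HOL-Analysis.Analysis"
begin

section \<open>The circle and smooth test functions\<close>

text \<open>
  Functions on the circle R/Z are 1-periodic functions on the line.  The measurable structure and
  the Lebesgue measure of the circle are those of the fundamental domain [0,1), onto which
  the circle is mapped by a Borel isomorphism.
\<close>

definition circle :: "real measure" where
  "circle = restrict_space lborel {0..<1}"

text \<open>For a set \<open>I\<close> of times, Lebesgue measure on the product of \<open>I\<close> and the circle.\<close>

definition cylinder :: "real set \<Rightarrow> (real \<times> real) measure" where
  "cylinder I = restrict_space lborel (I \<times> {0..<1})"

definition periodic1 :: "(real \<Rightarrow> 'a) \<Rightarrow> bool" where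
  "periodic1 f \<longleftrightarrow> (\<forall>x. f (x + 1) = f x)"

definition mean :: "(real \<Rightarrow> real) \<Rightarrow> real" where
  "mean f = (LINT x|circle. f x)"

text \<open>In finite dimension, a differentiable function all of whose directional derivatives are
  \<open>C\<^sup>k\<close> is \<open>C\<close> to the order \<open>k + 1\<close>, and conversely.\<close>

primrec C_k :: "nat \<Rightarrow> ('a::euclidean_space \<Rightarrow> real) \<Rightarrow> bool" where
  "C_k 0 f \<longleftrightarrow> continuous_on UNIV f"
| "C_k (Suc k) f \<longleftrightarrow>
     (\<forall>x. f differentiable (at x)) \<and> (\<forall>v. C_k k (\<lambda>x. frechet_derivative f (at x) v))"

definition smooth :: "('a::euclidean_space \<Rightarrow> real) \<Rightarrow> bool" where
  "smooth f \<longleftrightarrow> (\<forall>k. C_k k f)"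

definition circle_test :: "(real \<Rightarrow> real) set" where
  "circle_test = {\<phi>. smooth \<phi> \<and> periodic1 \<phi>}"

text \<open>Test functions on the product of the open set \<open>I\<close> of times and the circle.\<close>

definition cylinder_test :: "real set \<Rightarrow> (real \<Rightarrow> real \<Rightarrow> real) set" where
  "cylinder_test I = {\<phi>. smooth (\<lambda>(t, x). \<phi> t x) \<and> (\<forall>t. periodic1 (\<phi> t)) \<and>
     (\<exists>K. compact K \<and> K \<subseteq> I \<and> (\<forall>t x. t \<notin> K \<longrightarrow> \<phi> t x = 0))}"

definition d_t :: "(real \<Rightarrow> real \<Rightarrow> real) \<Rightarrow> real \<Rightarrow> real \<Rightarrow> real" where
  "d_t \<phi> t x = deriv (\<lambda>s. \<phi> s x) t"

definition d_x :: "(real \<Rightarrow> real \<Rightarrow> real) \<Rightarrow> real \<Rightarrow> real \<Rightarrow> real" where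
  "d_x \<phi> t x = deriv (\<phi> t) x"


section \<open>Function spaces on the circle\<close>

definition square_integrable :: "'a measure \<Rightarrow> ('a \<Rightarrow> real) \<Rightarrow> bool" where
  "square_integrable M f \<longleftrightarrow> f \<in> borel_measurable M \<and> integrable M (\<lambda>x. (f x)\<^sup>2)"

definition L2_norm :: "(real \<Rightarrow> real) \<Rightarrow> real" where
  "L2_norm f = sqrt (LINT x|circle. (f x)\<^sup>2)"

definition has_weak_deriv :: "(real \<Rightarrow> real) \<Rightarrow> (real \<Rightarrow> real) \<Rightarrow> bool" where
  "has_weak_deriv f v \<longleftrightarrow>
     integrable circle f \<and> integrable circle v \<and> periodic1 v \<and>
     (\<forall>\<phi>\<in>circle_test. (LINT x|circle. f x * deriv \<phi> x) = - (LINT x|circle. v x * \<phi> x))"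

text \<open>The weak derivative is unique up to null sets; \<open>weak_deriv\<close> picks a representative.\<close>

definition weak_deriv :: "(real \<Rightarrow> real) \<Rightarrow> real \<Rightarrow> real" where
  "weak_deriv f = (SOME v. has_weak_deriv f v)"

definition H1 :: "(real \<Rightarrow> real) set" where
  "H1 = {f. periodic1 f \<and> square_integrable circle f \<and>
            (\<exists>v. has_weak_deriv f v \<and> square_integrable circle v)}"

definition H1_norm :: "(real \<Rightarrow> real) \<Rightarrow> real" where
  "H1_norm f = sqrt ((L2_norm f)\<^sup>2 + (L2_norm (weak_deriv f))\<^sup>2)"

definition Linf :: "(real \<Rightarrow> real) \<Rightarrow> bool" where
  "Linf f \<longleftrightarrow> f \<in> borel_measurable circle \<and> esssup circle (\<lambda>x. ereal \<bar>f x\<bar>) < \<infinity>"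

definition Linf_norm :: "(real \<Rightarrow> real) \<Rightarrow> real" where
  "Linf_norm f = real_of_ereal (esssup circle (\<lambda>x. ereal \<bar>f x\<bar>))"

definition W1inf :: "(real \<Rightarrow> real) set" where
  "W1inf = {f. periodic1 f \<and> Linf f \<and> (\<exists>v. has_weak_deriv f v \<and> Linf v)}"

definition W1inf_norm :: "(real \<Rightarrow> real) \<Rightarrow> real" where
  "W1inf_norm f = Linf_norm f + Linf_norm (weak_deriv f)"

text \<open>
  \<open>Linf_into I X N u\<close> says that \<open>u\<close> is essentially bounded from \<open>I\<close> into the normed space \<open>(X, N)\<close>.
  Measurability in time is not part of the predicate: it is only applied to functions that are
  jointly continuous in time and space, for which it is automatic (strongly in \<open>H1\<close>, and in the
  usual weak-star sense in \<open>W1inf\<close>, which is not separable).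
\<close>

definition Linf_into ::
  "real set \<Rightarrow> (real \<Rightarrow> real) set \<Rightarrow> ((real \<Rightarrow> real) \<Rightarrow> real) \<Rightarrow> (real \<Rightarrow> real \<Rightarrow> real) \<Rightarrow> bool" where
  "Linf_into I X N u \<longleftrightarrow> (\<exists>K. AE t in lborel. t \<in> I \<longrightarrow> u t \<in> X \<and> N (u t) \<le> K)"


section \<open>Weak derivatives in time and space\<close>

definition has_weak_dt :: "real set \<Rightarrow> (real \<Rightarrow> real \<Rightarrow> real) \<Rightarrow> (real \<Rightarrow> real \<Rightarrow> real) \<Rightarrow> bool" where
  "has_weak_dt I u v \<longleftrightarrow> (\<forall>\<phi>\<in>cylinder_test I.
     (LINT (t, x)|cylinder I. u t x * d_t \<phi> t x) = - (LINT (t, x)|cylinder I. v t x * \<phi> t x))"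

definition has_weak_dx :: "real set \<Rightarrow> (real \<Rightarrow> real \<Rightarrow> real) \<Rightarrow> (real \<Rightarrow> real \<Rightarrow> real) \<Rightarrow> bool" where
  "has_weak_dx I u v \<longleftrightarrow> (\<forall>\<phi>\<in>cylinder_test I.
     (LINT (t, x)|cylinder I. u t x * d_x \<phi> t x) = - (LINT (t, x)|cylinder I. v t x * \<phi> t x))"

definition L2_cylinder :: "real set \<Rightarrow> (real \<Rightarrow> real \<Rightarrow> real) \<Rightarrow> bool" where
  "L2_cylinder I u \<longleftrightarrow> square_integrable (cylinder I) (\<lambda>(t, x). u t x)"

definition H1_cylinder :: "real set \<Rightarrow> (real \<Rightarrow> real \<Rightarrow> real) \<Rightarrow> bool" where
  "H1_cylinder I u \<longleftrightarrow> L2_cylinder I u \<and>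
     (\<exists>v. L2_cylinder I v \<and> has_weak_dt I u v) \<and> (\<exists>v. L2_cylinder I v \<and> has_weak_dx I u v)"


section \<open>Measures on the circle\<close>

definition total_variation :: "'a measure \<Rightarrow> ('a set \<Rightarrow> real) \<Rightarrow> ennreal" where
  "total_variation M m =
     (SUP P\<in>{P. finite P \<and> P \<subseteq> sets M \<and> disjoint P}. \<Sum>A\<in>P. ennreal \<bar>m A\<bar>)"

text \<open>Positive Radon measures of bounded total variation; on the (compact metric) circle these are
  the finite Borel measures.\<close>

definition M_plus :: "real measure set" where
  "M_plus = {\<nu>. sets \<nu> = sets circle \<and> finite_measure \<nu>}"

definition M_norm :: "real measure \<Rightarrow> ennreal" where
  "M_norm \<nu> = total_variation \<nu> (measure \<nu>)"

text \<open>The distribution \<open>\<mu>(f) - f\<^sub>x\<^sub>x\<close> on the circle.\<close>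

definition momentum :: "(real \<Rightarrow> real) \<Rightarrow> (real \<Rightarrow> real) \<Rightarrow> real" where
  "momentum f \<phi> = (LINT x|circle. mean f * \<phi> x) - (LINT x|circle. f x * deriv (deriv \<phi>) x)"

definition represents :: "real measure \<Rightarrow> ((real \<Rightarrow> real) \<Rightarrow> real) \<Rightarrow> bool" where
  "represents \<nu> D \<longleftrightarrow> (\<forall>\<phi>\<in>circle_test. D \<phi> = (LINT x|\<nu>. \<phi> x))"


section \<open>Admissible global weak solutions\<close>

definition green :: "real \<Rightarrow> real" where
  "green x = frac x * (frac x - 1) / 2 + 13 / 12"

definition circle_conv :: "(real \<Rightarrow> real) \<Rightarrow> (real \<Rightarrow> real) \<Rightarrow> real \<Rightarrow> real" where
  "circle_conv h w x = (LINT y|circle. h (x - y) * w y)"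

text \<open>
  \<open>u\<^sub>t + u u\<^sub>x = - \<partial>\<^sub>x (g * (2 \<mu>(u\<^sub>0) e\<^bsup>-lam t\<^esup> u + u\<^sub>x\<^sup>2 / 2)) - lam u\<close> in the sense of distributions
  for positive times: the derivatives of \<open>u\<close> in time and of the convolution in space fall on the
  test function, while \<open>u\<^sub>x\<close> is a locally square integrable function.
\<close>

definition weak_equation ::
  "real \<Rightarrow> (real \<Rightarrow> real) \<Rightarrow> (real \<Rightarrow> real \<Rightarrow> real) \<Rightarrow> bool" where
  "weak_equation lam u0 u \<longleftrightarrow>
     (\<exists>ux. (\<forall>T>0. L2_cylinder {0<..<T} ux) \<and> has_weak_dx {0<..} u ux \<and>
       (\<forall>\<phi>\<in>cylinder_test {0<..}.
          (LINT (t, x)|cylinder {0<..}. - u t x * d_t \<phi> t x + u t x * ux t x * \<phi> t x) =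
          (LINT (t, x)|cylinder {0<..}.
             circle_conv green (\<lambda>y. 2 * mean u0 * exp (- lam * t) * u t y + (ux t y)\<^sup>2 / 2) x
               * d_x \<phi> t x
             - lam * u t x * \<phi> t x)))"

text \<open>Only the values of \<open>u\<close> at times \<open>t \<ge> 0\<close> are relevant.\<close>

definition admissible_global_weak_solution ::
  "real \<Rightarrow> (real \<Rightarrow> real) \<Rightarrow> (real \<Rightarrow> real \<Rightarrow> real) \<Rightarrow> bool" where
  "admissible_global_weak_solution lam u0 u \<longleftrightarrow>
     continuous_on ({0..} \<times> UNIV) (\<lambda>(t, x). u t x) \<and>
     (\<forall>t\<ge>0. periodic1 (u t)) \<and>
     Linf_into {0..} H1 H1_norm u \<and>
     weak_equation lam u0 u \<and>
     (\<forall>\<phi>\<in>circle_test.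
        ((\<lambda>t. LINT x|circle. u t x * \<phi> x) \<longlongrightarrow> (LINT x|circle. u0 x * \<phi> x)) (at_right 0)) \<and>
     (\<forall>t\<ge>0. mean (u t) = mean u0 * exp (- lam * t) \<and>
        u t \<in> H1 \<and>
        L2_norm (weak_deriv (u t)) = exp (- lam * t) * L2_norm (weak_deriv u0))"

end

theory Submission
  imports Defs
begin

text \<open>
  Let \<open>nu\<close> be the measure representing \<open>\<mu>(u\<^sub>0) - u\<^sub>0\<^sub>x\<^sub>x\<close>.  The solution is
  \<open>u(t, x) = \<integral> p(t, y) g(x - q(t, y)) d nu(y)\<close>, where \<open>g\<close> is the Green's function and every label \<open>y\<close>
  carries a particle at \<open>q\<close> with momentum density \<open>p\<close>, moving by
  \<open>q\<^sub>t = u(t, q)\<close>, \<open>p\<^sub>t = - p u\<^sub>x(t, q) - lam p\<close> (a continuum of peakons).  Since \<open>g\<close> is a quadratic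
  polynomial away from its corner and the flow preserves the order of the particles, the right-hand side can
  be written so that it is Lipschitz in the supremum norm; Picard iteration then gives the flow even if
  \<open>nu\<close> has atoms, and no approximation or compactness argument is needed.  The damping is removed
  beforehand by the substitution \<open>u(t, x) = e\<^bsup>-lam t\<^esup> U((1 - e\<^bsup>-lam t\<^esup>) / lam, x)\<close>.

  By construction the momentum of \<open>u(t)\<close> is the image of \<open>p(t) nu\<close> under \<open>q(t)\<close>, a positive measure of
  mass \<open>\<mu>(u\<^sub>0) e\<^bsup>-lam t\<^esup>\<close>, and the energy \<open>\<integral>\<integral> p(x) p(y) g(q(x) - q(y))\<close> is the Hamiltonian of the
  particle system.  The weak equation amounts, for each time, to an identity between double integrals over
  particles, which follows from integrations by parts against \<open>g\<close> and \<open>g'\<close>.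
\<close>

section \<open>Integration over the circle\<close>

text \<open>The obstacle is an atom of \<open>nu\<close>: there u_x jumps exactly where a particle
  sits, and p u_x(q) is not a continuous function of the positions. On (-1, 1) the derivative of the
  kernel is x - sgn x / 2. Since particles keep the order of their labels, the sign may be taken of
  the labels, which do not move, and the rest is linear in the positions. An atom is a single label
  and never splits; its own contribution to u_x is 0, the mean of the one-sided limits.

  The potential of a general measure need not be differentiable off a discrete set. All integrations
  by parts are therefore made on the kernels, for one particle or one pair of particles at a time,
  and integrated over the particles afterwards.

  The change of time removes the damping because the undamped equation is homogeneous of degree two:
  with u = e^(-lam t) U(s), the quadratic terms carry e^(-2 lam t), and so does U_s in u_t once
  ds/dt = e^(-lam t).

  The energy law needs no estimate: the squared norm of u_x is the Hamiltonian minus the squared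
  mass, and both are conserved by the undamped system.\<close>

lemma space_circle [simp]: "space circle = {0..<1}"
  by (simp add: circle_def)

lemma sets_circle: "sets circle = sets (restrict_space borel {0..<1::real})"
  by (simp add: circle_def sets_restrict_space)

lemma emeasure_circle_space: "emeasure circle {0..<1} = 1"
  by (simp add: circle_def emeasure_restrict_space)

lemma finite_measure_circle: "finite_measure circle"
  by (rule finite_measureI) (simp add: emeasure_circle_space)

lemma measure_circle_space [simp]: "measure circle {0..<1} = 1"
  by (simp add: measure_def emeasure_circle_space)

lemma measurable_circleI [intro]: "f \<in> borel_measurable borel \<Longrightarrow> f \<in> borel_measurable circle"
  unfolding circle_def by (rule measurable_restrict_space1) simp

lemma integrable_bounded:
  fixes f :: "'a \<Rightarrow> real"
  assumes "finite_measure N" "f \<in> borel_measurable N" "\<And>x. x \<in> space N \<Longrightarrow> \<bar>f x\<bar> \<le> B"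
  shows "integrable N f"
  by (rule finite_measure.integrable_const_bound[OF assms(1), where B = B])
     (use assms in \<open>auto intro!: AE_I2\<close>)

text \<open>A non-integrable function has Bochner integral 0, and \<open>0 \<le> B\<close> covers
  that case.\<close>

lemma abs_integral_bounded:
  fixes f :: "'a \<Rightarrow> real"
  assumes "finite_measure N" "\<And>x. x \<in> space N \<Longrightarrow> \<bar>f x\<bar> \<le> B" "0 \<le> B"
  shows "\<bar>LINT x|N. f x\<bar> \<le> B * measure N (space N)"
proof (cases "integrable N f")
  case True
  interpret finite_measure N by fact
  have "\<bar>LINT x|N. f x\<bar> \<le> (LINT x|N. \<bar>f x\<bar>)" by simp
  also have "\<dots> \<le> (LINT x|N. B)" using True assms by (intro integral_mono) auto
  finally show ?thesis by (simp add: mult.commute)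
next
  case False
  then show ?thesis using assms by (simp add: not_integrable_integral_eq)
qed

lemma fubini_bounded:
  fixes F :: "'a \<Rightarrow> 'b \<Rightarrow> real"
  assumes A: "finite_measure A" and B: "finite_measure B"
    and m: "(\<lambda>(x, y). F x y) \<in> borel_measurable (A \<Otimes>\<^sub>M B)"
    and bd: "\<And>x y. x \<in> space A \<Longrightarrow> y \<in> space B \<Longrightarrow> \<bar>F x y\<bar> \<le> C"
  shows "integrable A (\<lambda>x. LINT y|B. F x y)"
    and "integrable B (\<lambda>y. LINT x|A. F x y)"
    and "(LINT x|A. LINT y|B. F x y) = (LINT y|B. LINT x|A. F x y)"
proof -
  interpret A: finite_measure A by fact
  interpret B: finite_measure B by fact
  interpret P: pair_sigma_finite A B by unfold_locales
  have "finite_measure (A \<Otimes>\<^sub>M B)" by (simp add: A B finite_measure_pair_measure)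
  then have i: "integrable (A \<Otimes>\<^sub>M B) (\<lambda>(x, y). F x y)"
    by (rule integrable_bounded[OF _ m, where B = C]) (use bd in \<open>auto simp: space_pair_measure\<close>)
  show "integrable A (\<lambda>x. LINT y|B. F x y)" using P.integrable_fst[OF i] .
  show "integrable B (\<lambda>y. LINT x|A. F x y)" using P.integrable_snd[OF i] .
  show "(LINT x|A. LINT y|B. F x y) = (LINT y|B. LINT x|A. F x y)"
    using P.Fubini_integral[OF i] by simp
qed

lemma set_integrable_interval:
  fixes f :: "real \<Rightarrow> real"
  assumes "f \<in> borel_measurable borel" and "\<And>x. s \<le> x \<Longrightarrow> x \<le> t \<Longrightarrow> \<bar>f x\<bar> \<le> B"
  shows "set_integrable lborel {s..t} f"
  unfolding set_integrable_def
  by (rule integrableI_bounded_set_indicator[where B = B])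
     (use assms in \<open>auto simp: emeasure_lborel_Icc_eq\<close>)

text \<open>The endpoint 1 is a null set. The closed interval and the gauge integral make the
  fundamental theorem of calculus with finitely many exceptional points available.\<close>

lemma integral_circle_eq:
  fixes f :: "real \<Rightarrow> real"
  assumes "f \<in> borel_measurable borel" and "\<And>x. 0 \<le> x \<Longrightarrow> x \<le> 1 \<Longrightarrow> \<bar>f x\<bar> \<le> B"
  shows "(LINT x|circle. f x) = integral {0..1} f"
proof -
  have si: "set_integrable lborel {0..1} f"
    by (rule set_integrable_interval) (use assms in auto)
  have "(LINT x|circle. f x) = (LINT x:{0..<1}|lborel. f x)"
    unfolding circle_def set_lebesgue_integral_def by (subst integral_restrict_space) auto
  also have "\<dots> = (LINT x:{0..1}|lborel. f x)"
  proof (rule set_integral_cong_set)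
    show "set_borel_measurable lborel {0..<1} f" "set_borel_measurable lborel {0..1} f"
      using assms(1) unfolding set_borel_measurable_def by measurable
    have "AE x in lborel. x \<noteq> (1::real)" by (rule AE_lborel_singleton)
    then show "AE x in lborel. (x \<in> {0..1::real}) = (x \<in> {0..<1})" by eventually_elim auto
  qed
  also have "\<dots> = integral {0..1} f" by (rule set_borel_integral_eq_integral(2)[OF si])
  finally show ?thesis .
qed

lemma integral_circle_has_integral:
  fixes f :: "real \<Rightarrow> real"
  assumes "f \<in> borel_measurable borel" and "\<And>x. 0 \<le> x \<Longrightarrow> x \<le> 1 \<Longrightarrow> \<bar>f x\<bar> \<le> B"
    and "(f has_integral I) {0..1}"
  shows "(LINT x|circle. f x) = I"
  using integral_circle_eq[OF assms(1,2)] assms(3) by (simp add: integral_unique)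

lemma periodic1_add_int: "periodic1 f \<Longrightarrow> f (x + of_int n) = f x"
proof -
  assume p: "periodic1 f"
  have n: "f (x + real m) = f x" for m x
  proof (induction m)
    case (Suc m)
    have "f (x + real (Suc m)) = f ((x + real m) + 1)" by (simp add: add_ac)
    then show ?case using p Suc by (simp add: periodic1_def)
  qed simp
  show ?thesis
  proof (cases "n \<ge> 0")
    case True
    then show ?thesis using n[of x "nat n"] by simp
  next
    case False
    then show ?thesis using n[of "x + of_int n" "nat (-n)"] by simp
  qed
qed

lemma periodic1_frac: "periodic1 f \<Longrightarrow> f (frac x) = f x"
  using periodic1_add_int[of f x "- \<lfloor>x\<rfloor>"] by (simp add: frac_def)

text \<open>Only the fractional part c of the shift matters. The shifted period [c, 1 + c] is cut at
  1, and its second piece is moved back to [0, c] by periodicity.\<close>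

lemma integral_circle_shift:
  fixes f :: "real \<Rightarrow> real"
  assumes p: "periodic1 f" and m: "f \<in> borel_measurable borel" and b: "\<And>x. \<bar>f x\<bar> \<le> B"
  shows "(LINT x|circle. f (x + a)) = (LINT x|circle. f x)"
proof -
  define c where "c = frac a"
  have c: "0 \<le> c" "c < 1" by (auto simp: c_def frac_lt_1)
  have int: "f integrable_on {s..t}" for s t
    by (rule set_borel_integral_eq_integral(1)[OF set_integrable_interval]) (use m b in auto)
  have sh: "integral {s..t} (\<lambda>x. f (x + d)) = integral {s+d..t+d} f" for s t d
    using integral_shift_real_ivl[of "s+d" d "t+d" f] by simp
  have "(LINT x|circle. f (x + a)) = (LINT x|circle. f (x + c))"
    using periodic1_add_int[OF p, of "_ + a" "- \<lfloor>a\<rfloor>"]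
    by (intro Bochner_Integration.integral_cong refl) (simp add: c_def frac_def algebra_simps)
  also have "\<dots> = integral {0..1} (\<lambda>x. f (x + c))"
    by (rule integral_circle_eq[where B = B]) (use m b in auto)
  also have "\<dots> = integral {c..1+c} f" by (simp add: sh)
  also have "\<dots> = integral {c..1} f + integral {1..1+c} f"
    by (rule Henstock_Kurzweil_Integration.integral_combine[symmetric]) (use c int in auto)
  also have "integral {1..1+c} f = integral {0..c} (\<lambda>x. f (x + 1))"
    by (simp add: sh add.commute)
  also have "(\<lambda>x. f (x + 1)) = f" using p by (auto simp: periodic1_def)
  also have "integral {c..1} f + integral {0..c} f = integral {0..1} f"
    using Henstock_Kurzweil_Integration.integral_combine[of 0 c 1 f] c int by simp
  also have "\<dots> = (LINT x|circle. f x)"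
    by (rule integral_circle_eq[symmetric, where B = B]) (use m b in auto)
  finally show ?thesis .
qed

section \<open>The Green's function\<close>

text \<open>At the corner the value is the mean of the one-sided limits 1/2 and -1/2. This keeps the
  function odd, so that a particle does not act on its own momentum, and it gives the right product
  of u_x with an atom in \<open>integral_dpot_sq_mult\<close>.\<close>

definition dgreen :: "real \<Rightarrow> real" where
  "dgreen x = (if x \<in> \<int> then 0 else frac x - 1 / 2)"

lemma periodic1_green: "periodic1 green"
  by (simp add: periodic1_def green_def frac_1_eq)

lemma periodic1_dgreen: "periodic1 dgreen"
proof -
  have "x + 1 \<in> \<int> \<longleftrightarrow> x \<in> \<int>" for x :: real
    by (metis Ints_1 Ints_add Ints_diff add_diff_cancel_right')
  then show ?thesis by (simp add: periodic1_def dgreen_def frac_1_eq)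
qed

lemma green_minus: "green (- x) = green x"
  by (auto simp: green_def frac_neg field_simps)

lemma dgreen_minus: "dgreen (- x) = - dgreen x"
  by (auto simp: dgreen_def frac_neg)

lemma dgreen_0 [simp]: "dgreen 0 = 0"
  by (simp add: dgreen_def)

lemma green_unit: "0 \<le> x \<Longrightarrow> x \<le> 1 \<Longrightarrow> green x = x * (x - 1) / 2 + 13 / 12"
  by (cases "x = 1") (auto simp: green_def frac_eq)

lemma dgreen_unit: "0 < x \<Longrightarrow> x < 1 \<Longrightarrow> dgreen x = x - 1 / 2"
proof -
  assume "0 < x" "x < 1"
  then have "frac x = x" by (simp add: frac_eq)
  then show ?thesis using \<open>0 < x\<close> by (auto simp: dgreen_def frac_eq_0_iff[symmetric])
qed

lemma abs_dgreen_le: "\<bar>dgreen x\<bar> \<le> 1 / 2"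
  using frac_ge_0[of x] frac_lt_1[of x] unfolding dgreen_def by (smt (verit, best) field_sum_of_halves)

lemma green_le: "green x \<le> 13 / 12" and green_ge_0: "0 \<le> green x"
proof -
  obtain f where f: "f = frac x" "0 \<le> f" "f < 1" using frac_ge_0 frac_lt_1 by blast
  then have "0 \<le> f * (1 - f)" by auto
  moreover have "f * (1 - f) \<le> 1 * 1" using f by (intro mult_mono) auto
  moreover have "green x = 13 / 12 - f * (1 - f) / 2" by (simp add: green_def f(1) field_simps)
  ultimately show "green x \<le> 13 / 12" "0 \<le> green x" by simp_all
qed

text \<open>The crude bound 2 agrees with \<open>abs_ker_le\<close>, so that both kernels fit the
  estimate \<open>integral_weight_diff_le\<close>.\<close>

lemma abs_green_le: "\<bar>green x\<bar> \<le> 2"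
  using green_le[of x] green_ge_0[of x] by simp

text \<open>The constant is the supremum of |\<open>dgreen\<close>|. Without an integer between x
  and y, the difference of the parabolas factors through a - b. Otherwise the distance is at least
  (1 - a) + b, which dominates both a (1 - a) and b (1 - b).\<close>

lemma green_lipschitz: "\<bar>green x - green y\<bar> \<le> \<bar>x - y\<bar> / 2"
proof -
  have *: "\<bar>green x - green y\<bar> \<le> \<bar>x - y\<bar> / 2" if "x \<le> y" for x y
  proof -
    obtain a b where fr: "a = frac x" "b = frac y" and ab: "0 \<le> a" "a < 1" "0 \<le> b" "b < 1"
      using frac_ge_0 frac_lt_1 by blast
    have xy: "x = of_int \<lfloor>x\<rfloor> + a" "y = of_int \<lfloor>y\<rfloor> + b" by (auto simp: frac_def fr)
    have fl: "\<lfloor>x\<rfloor> \<le> \<lfloor>y\<rfloor>" using that by (rule floor_mono)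
    show ?thesis
    proof (cases "\<lfloor>x\<rfloor> = \<lfloor>y\<rfloor>")
      case True
      have "green x - green y = (a - b) * (a + b - 1) / 2" by (simp add: green_def fr[symmetric] field_simps)
      also have "\<bar>\<dots>\<bar> = \<bar>a - b\<bar> * \<bar>a + b - 1\<bar> / 2" by (simp add: abs_mult)
      also have "\<dots> \<le> \<bar>a - b\<bar> * 1 / 2"
        using ab by (intro divide_right_mono mult_left_mono) linarith+
      also have "\<bar>a - b\<bar> = \<bar>x - y\<bar>" using xy True by (smt (verit))
      finally show ?thesis by simp
    next
      case False
      then have "real_of_int \<lfloor>y\<rfloor> \<ge> of_int \<lfloor>x\<rfloor> + 1" using fl by linarith
      then have d: "\<bar>x - y\<bar> \<ge> (1 - a) + b" using xy ab by linarith
      define P Q where "P = a * (1 - a)" and "Q = b * (1 - b)"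
      have "P \<le> 1 - a" unfolding P_def using ab by (simp add: mult_left_le_one_le)
      moreover have "Q \<le> b" unfolding Q_def using ab by (simp add: mult_left_le)
      moreover have "0 \<le> P" "0 \<le> Q"
        unfolding P_def Q_def using ab by (auto intro!: mult_nonneg_nonneg)
      ultimately have "\<bar>P - Q\<bar> \<le> (1 - a) + b" using ab by linarith
      moreover have "green x - green y = - (P - Q) / 2"
        by (simp add: green_def fr[symmetric] P_def Q_def field_simps)
      then have "\<bar>green x - green y\<bar> = \<bar>P - Q\<bar> / 2" by (simp add: abs_if)
      then show ?thesis using d \<open>\<bar>P - Q\<bar> \<le> (1 - a) + b\<close> by simp
    qed
  qed
  show ?thesis using *[of x y] *[of y x] by (cases "x \<le> y") (auto simp: abs_minus_commute)
qed

lemma continuous_on_green: "continuous_on S green"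
proof (rule lipschitz_on_continuous_on)
  show "(1/2)-lipschitz_on S green"
    by (rule lipschitz_onI) (use green_lipschitz in \<open>auto simp: dist_real_def\<close>)
qed

lemma measurable_green [measurable]: "green \<in> borel_measurable borel"
  by (rule borel_measurable_continuous_onI[OF continuous_on_green])

lemma measurable_dgreen [measurable]: "dgreen \<in> borel_measurable borel"
proof -
  have [measurable]: "(frac :: real \<Rightarrow> real) \<in> borel_measurable borel"
    unfolding frac_def[abs_def] by measurable
  have *: "dgreen = (\<lambda>x. if frac x = 0 then 0 else frac x - 1 / 2)"
    by (auto simp: dgreen_def fun_eq_iff)
  show ?thesis unfolding * by measurable
qed

section \<open>Derivatives of the kernels away from their corners\<close>

lemma eventually_floor_eq:
  fixes x :: real
  assumes "x \<notin> \<int>"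
  shows "\<forall>\<^sub>F y in nhds x. \<lfloor>y\<rfloor> = \<lfloor>x\<rfloor>"
proof -
  have "real_of_int \<lfloor>x\<rfloor> < x" using assms by (metis Ints_of_int of_int_floor_le order_le_less)
  then have "\<forall>\<^sub>F y in nhds x. y \<in> {of_int \<lfloor>x\<rfloor><..<of_int \<lfloor>x\<rfloor> + 1}"
    by (intro eventually_nhds_in_open) auto
  then show ?thesis by eventually_elim (auto simp: floor_eq_iff)
qed

lemma DERIV_dgreen:
  assumes "x \<notin> \<int>"
  shows "(dgreen has_real_derivative 1) (at x)"
proof -
  have o: "open (- \<int> :: real set)" using closed_Ints by (simp add: open_Compl)
  have "((\<lambda>y. y - of_int \<lfloor>x\<rfloor> - 1 / 2) has_real_derivative 1) (at x)"
    by (auto intro!: derivative_eq_intros)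
  moreover have "\<forall>\<^sub>F y in nhds x. dgreen y = y - of_int \<lfloor>x\<rfloor> - 1 / 2"
    using eventually_floor_eq[OF assms] eventually_nhds_in_open[OF o, of x, simplified, OF assms]
    by eventually_elim (auto simp: dgreen_def frac_def)
  ultimately show ?thesis by (rule DERIV_cong_ev[OF refl _ refl, THEN iffD2, rotated])
qed

lemma DERIV_green:
  assumes "x \<notin> \<int>"
  shows "(green has_real_derivative dgreen x) (at x)"
proof -
  let ?n = "real_of_int \<lfloor>x\<rfloor>"
  have "((\<lambda>y. (y - ?n) * (y - ?n - 1) / 2 + 13 / 12) has_real_derivative dgreen x) (at x)"
    using assms by (auto intro!: derivative_eq_intros simp: dgreen_def frac_def field_simps)
  moreover have "\<forall>\<^sub>F y in nhds x. green y = (y - ?n) * (y - ?n - 1) / 2 + 13 / 12"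
    using eventually_floor_eq[OF assms] by eventually_elim (simp add: green_def frac_def)
  ultimately show ?thesis by (rule DERIV_cong_ev[OF refl _ refl, THEN iffD2, rotated])
qed

text \<open>The exceptional set \<open>S\<close> accommodates the corners of \<open>green\<close>.\<close>

definition circle_deriv :: "(real \<Rightarrow> real) \<Rightarrow> (real \<Rightarrow> real) \<Rightarrow> bool" where
  "circle_deriv h h' \<longleftrightarrow> periodic1 h \<and> periodic1 h' \<and> continuous_on UNIV h \<and>
     h' \<in> borel_measurable borel \<and> (\<exists>B. \<forall>x. \<bar>h' x\<bar> \<le> B) \<and>
     (\<exists>S. (\<forall>a b. finite (S \<inter> {a..b})) \<and> (\<forall>x. x \<notin> S \<longrightarrow> (h has_real_derivative h' x) (at x)))"

lemma periodic1_bounded: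
  assumes "periodic1 h" "continuous_on UNIV h"
  obtains B where "\<And>x. \<bar>h x\<bar> \<le> (B::real)"
proof -
  have "compact (h ` {0..1})"
    by (rule compact_continuous_image) (use assms continuous_on_subset in auto)
  then obtain B where B: "\<forall>x\<in>{0..1}. norm (h x) \<le> B" by (auto dest!: compact_imp_bounded simp: bounded_iff)
  have "\<bar>h x\<bar> \<le> B" for x
    using B periodic1_frac[OF assms(1), of x] frac_ge_0[of x] frac_lt_1[of x]
    by (metis atLeastAtMost_iff less_imp_le real_norm_def)
  then show ?thesis using that by blast
qed

lemma finite_Ints_translate: "finite ({x::real. x - c \<in> \<int>} \<inter> {a..b})"
proof (rule finite_subset)
  show "{x. x - c \<in> \<int>} \<inter> {a..b} \<subseteq> (\<lambda>k. of_int k + c) ` {\<lceil>a - c\<rceil>..\<lfloor>b - c\<rfloor>}"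
  proof
    fix x assume x: "x \<in> {x. x - c \<in> \<int>} \<inter> {a..b}"
    then obtain k where k: "x - c = of_int k" by (auto elim!: Ints_cases)
    then have "x = of_int k + c" by simp
    moreover have "k \<in> {\<lceil>a - c\<rceil>..\<lfloor>b - c\<rfloor>}"
      using x k by (auto simp: ceiling_le_iff le_floor_iff)
    ultimately show "x \<in> (\<lambda>k. of_int k + c) ` {\<lceil>a - c\<rceil>..\<lfloor>b - c\<rfloor>}" by blast
  qed
qed simp

lemma circle_deriv_green: "circle_deriv (\<lambda>x. green (x - c)) (\<lambda>x. dgreen (x - c))"
  unfolding circle_deriv_def
proof (intro conjI)
  show "periodic1 (\<lambda>x. green (x - c))" "periodic1 (\<lambda>x. dgreen (x - c))"
    using periodic1_green periodic1_dgreen unfolding periodic1_def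
    by (metis add_diff_eq add.commute diff_add_eq)+
  show "continuous_on UNIV (\<lambda>x. green (x - c))"
    by (rule continuous_on_compose2[OF continuous_on_green[of UNIV]]) (auto intro!: continuous_intros)
  show "\<exists>B. \<forall>x. \<bar>dgreen (x - c)\<bar> \<le> B" using abs_dgreen_le by blast
  have "((\<lambda>x. green (x - c)) has_real_derivative dgreen (x - c)) (at x)" if "x - c \<notin> \<int>" for x
    using DERIV_green[OF that] DERIV_shift[of green "dgreen (x - c)" x "- c"] by simp
  then show "\<exists>S. (\<forall>a b. finite (S \<inter> {a..b})) \<and>
     (\<forall>x. x \<notin> S \<longrightarrow> ((\<lambda>x. green (x - c)) has_real_derivative dgreen (x - c)) (at x))"
    by (intro exI[of _ "{x. x - c \<in> \<int>}"]) (use finite_Ints_translate in auto)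
qed measurable

lemma circle_deriv_C1:
  assumes "periodic1 h" "periodic1 h'" "continuous_on UNIV h'"
    "\<And>x. (h has_real_derivative h' x) (at x)"
  shows "circle_deriv h h'"
  unfolding circle_deriv_def
proof (intro conjI)
  show "continuous_on UNIV h" using assms(4) DERIV_isCont continuous_at_imp_continuous_on by blast
  show "h' \<in> borel_measurable borel" by (rule borel_measurable_continuous_onI[OF assms(3)])
  show "\<exists>B. \<forall>x. \<bar>h' x\<bar> \<le> B" using periodic1_bounded[OF assms(2,3)] by metis
qed (use assms in \<open>auto intro!: exI[of _ "{}"]\<close>)

lemma circle_deriv_mult:
  assumes "circle_deriv h h'" "circle_deriv k k'"
  shows "circle_deriv (\<lambda>x. h x * k x) (\<lambda>x. h' x * k x + h x * k' x)"
proof -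
  note h = assms(1)[unfolded circle_deriv_def] and k = assms(2)[unfolded circle_deriv_def]
  obtain B1 B2 where B: "\<And>x. \<bar>h' x\<bar> \<le> B1" "\<And>x. \<bar>k' x\<bar> \<le> B2" using h k by metis
  obtain C1 where C1: "\<And>x. \<bar>h x\<bar> \<le> C1" using periodic1_bounded h by metis
  obtain C2 where C2: "\<And>x. \<bar>k x\<bar> \<le> C2" using periodic1_bounded k by metis
  obtain S where S: "\<And>a b. finite (S \<inter> {a..b})" "\<And>x. x \<notin> S \<Longrightarrow> (h has_real_derivative h' x) (at x)"
    using h by blast
  obtain T where T: "\<And>a b. finite (T \<inter> {a..b})" "\<And>x. x \<notin> T \<Longrightarrow> (k has_real_derivative k' x) (at x)"
    using k by blast
  have [measurable]: "h \<in> borel_measurable borel" "k \<in> borel_measurable borel"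
    "h' \<in> borel_measurable borel" "k' \<in> borel_measurable borel"
    using h k by (auto intro: borel_measurable_continuous_onI)
  show ?thesis unfolding circle_deriv_def
  proof (intro conjI)
    show "continuous_on UNIV (\<lambda>x. h x * k x)" using h k by (auto intro!: continuous_intros)
    have "\<bar>h' x * k x + h x * k' x\<bar> \<le> B1 * C2 + C1 * B2" for x
      by (rule order_trans[OF abs_triangle_ineq])
         (unfold abs_mult, use B C1 C2 abs_ge_zero order_trans in \<open>(intro add_mono mult_mono; blast)\<close>)
    then show "\<exists>B. \<forall>x. \<bar>h' x * k x + h x * k' x\<bar> \<le> B" by blast
    have "(S \<union> T) \<inter> {a..b} = S \<inter> {a..b} \<union> T \<inter> {a..b}" for a b by blast
    then show "\<exists>S. (\<forall>a b. finite (S \<inter> {a..b})) \<and> (\<forall>x. x \<notin> S \<longrightarrow>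
        ((\<lambda>x. h x * k x) has_real_derivative h' x * k x + h x * k' x) (at x))"
      using S(1) T(1) DERIV_mult'[OF S(2) T(2)]
      by (intro exI[of _ "S \<union> T"]) (auto simp: add.commute)
  qed (use h k in \<open>auto simp: periodic1_def\<close>)
qed

text \<open>Subtracting \<open>h c\<close> cancels the jump of \<open>dgreen (x - c)\<close> at \<open>x = c\<close>.\<close>

lemma circle_deriv_dgreen_mult:
  assumes d: "circle_deriv h h'"
  shows "circle_deriv (\<lambda>x. dgreen (x - c) * (h x - h c)) (\<lambda>x. h x - h c + dgreen (x - c) * h' x)"
proof -
  note h = d[unfolded circle_deriv_def]
  obtain B where B: "\<And>x. \<bar>h' x\<bar> \<le> B" using h by metis
  obtain C where C: "\<And>x. \<bar>h x\<bar> \<le> C" using periodic1_bounded h by metis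
  obtain S where S: "\<And>a b. finite (S \<inter> {a..b})" "\<And>x. x \<notin> S \<Longrightarrow> (h has_real_derivative h' x) (at x)"
    using h by blast
  have [measurable]: "h \<in> borel_measurable borel" "h' \<in> borel_measurable borel"
    using h by (auto intro: borel_measurable_continuous_onI)
  have per: "periodic1 (\<lambda>x. dgreen (x - c))"
    using circle_deriv_green[of c] by (simp add: circle_deriv_def)
  have D: "((\<lambda>x. dgreen (x - c)) has_real_derivative 1) (at x)" if "x - c \<notin> \<int>" for x
    using DERIV_dgreen[OF that] DERIV_shift[of dgreen 1 x "- c"] by simp
  show ?thesis unfolding circle_deriv_def
  proof (intro conjI)
    show "periodic1 (\<lambda>x. dgreen (x - c) * (h x - h c))"
      "periodic1 (\<lambda>x. h x - h c + dgreen (x - c) * h' x)"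
      using per h by (auto simp: periodic1_def)
    have "isCont (\<lambda>x. dgreen (x - c) * (h x - h c)) x" for x
    proof (cases "x - c \<in> \<int>")
      case True
      then obtain n where n: "x - c = of_int n" by (auto elim: Ints_cases)
      then have "x = c + of_int n" by simp
      then have hx: "h x = h c" using periodic1_add_int[of h c n] h by simp
      have "((\<lambda>y. dgreen (y - c) * (h y - h c)) \<longlongrightarrow> 0) (at x)"
      proof (rule Lim_null_comparison)
        show "\<forall>\<^sub>F y in at x. norm (dgreen (y - c) * (h y - h c)) \<le> 1 / 2 * \<bar>h y - h x\<bar>"
          by (intro always_eventually allI)
             (unfold hx real_norm_def abs_mult, intro mult_right_mono abs_dgreen_le abs_ge_zero)
        have "isCont h x" using h by (simp add: continuous_on_eq_continuous_at)
        then show "((\<lambda>y. 1 / 2 * \<bar>h y - h x\<bar>) \<longlongrightarrow> 0) (at x)"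
          unfolding isCont_def by (intro tendsto_eq_intros) auto
      qed
      then show ?thesis using hx by (simp add: isCont_def)
    next
      case False
      have "isCont h x" using h by (simp add: continuous_on_eq_continuous_at)
      then show ?thesis using DERIV_isCont[OF D[OF False]] by (intro continuous_intros)
    qed
    then show "continuous_on UNIV (\<lambda>x. dgreen (x - c) * (h x - h c))"
      by (simp add: continuous_at_imp_continuous_on)
    have "\<bar>h x - h c + dgreen (x - c) * h' x\<bar> \<le> (C + C) + 1/2 * B" for x
    proof (rule order_trans[OF abs_triangle_ineq add_mono])
      show "\<bar>h x - h c\<bar> \<le> C + C" using C[of x] C[of c] by linarith
      have "0 \<le> B" using B abs_ge_zero order_trans by blast
      then show "\<bar>dgreen (x - c) * h' x\<bar> \<le> 1/2 * B"
        unfolding abs_mult using B abs_dgreen_le by (intro mult_mono) auto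
    qed
    then show "\<exists>B. \<forall>x. \<bar>h x - h c + dgreen (x - c) * h' x\<bar> \<le> B" by blast
    have "(S \<union> {x. x - c \<in> \<int>}) \<inter> {a..b} = S \<inter> {a..b} \<union> {x. x - c \<in> \<int>} \<inter> {a..b}" for a b by blast
    then show "\<exists>S. (\<forall>a b. finite (S \<inter> {a..b})) \<and> (\<forall>x. x \<notin> S \<longrightarrow>
        ((\<lambda>x. dgreen (x - c) * (h x - h c)) has_real_derivative h x - h c + dgreen (x - c) * h' x) (at x))"
      using S(1) finite_Ints_translate DERIV_mult'[OF D DERIV_diff[OF S(2) DERIV_const[of "h c"]]]
      by (intro exI[of _ "S \<union> {x. x - c \<in> \<int>}"]) (auto simp: add.commute)
  qed measurable
qed

section \<open>Integration by parts against the kernels\<close>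

lemma circle_deriv_translate:
  assumes "circle_deriv h h'"
  shows "circle_deriv (\<lambda>x. h (x + a)) (\<lambda>x. h' (x + a))"
proof -
  note h = assms[unfolded circle_deriv_def]
  obtain S where S: "\<And>a b. finite (S \<inter> {a..b})" "\<And>x. x \<notin> S \<Longrightarrow> (h has_real_derivative h' x) (at x)"
    using h by blast
  have [measurable]: "h' \<in> borel_measurable borel" using h by auto
  show ?thesis unfolding circle_deriv_def
  proof (intro conjI)
    show "periodic1 (\<lambda>x. h (x + a))" "periodic1 (\<lambda>x. h' (x + a))"
      using h unfolding periodic1_def by (metis add.assoc add.commute)+
    show "continuous_on UNIV (\<lambda>x. h (x + a))"
      using h by (auto intro!: continuous_intros intro: continuous_on_compose2)
    have "finite ((\<lambda>x. x - a) ` (S \<inter> {b + a..c + a}))" for b c using S by blast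
    moreover have "{x. x + a \<in> S} \<inter> {b..c} \<subseteq> (\<lambda>x. x - a) ` (S \<inter> {b + a..c + a})" for b c
      by (auto intro!: image_eqI[of _ _ "_ + a"])
    ultimately have "finite ({x. x + a \<in> S} \<inter> {b..c})" for b c by (meson finite_subset)
    moreover have "((\<lambda>x. h (x + a)) has_real_derivative h' (x + a)) (at x)" if "x + a \<notin> S" for x
      using S(2)[OF that] by (simp add: DERIV_shift)
    ultimately show "\<exists>S. (\<forall>a b. finite (S \<inter> {a..b})) \<and> (\<forall>x. x \<notin> S \<longrightarrow>
        ((\<lambda>x. h (x + a)) has_real_derivative h' (x + a)) (at x))"
      by (intro exI[of _ "{x. x + a \<in> S}"]) auto
  qed (use h in \<open>auto\<close>)
qed

text \<open>\<open>G0\<close> is the periodic kernel and \<open>G\<close> its continuous extension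
  from (0, 1) to [0, 1]. The two may differ at the endpoints, so that a jump of the kernel at the
  integers survives as the boundary term, which is the Dirac mass in its derivative.\<close>

lemma circle_deriv_integral:
  assumes "circle_deriv h h'" "G0 \<in> borel_measurable borel" "G1 \<in> borel_measurable borel"
    and "\<And>x. \<bar>G0 x\<bar> \<le> K" "\<And>x. \<bar>G1 x\<bar> \<le> L" "continuous_on {0..1} G"
    and "\<And>x. 0 < x \<Longrightarrow> x < 1 \<Longrightarrow> G x = G0 x"
    and "\<And>x. 0 < x \<Longrightarrow> x < 1 \<Longrightarrow> (G has_real_derivative G1 x) (at x)"
  shows "(LINT x|circle. G0 x * h' x) = (G 1 - G 0) * h 0 - (LINT x|circle. G1 x * h x)"
proof -
  note h = assms(1)[unfolded circle_deriv_def]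
  obtain B where B: "\<And>x. \<bar>h' x\<bar> \<le> B" using h by metis
  obtain C where C: "\<And>x. \<bar>h x\<bar> \<le> C" using periodic1_bounded h by metis
  obtain S where S: "\<And>a b. finite (S \<inter> {a..b})" "\<And>x. x \<notin> S \<Longrightarrow> (h has_real_derivative h' x) (at x)"
    using h by blast
  have [measurable]: "h \<in> borel_measurable borel" "h' \<in> borel_measurable borel"
    using h by (auto intro: borel_measurable_continuous_onI)
  note [measurable] = assms(2,3)
  have b0: "\<bar>G0 x * h' x\<bar> \<le> K * B" and b1: "\<bar>G1 x * h x\<bar> \<le> L * C" for x
    unfolding abs_mult using assms(4,5) B C
    by (auto intro!: mult_mono) (use abs_ge_zero order_trans in blast)+
  have fin: "finite (S \<inter> {0..1} \<union> {0, 1})" using S by auto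
  have "((\<lambda>x. G1 x * h x + G0 x * h' x) has_integral (G 1 * h 1 - G 0 * h 0)) {0..1}"
  proof (rule fundamental_theorem_of_calculus_strong[OF fin])
    show "continuous_on {0..1} (\<lambda>x. G x * h x)"
      using h assms(6) by (intro continuous_intros) (auto intro: continuous_on_subset)
    fix x assume x: "x \<in> {0..1} - (S \<inter> {0..1} \<union> {0, 1::real})"
    then have "0 < x" "x < 1" "x \<notin> S" by auto
    then show "((\<lambda>x. G x * h x) has_vector_derivative G1 x * h x + G0 x * h' x) (at x)"
      using assms(7,8) S(2) unfolding has_real_derivative_iff_has_vector_derivative[symmetric]
      by (auto intro!: derivative_eq_intros)
  qed simp
  then have "(LINT x|circle. G1 x * h x + G0 x * h' x) = G 1 * h 1 - G 0 * h 0"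
    by (intro integral_circle_has_integral[where B = "L * C + K * B"] order_trans[OF abs_triangle_ineq] add_mono)
       (use b0 b1 in auto)
  moreover have "(LINT x|circle. G1 x * h x + G0 x * h' x) =
      (LINT x|circle. G1 x * h x) + (LINT x|circle. G0 x * h' x)"
    by (rule Bochner_Integration.integral_add; rule integrable_bounded[OF finite_measure_circle])
       (use b0 b1 in auto)
  moreover have "h 1 = h 0" using h unfolding periodic1_def by (metis add_0)
  ultimately show ?thesis by (simp add: algebra_simps)
qed

text \<open>The shift moves the corner of the kernel to the ends of the fundamental domain, where
  \<open>circle_deriv_integral\<close> tolerates it.\<close>

lemma shift_kernel:
  fixes k f :: "real \<Rightarrow> real"
  assumes "periodic1 k" "k \<in> borel_measurable borel" "\<And>x. \<bar>k x\<bar> \<le> B0"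
    "periodic1 f" "f \<in> borel_measurable borel" "\<And>x. \<bar>f x\<bar> \<le> B"
  shows "(LINT x|circle. k (x - a) * f x) = (LINT x|circle. k x * f (x + a))"
proof -
  note [measurable] = assms(2,5)
  have "(LINT x|circle. k (x + a - a) * f (x + a)) = (LINT x|circle. k (x - a) * f x)"
  proof (rule integral_circle_shift[where f = "\<lambda>x. k (x - a) * f x"])
    show "periodic1 (\<lambda>x. k (x - a) * f x)"
      using assms(1,4) unfolding periodic1_def by (metis add_diff_eq add.commute diff_add_eq)
    show "\<bar>k (x - a) * f x\<bar> \<le> B0 * B" for x
      unfolding abs_mult using assms(3,6) by (intro mult_mono) (auto intro: order_trans[OF abs_ge_zero])
  qed measurable
  then show ?thesis by simp
qed

lemma green_by_parts:
  assumes "circle_deriv h h'"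
  shows "(LINT x|circle. green (x - a) * h' x) = - (LINT x|circle. dgreen (x - a) * h x)"
proof -
  note h = assms[unfolded circle_deriv_def]
  obtain B where B: "\<And>x. \<bar>h' x\<bar> \<le> B" using h by metis
  obtain C where C: "\<And>x. \<bar>h x\<bar> \<le> C" using periodic1_bounded h by metis
  have [measurable]: "h \<in> borel_measurable borel" using h by (auto intro: borel_measurable_continuous_onI)
  have "(LINT x|circle. green x * h' (x + a)) =
      (green 1 - green 0) * h (0 + a) - (LINT x|circle. dgreen x * h (x + a))"
  proof (rule circle_deriv_integral[OF circle_deriv_translate[OF assms], where K = 2 and L = "1/2"])
    fix x :: real assume "0 < x" "x < 1"
    then have "x \<notin> \<int>" using frac_eq[of x] frac_eq_0_iff[of x] by auto
    then show "(green has_real_derivative dgreen x) (at x)" by (rule DERIV_green)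
  qed (use abs_green_le abs_dgreen_le continuous_on_green in auto)
  moreover have "green 1 = green 0" by (simp add: green_unit)
  ultimately show ?thesis
    using shift_kernel[of green 2 h' B a] periodic1_green abs_green_le B C
      shift_kernel[of dgreen "1/2" h C a] periodic1_dgreen abs_dgreen_le h by simp
qed

text \<open>In distributional terms the derivative of \<open>dgreen\<close> is 1 minus the Dirac
  mass at the corner. The point value \<open>h a\<close> is the boundary term of x - 1/2, which
  rises by 1 over a period.\<close>

lemma dgreen_by_parts:
  assumes "circle_deriv h h'"
  shows "(LINT x|circle. dgreen (x - a) * h' x) = h a - (LINT x|circle. h x)"
proof -
  note h = assms[unfolded circle_deriv_def]
  obtain B where B: "\<And>x. \<bar>h' x\<bar> \<le> B" using h by metis
  obtain C where C: "\<And>x. \<bar>h x\<bar> \<le> C" using periodic1_bounded h by metis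
  have [measurable]: "h \<in> borel_measurable borel" using h by (auto intro: borel_measurable_continuous_onI)
  have "(LINT x|circle. dgreen x * h' (x + a)) =
      ((1 - 1/2) - (0 - 1/2)) * h (0 + a) - (LINT x|circle. 1 * h (x + a))"
    by (rule circle_deriv_integral[OF circle_deriv_translate[OF assms],
          where K = "1/2" and L = 1 and G = "\<lambda>x. x - 1/2"])
       (use abs_dgreen_le in \<open>auto simp: dgreen_unit intro!: continuous_intros derivative_eq_intros\<close>)
  then show ?thesis
    using shift_kernel[of dgreen "1/2" h' B a] periodic1_dgreen abs_dgreen_le B C
      integral_circle_shift[of h C a] h by simp
qed

text \<open>The parabola contributes -1/12, so the constant 13/12 in \<open>green\<close> normalises
  the mean to 1; the mean of a potential is then the mass of its source.\<close>

lemma integral_green [simp]: "(LINT x|circle. green (x - a)) = 1"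
proof -
  have "((\<lambda>x. green x) has_integral 1) {0..1}"
  proof (rule has_integral_eq)
    show "((\<lambda>x. x * (x - 1) / 2 + 13 / 12) has_integral 1) {0..1::real}"
    proof -
      have "((\<lambda>x. x^3/6 - x^2/4 + 13/12*x) has_real_derivative x * (x - 1) / 2 + 13 / 12)
          (at x within {0..1})" for x :: real
        by (auto intro!: derivative_eq_intros simp: field_simps power2_eq_square)
      then show ?thesis
        using fundamental_theorem_of_calculus[of 0 1 "\<lambda>x. x^3/6 - x^2/4 + 13/12*x"
          "\<lambda>x. x * (x - 1) / 2 + 13 / 12 :: real"]
        by (simp add: has_real_derivative_iff_has_vector_derivative[symmetric])
    qed
  qed (simp add: green_unit)
  then have "(LINT x|circle. green x) = 1"
    by (intro integral_circle_has_integral[where B = 2]) (use abs_green_le in auto)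
  moreover have "(LINT x|circle. green (x + - a)) = (LINT x|circle. green x)"
    by (rule integral_circle_shift[OF periodic1_green _ abs_green_le]) measurable
  ultimately show ?thesis by simp
qed

lemma integral_dgreen [simp]: "(LINT x|circle. dgreen (x - a)) = 0"
  using green_by_parts[of "\<lambda>_. 1" "\<lambda>_. 0" a]
  by (simp add: circle_deriv_C1 periodic1_def)

text \<open>One factor is the derivative of \<open>green (x - b)\<close>, so
  \<open>dgreen_by_parts\<close> applies. Integrated over pairs, this turns the energy of u_x into
  the Hamiltonian of the particles.\<close>

lemma integral_dgreen_dgreen:
  "(LINT x|circle. dgreen (x - a) * dgreen (x - b)) = green (a - b) - 1"
  by (simp add: dgreen_by_parts[OF circle_deriv_green])

section \<open>Potentials of finite measures\<close>

text \<open>The source lives on the line and not on the circle, since particle positions are never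
  reduced modulo 1; the periodic kernels identify the copies.\<close>

definition pot :: "real measure \<Rightarrow> real \<Rightarrow> real" where
  "pot Y x = (LINT a|Y. green (x - a))"

definition dpot :: "real measure \<Rightarrow> real \<Rightarrow> real" where
  "dpot Y x = (LINT a|Y. dgreen (x - a))"

text \<open>After a shift of the integration variable, y enters only through the C1 function h and
  no longer through the kernel with its corner, so the Leibniz rule applies.\<close>

lemma has_derivative_green_conv:
  assumes h: "periodic1 h" "periodic1 h'" "continuous_on UNIV h'"
    "\<And>x. (h has_real_derivative h' x) (at x)"
  shows "((\<lambda>y. LINT x|circle. green (x - y) * h x) has_real_derivative
    (LINT x|circle. green (x - y) * h' x)) (at y)"
proof -
  have ch: "continuous_on UNIV h" using h(4) DERIV_isCont continuous_at_imp_continuous_on by blast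
  have *: "(LINT x|circle. green (x - y) * k x) = integral (cbox 0 1) (\<lambda>x. green x * k (x + y))"
    if k: "periodic1 k" "continuous_on UNIV k" for k y
  proof -
    obtain C where C: "\<And>x. \<bar>k x\<bar> \<le> C" using periodic1_bounded[OF k] by metis
    have [measurable]: "k \<in> borel_measurable borel" by (rule borel_measurable_continuous_onI[OF k(2)])
    have "(LINT x|circle. green (x - y) * k x) = (LINT x|circle. green x * k (x + y))"
      by (rule shift_kernel[OF periodic1_green measurable_green abs_green_le k(1) _ C]) measurable
    also have "\<dots> = integral {0..1} (\<lambda>x. green x * k (x + y))"
      by (rule integral_circle_eq[where B = "2 * C"])
         (auto simp: abs_mult intro!: mult_mono abs_green_le C order_trans[OF abs_ge_zero C])
    finally show ?thesis by simp
  qed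
  have "((\<lambda>y. integral (cbox 0 1) (\<lambda>x. green x * h (x + y))) has_field_derivative
      integral (cbox 0 1) (\<lambda>x. green x * h' (x + y))) (at y within UNIV)"
  proof (rule leibniz_rule_field_derivative)
    show "((\<lambda>y. green x * h (x + y)) has_real_derivative green x * h' (x + y)) (at y within UNIV)" for x y
      using DERIV_shift[of h "h' (x + y)" y x] h(4)[of "x + y"]
      by (auto intro!: DERIV_cmult simp: add.commute)
    show "(\<lambda>x. green x * h (x + y)) integrable_on cbox 0 1" for y
      by (rule integrable_continuous)
         (auto intro!: continuous_intros continuous_on_green continuous_on_compose2[OF ch])
    show "continuous_on (UNIV \<times> cbox 0 1) (\<lambda>(y, x). green x * h' (x + y))"
      unfolding split_beta
      by (intro continuous_intros continuous_on_compose2[OF continuous_on_green[of UNIV]]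
          continuous_on_compose2[OF h(3)]) auto
  qed auto
  then show ?thesis using *[OF h(1) ch] *[OF h(2,3)] by simp
qed

lemma periodic1_green_conv: "periodic1 (\<lambda>y. LINT x|circle. green (x - y) * h x)"
proof -
  have "green (x - (y + 1)) = green (x - y)" for x y
    using periodic1_add_int[OF periodic1_green, of "x - y" "-1"] by (simp add: algebra_simps)
  then show ?thesis by (simp add: periodic1_def)
qed

lemma measurable_convolution:
  fixes k :: "real \<Rightarrow> real"
  assumes "finite_measure Y" "sets Y = sets borel" and [measurable]: "k \<in> borel_measurable borel"
  shows "(\<lambda>x. LINT a|Y. k (x - a)) \<in> borel_measurable borel"
proof -
  interpret Y: finite_measure Y by fact
  have [measurable_cong]: "sets Y = sets borel" by fact
  show ?thesis by measurable
qed

lemma integrable_circle_bounded: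
  fixes f :: "real \<Rightarrow> real"
  assumes "f \<in> borel_measurable borel" "\<And>x. \<bar>f x\<bar> \<le> B"
  shows "integrable circle f"
  by (rule integrable_bounded[OF finite_measure_circle measurable_circleI]) (use assms in auto)

lemma convolution_swap:
  fixes k :: "real \<Rightarrow> real"
  assumes Y: "finite_measure Y" "sets Y = sets borel"
    and k[measurable]: "k \<in> borel_measurable borel" and f[measurable]: "f \<in> borel_measurable borel"
    and bd: "\<And>x. \<bar>k x\<bar> \<le> K" "\<And>x. \<bar>f x\<bar> \<le> L"
  shows "(LINT x|circle. (LINT a|Y. k (x - a)) * f x) = (LINT a|Y. LINT x|circle. k (x - a) * f x)"
    and "(\<lambda>a. LINT x|circle. k (x - a) * f x) \<in> borel_measurable borel"
    and "integrable Y (\<lambda>a. LINT x|circle. k (x - a) * f x)"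
proof -
  interpret C: finite_measure circle by (rule finite_measure_circle)
  have [measurable_cong]: "sets Y = sets borel" "sets circle = sets (restrict_space borel {0..<1::real})"
    using Y sets_circle by auto
  have [measurable]: "(\<lambda>x. x) \<in> measurable (restrict_space borel {0..<1::real}) borel"
    by (rule measurable_restrict_space1) simp
  have m: "(\<lambda>(x, a). k (x - a) * f x) \<in> borel_measurable (circle \<Otimes>\<^sub>M Y)" by measurable
  have b: "\<bar>k (x - a) * f x\<bar> \<le> K * L" for x a
    unfolding abs_mult using bd by (intro mult_mono) (auto intro: order_trans[OF abs_ge_zero])
  note F = fubini_bounded[OF finite_measure_circle Y(1) m b]
  show "(LINT x|circle. (LINT a|Y. k (x - a)) * f x) = (LINT a|Y. LINT x|circle. k (x - a) * f x)"
    using F(3) by simp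
  show "integrable Y (\<lambda>a. LINT x|circle. k (x - a) * f x)" by (rule F(2))
  have m: "(\<lambda>(a, x). k (x - a) * f x) \<in> borel_measurable (borel \<Otimes>\<^sub>M circle)" by measurable
  show "(\<lambda>a. LINT x|circle. k (x - a) * f x) \<in> borel_measurable borel"
    using C.borel_measurable_lebesgue_integral[OF m] by simp
qed

section \<open>Potentials of a fixed finite source\<close>

locale source =
  fixes Y :: "real measure"
  assumes fin: "finite_measure Y" and sets_Y [measurable_cong]: "sets Y = sets borel"
begin

sublocale finite_measure Y by (rule fin)

definition mass :: real where "mass = measure Y UNIV"

lemma space_Y [simp]: "space Y = UNIV"
  using sets_eq_imp_space_eq[OF sets_Y] by simp

lemma mass_nonneg: "0 \<le> mass"
  by (simp add: mass_def)

lemma measurable_pot [measurable]: "pot Y \<in> borel_measurable borel"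
  and measurable_dpot [measurable]: "dpot Y \<in> borel_measurable borel"
  unfolding pot_def[abs_def] dpot_def[abs_def]
  by (rule measurable_convolution[OF fin sets_Y measurable_green]
      measurable_convolution[OF fin sets_Y measurable_dgreen])+

lemma abs_pot_le: "\<bar>pot Y x\<bar> \<le> 2 * mass"
  unfolding pot_def mass_def using abs_integral_bounded[OF fin, of "\<lambda>a. green (x - a)" 2] abs_green_le
  by simp

lemma abs_dpot_le: "\<bar>dpot Y x\<bar> \<le> mass"
  unfolding dpot_def mass_def
  using abs_integral_bounded[OF fin, of "\<lambda>a. dgreen (x - a)" 1] order_trans[OF abs_dgreen_le, of 1]
  by simp

lemma periodic1_pot: "periodic1 (pot Y)"
  using circle_deriv_green by (simp add: pot_def circle_deriv_def periodic1_def)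

lemma periodic1_dpot: "periodic1 (dpot Y)"
  using circle_deriv_green by (simp add: dpot_def circle_deriv_def periodic1_def)

lemma integrable_green: "integrable Y (\<lambda>a. green (x - a))"
  by (rule integrable_bounded[OF fin, where B = 2]) (use abs_green_le in auto)

lemma mean_pot: "mean (pot Y) = mass"
  using convolution_swap(1)[OF fin sets_Y measurable_green _ abs_green_le, of "\<lambda>_. 1" 1]
  by (simp add: mean_def pot_def[abs_def] mass_def)

lemma circle_derivD:
  assumes "circle_deriv h h'"
  shows "h \<in> borel_measurable borel" "h' \<in> borel_measurable borel"
    and "\<exists>C. \<forall>x. \<bar>h x\<bar> \<le> C" "\<exists>B. \<forall>x. \<bar>h' x\<bar> \<le> B"
proof -
  note h = assms[unfolded circle_deriv_def]
  show "h \<in> borel_measurable borel" "h' \<in> borel_measurable borel" "\<exists>B. \<forall>x. \<bar>h' x\<bar> \<le> B"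
    using h by (auto intro: borel_measurable_continuous_onI)
  obtain C where "\<And>x. \<bar>h x\<bar> \<le> C" using periodic1_bounded h by metis
  then show "\<exists>C. \<forall>x. \<bar>h x\<bar> \<le> C" by blast
qed

lemma integrable_source:
  assumes "circle_deriv h h'"
  shows "integrable Y h"
proof -
  obtain C where C: "\<And>x. \<bar>h x\<bar> \<le> C" using circle_derivD[OF assms] by metis
  have [measurable]: "h \<in> borel_measurable borel" by (rule circle_derivD[OF assms])
  show ?thesis by (rule integrable_bounded[OF fin _ C]) measurable
qed

lemma pot_by_parts:
  assumes "circle_deriv h h'"
  shows "(LINT x|circle. pot Y x * h' x) = - (LINT x|circle. dpot Y x * h x)"
proof -
  obtain C B where b: "\<And>x. \<bar>h x\<bar> \<le> C" "\<And>x. \<bar>h' x\<bar> \<le> B" using circle_derivD[OF assms] by metis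
  show ?thesis
    using convolution_swap(1)[OF fin sets_Y measurable_green circle_derivD(2)[OF assms] abs_green_le b(2)]
      convolution_swap(1)[OF fin sets_Y measurable_dgreen circle_derivD(1)[OF assms] abs_dgreen_le b(1)]
    by (simp add: pot_def dpot_def green_by_parts[OF assms])
qed

text \<open>Integrating \<open>dgreen_by_parts\<close> over the source turns the point value into an
  integral over Y. With \<open>pot_by_parts\<close> and \<open>mean_pot\<close> this says that Y is
  the momentum of its own potential.\<close>

lemma dpot_by_parts:
  assumes "circle_deriv h h'"
  shows "(LINT x|circle. dpot Y x * h' x) = (LINT a|Y. h a) - mass * (LINT x|circle. h x)"
proof -
  obtain C B where b: "\<And>x. \<bar>h x\<bar> \<le> C" "\<And>x. \<bar>h' x\<bar> \<le> B" using circle_derivD[OF assms] by metis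
  show ?thesis
    using convolution_swap(1)[OF fin sets_Y measurable_dgreen circle_derivD(2)[OF assms] abs_dgreen_le b(2)]
      integrable_source[OF assms]
    by (simp add: dpot_def dgreen_by_parts[OF assms] mass_def)
qed

section \<open>Quadratic identities for potentials\<close>

text \<open>This reduces an identity for a product of two potentials to one for a pair of kernels
  with corners at a and b.\<close>

lemma convolution_swap2:
  fixes k l c :: "real \<Rightarrow> real"
  assumes k[measurable]: "k \<in> borel_measurable borel" and l[measurable]: "l \<in> borel_measurable borel"
    and c[measurable]: "c \<in> borel_measurable borel"
    and bd: "\<And>x. \<bar>k x\<bar> \<le> K" "\<And>x. \<bar>l x\<bar> \<le> L" "\<And>x. \<bar>c x\<bar> \<le> B"
  shows "(LINT x|circle. (LINT a|Y. k (x - a)) * ((LINT b|Y. l (x - b)) * c x)) =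
    (LINT a|Y. LINT b|Y. LINT x|circle. k (x - a) * (l (x - b) * c x))"
proof -
  have [measurable]: "(\<lambda>x. LINT b|Y. l (x - b)) \<in> borel_measurable borel"
    by (rule measurable_convolution[OF fin sets_Y l])
  have L0: "0 \<le> L" using order_trans[OF abs_ge_zero bd(2)] .
  have "\<bar>LINT b|Y. l (x - b)\<bar> \<le> L * mass" for x
    using abs_integral_bounded[OF fin, of "\<lambda>b. l (x - b)" L] bd L0 by (simp add: mass_def)
  then have b1: "\<bar>(LINT b|Y. l (x - b)) * c x\<bar> \<le> L * mass * B" for x
    unfolding abs_mult using bd(3) by (intro mult_mono) (auto simp: L0 mass_nonneg)
  have b2: "\<bar>k (x - a) * c x\<bar> \<le> K * B" for x a
    unfolding abs_mult using bd by (intro mult_mono) (auto intro: order_trans[OF abs_ge_zero])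
  have "(LINT x|circle. (LINT a|Y. k (x - a)) * ((LINT b|Y. l (x - b)) * c x)) =
      (LINT a|Y. LINT x|circle. k (x - a) * ((LINT b|Y. l (x - b)) * c x))"
    by (rule convolution_swap(1)[OF fin sets_Y k _ bd(1) b1]) measurable
  also have "\<dots> = (LINT a|Y. LINT b|Y. LINT x|circle. k (x - a) * (l (x - b) * c x))"
  proof (rule Bochner_Integration.integral_cong[OF refl])
    fix a
    have "(LINT x|circle. (LINT b|Y. l (x - b)) * (k (x - a) * c x)) =
      (LINT b|Y. LINT x|circle. l (x - b) * (k (x - a) * c x))"
      by (rule convolution_swap(1)[OF fin sets_Y l _ bd(2) b2]) measurable
    then show "(LINT x|circle. k (x - a) * ((LINT b|Y. l (x - b)) * c x)) =
      (LINT b|Y. LINT x|circle. k (x - a) * (l (x - b) * c x))" by (simp add: algebra_simps)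
  qed
  finally show ?thesis .
qed

lemma integral_source_swap:
  fixes F :: "real \<Rightarrow> real \<Rightarrow> real"
  assumes "(\<lambda>(a, b). F a b) \<in> borel_measurable (borel \<Otimes>\<^sub>M borel)" "\<And>a b. \<bar>F a b\<bar> \<le> K"
  shows "(LINT a|Y. LINT b|Y. F a b) = (LINT b|Y. LINT a|Y. F a b)"
proof (rule fubini_bounded(3)[OF fin fin])
  have "sets (Y \<Otimes>\<^sub>M Y) = sets (borel \<Otimes>\<^sub>M borel)" by (rule sets_pair_measure_cong[OF sets_Y sets_Y])
  from measurable_cong_sets[OF this refl] assms(1)
  show "(\<lambda>(a, b). F a b) \<in> borel_measurable (Y \<Otimes>\<^sub>M Y)" by blast
qed (use assms in auto)

text \<open>The right-hand side is the Hamiltonian of the particles minus the squared mass; the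
  decay law for u_x rests on this.\<close>

lemma integral_dpot_sq: "(LINT x|circle. (dpot Y x)\<^sup>2) = (LINT a|Y. pot Y a) - mass\<^sup>2"
proof -
  have i: "integrable Y (\<lambda>b. green (a - b))" for a by (rule integrable_green)
  have ip: "integrable Y (pot Y)"
    by (rule integrable_bounded[OF fin _ abs_pot_le]) measurable
  have "(LINT x|circle. (dpot Y x)\<^sup>2) = (LINT x|circle. dpot Y x * (dpot Y x * 1))"
    by (simp add: power2_eq_square)
  also have "\<dots> = (LINT a|Y. LINT b|Y. LINT x|circle. dgreen (x - a) * (dgreen (x - b) * 1))"
    unfolding dpot_def by (rule convolution_swap2[OF _ _ _ abs_dgreen_le abs_dgreen_le, where c = "\<lambda>_. 1" and B = 1]) auto
  also have "\<dots> = (LINT a|Y. pot Y a - mass)"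
    by (simp add: integral_dgreen_dgreen i pot_def mass_def)
  also have "\<dots> = (LINT a|Y. pot Y a) - mass\<^sup>2"
    using ip by (simp add: mass_def power2_eq_square)
  finally show ?thesis .
qed

text \<open>Formally this integrates the derivative of the periodic function u^2 / 2. The potential
  itself may fail \<open>circle_deriv\<close>, so the integration by parts is done for each pair of
  kernels; it exchanges their roles with a minus sign, and the double integral equals its own
  negative.\<close>

lemma integral_pot_dpot: "(LINT x|circle. pot Y x * dpot Y x) = 0"
proof -
  have "(LINT x|circle. pot Y x * (dpot Y x * 1)) =
      (LINT a|Y. LINT b|Y. LINT x|circle. green (x - a) * (dgreen (x - b) * 1))"
    unfolding pot_def dpot_def
    by (rule convolution_swap2[OF _ _ _ abs_green_le abs_dgreen_le, where c = "\<lambda>_. 1" and B = 1]) auto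
  also have "\<dots> = (LINT a|Y. LINT b|Y. - (LINT x|circle. dgreen (x - a) * (green (x - b) * 1)))"
    using green_by_parts[OF circle_deriv_green] by simp
  also have "\<dots> = - (LINT a|Y. LINT b|Y. LINT x|circle. dgreen (x - a) * (green (x - b) * 1))"
    by (simp only: Bochner_Integration.integral_minus)
  also have "(LINT a|Y. LINT b|Y. LINT x|circle. dgreen (x - a) * (green (x - b) * 1)) =
      (LINT x|circle. dpot Y x * (pot Y x * 1))"
    unfolding pot_def dpot_def
    by (rule convolution_swap2[symmetric, OF _ _ _ abs_dgreen_le abs_green_le, where c = "\<lambda>_. 1" and B = 1]) auto
  also have "(LINT x|circle. dpot Y x * (pot Y x * 1)) = (LINT x|circle. pot Y x * (dpot Y x * 1))"
    by (rule Bochner_Integration.integral_cong) auto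
  finally show ?thesis by simp
qed

text \<open>For fixed \<open>b\<close> integrate \<open>dgreen (x - a)\<close> by parts against \<open>green (x - b) * k x\<close>.\<close>

lemma integral_dpot_dpot:
  assumes k: "circle_deriv k k'"
  shows "(LINT x|circle. dpot Y x * (dpot Y x * k x)) + (LINT x|circle. dpot Y x * (pot Y x * k' x)) =
    (LINT a|Y. pot Y a * k a) - mass * (LINT x|circle. pot Y x * k x)"
proof -
  have [measurable]: "k \<in> borel_measurable borel" "k' \<in> borel_measurable borel" using circle_derivD[OF k] by auto
  obtain C B where b: "\<And>x. \<bar>k x\<bar> \<le> C" "\<And>x. \<bar>k' x\<bar> \<le> B" using circle_derivD[OF k] by metis
  let ?I = "\<lambda>f. (LINT a|Y. LINT b|Y. (f a b :: real))"
  let ?f1 = "\<lambda>a b. LINT x|circle. dgreen (x - a) * (dgreen (x - b) * k x)"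
  let ?f2 = "\<lambda>a b. LINT x|circle. dgreen (x - a) * (green (x - b) * k' x)"
  have [measurable]: "(\<lambda>b. LINT x|circle. green (x - b) * k x) \<in> borel_measurable borel"
    by (rule convolution_swap(2)[OF fin sets_Y _ _ abs_green_le b(1)]) measurable
  have i2: "integrable Y (\<lambda>b. LINT x|circle. green (x - b) * k x)"
    by (rule convolution_swap(3)[OF fin sets_Y _ _ abs_green_le b(1)]) measurable
  have i3: "integrable Y (\<lambda>b. green (a - b) * k a)" for a using integrable_green by simp
  have e: "(LINT x|circle. pot Y x * k x) = (LINT b|Y. LINT x|circle. green (x - b) * k x)"
    unfolding pot_def by (rule convolution_swap(1)[OF fin sets_Y _ _ abs_green_le b(1)]) measurable
  have ip: "integrable Y (\<lambda>a. pot Y a * k a)"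
  proof (rule integrable_bounded[OF fin, where B = "2 * mass * C"])
    show "\<bar>pot Y x * k x\<bar> \<le> 2 * mass * C" for x
      unfolding abs_mult using abs_pot_le b mass_nonneg by (intro mult_mono) auto
  qed measurable
  have "(LINT x|circle. dpot Y x * (dpot Y x * k x)) = ?I ?f1"
    unfolding dpot_def by (rule convolution_swap2[OF _ _ _ abs_dgreen_le abs_dgreen_le b(1)]) measurable
  moreover have "(LINT x|circle. dpot Y x * (pot Y x * k' x)) = ?I ?f2"
    unfolding dpot_def pot_def by (rule convolution_swap2[OF _ _ _ abs_dgreen_le abs_green_le b(2)]) measurable
  \<comment> \<open>Adding the outer integrals requires integrability in a of the inner ones; these
    are folded back into integrals of \<open>dpot\<close> and \<open>pot\<close>, to which
    \<open>convolution_swap\<close> applies.\<close>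
  moreover have "?I ?f1 + ?I ?f2 = ?I (\<lambda>a b. ?f1 a b + ?f2 a b)"
  proof -
    have m: "(\<lambda>x. dgreen (x - a) * k x) \<in> borel_measurable borel"
      "(\<lambda>x. dgreen (x - a) * k' x) \<in> borel_measurable borel" for a by measurable
    have bb: "\<bar>dgreen (x - a) * k x\<bar> \<le> 1/2 * C" "\<bar>dgreen (x - a) * k' x\<bar> \<le> 1/2 * B" for x a
      unfolding abs_mult by (rule mult_mono[OF abs_dgreen_le b(1)] mult_mono[OF abs_dgreen_le b(2)]; simp)+
    have j: "integrable Y (\<lambda>b. ?f1 a b)" "integrable Y (\<lambda>b. ?f2 a b)" for a
      using convolution_swap(3)[OF fin sets_Y measurable_dgreen m(1) abs_dgreen_le bb(1), of a]
        convolution_swap(3)[OF fin sets_Y measurable_green m(2) abs_green_le bb(2), of a]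
      by (simp_all add: mult.left_commute)
    have "(\<lambda>x. dpot Y x * k x) \<in> borel_measurable borel" "(\<lambda>x. pot Y x * k' x) \<in> borel_measurable borel"
      by measurable
    moreover have "\<bar>dpot Y x * k x\<bar> \<le> mass * C" "\<bar>pot Y x * k' x\<bar> \<le> 2 * mass * B" for x
      unfolding abs_mult using b abs_dpot_le abs_pot_le mass_nonneg by (auto intro!: mult_mono)
    ultimately have "integrable Y (\<lambda>a. LINT x|circle. dgreen (x - a) * (dpot Y x * k x))"
       "integrable Y (\<lambda>a. LINT x|circle. dgreen (x - a) * (pot Y x * k' x))"
      by (auto intro!: convolution_swap(3)[OF fin sets_Y measurable_dgreen _ abs_dgreen_le])
    moreover have "(LINT x|circle. dgreen (x - a) * (dpot Y x * k x)) = (LINT b|Y. ?f1 a b)"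
      "(LINT x|circle. dgreen (x - a) * (pot Y x * k' x)) = (LINT b|Y. ?f2 a b)" for a
      using convolution_swap(1)[OF fin sets_Y measurable_dgreen m(1) abs_dgreen_le bb(1), of a]
        convolution_swap(1)[OF fin sets_Y measurable_green m(2) abs_green_le bb(2), of a]
      by (simp_all add: mult.left_commute dpot_def pot_def)
    ultimately show ?thesis using j by simp
  qed
  moreover have "?f1 a b + ?f2 a b = green (a - b) * k a - (LINT x|circle. green (x - b) * k x)" for a b
  proof -
    have "?f1 a b + ?f2 a b = (LINT x|circle. dgreen (x - a) * (dgreen (x - b) * k x + green (x - b) * k' x))"
    proof (subst Bochner_Integration.integral_add[symmetric])
      have 1: "\<bar>dgreen (x - a) * (dgreen (x - b) * k x)\<bar> \<le> 1/2 * (1/2 * C)" for x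
        unfolding abs_mult using b by (intro mult_mono abs_dgreen_le) auto
      have 2: "\<bar>dgreen (x - a) * (green (x - b) * k' x)\<bar> \<le> 1/2 * (2 * B)" for x
        unfolding abs_mult using b by (intro mult_mono abs_dgreen_le abs_green_le) auto
      show "integrable circle (\<lambda>x. dgreen (x - a) * (dgreen (x - b) * k x))"
        by (rule integrable_circle_bounded[OF _ 1]) auto
      show "integrable circle (\<lambda>x. dgreen (x - a) * (green (x - b) * k' x))"
        by (rule integrable_circle_bounded[OF _ 2]) auto
    qed (simp add: algebra_simps)
    also have "\<dots> = green (a - b) * k a - (LINT x|circle. green (x - b) * k x)"
      by (rule dgreen_by_parts[OF circle_deriv_mult[OF circle_deriv_green k]])
    finally show ?thesis .
  qed
  moreover have "?I (\<lambda>a b. green (a - b) * k a - (LINT x|circle. green (x - b) * k x)) =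
     (LINT a|Y. pot Y a * k a - (LINT x|circle. pot Y x * k x))"
    using i2 i3 e by (simp add: pot_def)
  ultimately show ?thesis using ip by (simp add: mass_def)
qed

text \<open>Formally the left-hand side is -2 \<integral> u_x u_xx k with u_xx = \<open>mass\<close>
  - Y, followed by one more integration by parts of the \<open>mass\<close> term. If Y has atoms,
  u_x jumps on them, and u_x Y must be read with the mean value of u_x at the jump, which is what
  \<open>dgreen 0 = 0\<close> provides.\<close>

lemma integral_dpot_sq_mult:
  assumes k: "circle_deriv k k'"
  shows "(LINT x|circle. dpot Y x * (dpot Y x * k' x)) =
    2 * (LINT a|Y. dpot Y a * k a) + 2 * mass * (LINT x|circle. pot Y x * k' x)"
proof -
  have [measurable]: "k \<in> borel_measurable borel" "k' \<in> borel_measurable borel" using circle_derivD[OF k] by auto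
  obtain C B where b: "\<And>x. \<bar>k x\<bar> \<le> C" "\<And>x. \<bar>k' x\<bar> \<le> B" using circle_derivD[OF k] by metis
  define G where "G a = (LINT x|circle. green (x - a) * k' x)" for a
  have [measurable]: "G \<in> borel_measurable borel" unfolding G_def[abs_def]
    by (rule convolution_swap(2)[OF fin sets_Y _ _ abs_green_le b(2)]) measurable
  have iG: "integrable Y G" unfolding G_def[abs_def]
    by (rule convolution_swap(3)[OF fin sets_Y _ _ abs_green_le b(2)]) measurable
  have G: "(LINT x|circle. pot Y x * k' x) = (LINT a|Y. G a)"
    unfolding G_def pot_def by (rule convolution_swap(1)[OF fin sets_Y _ _ abs_green_le b(2)]) measurable
  have G': "(LINT x|circle. dgreen (x - a) * k x) = - G a" for a
    unfolding G_def using green_by_parts[OF k, of a] by simp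
  \<comment> \<open>Both factors jump. Replacing k by k - k c makes the one with corner at c
    continuous after multiplication, so \<open>dgreen_by_parts\<close> applies to the other. The
    constant k c costs nothing, because \<open>dgreen\<close> has mean zero.\<close>
  have kern: "(LINT x|circle. dgreen (x - a) * (dgreen (x - c) * k' x)) =
      dgreen (a - c) * k a - dgreen (a - c) * k c + G c + G a" for a c
  proof -
    have i: "integrable circle (\<lambda>x. dgreen (x - d) * k x)" "integrable circle (\<lambda>x. dgreen (x - d) * k c)"
      "integrable circle (\<lambda>x. dgreen (x - d) * (k x - k c))" for d
    proof -
      have b1: "\<bar>dgreen (x - d) * k x\<bar> \<le> 1/2 * C" "\<bar>dgreen (x - d) * k c\<bar> \<le> 1/2 * C" for x
        unfolding abs_mult by (rule mult_mono[OF abs_dgreen_le b(1)]; simp)+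
      show "integrable circle (\<lambda>x. dgreen (x - d) * k x)" "integrable circle (\<lambda>x. dgreen (x - d) * k c)"
        by (rule integrable_circle_bounded[OF _ b1(1)] integrable_circle_bounded[OF _ b1(2)]; measurable)+
      then have "integrable circle (\<lambda>x. dgreen (x - d) * k x - dgreen (x - d) * k c)" by simp
      then show "integrable circle (\<lambda>x. dgreen (x - d) * (k x - k c))" by (simp add: right_diff_distrib)
    qed
    have z: "(LINT x|circle. dgreen (x - d) * (k x - k c)) = - G d" for d
      using i by (simp add: right_diff_distrib G')
    have b2: "\<bar>dgreen (x - a) * (dgreen (x - c) * k' x)\<bar> \<le> 1/2 * (1/2 * B)" for x
      unfolding abs_mult
      by (intro mult_mono abs_dgreen_le b(2) mult_nonneg_nonneg) (auto intro: order_trans[OF abs_ge_zero b(2)])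
    have "integrable circle (\<lambda>x. dgreen (x - a) * (dgreen (x - c) * k' x))"
      by (rule integrable_circle_bounded[OF _ b2]) measurable
    then have "(LINT x|circle. dgreen (x - a) * (k x - k c + dgreen (x - c) * k' x)) =
        - G a + (LINT x|circle. dgreen (x - a) * (dgreen (x - c) * k' x))"
      using i(3)[of a] by (simp add: distrib_left z)
    then show ?thesis
      using dgreen_by_parts[OF circle_deriv_dgreen_mult[OF k, of c], of a] z[of c]
      by (simp add: algebra_simps)
  qed
  have bk: "\<bar>dgreen (a - c) * k d\<bar> \<le> 1/2 * C" for a c d
    unfolding abs_mult by (rule mult_mono[OF abs_dgreen_le b(1)]; simp)
  have i1: "integrable Y (\<lambda>c. dgreen (a - c) * k a)" "integrable Y (\<lambda>c. dgreen (a - c) * k c)" for a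
    by (rule integrable_bounded[OF fin _ bk]; measurable)+
  have bk': "\<bar>dpot Y a * k a\<bar> \<le> mass * C" for a
    unfolding abs_mult by (rule mult_mono[OF abs_dpot_le b(1)]) (auto simp: mass_nonneg)
  have i2: "integrable Y (\<lambda>a. dpot Y a * k a)"
    by (rule integrable_bounded[OF fin _ bk']) measurable
  have i4: "integrable Y (\<lambda>a. LINT c|Y. dgreen (a - c) * k c)"
    by (rule fubini_bounded(1)[OF fin fin _ bk]) measurable
  \<comment> \<open>By oddness of \<open>dgreen\<close>, exchanging a and c reproduces the term with
    k a up to sign; the two therefore add up, which gives the factor 2.\<close>
  have "(LINT a|Y. LINT c|Y. dgreen (a - c) * k c) = (LINT c|Y. LINT a|Y. dgreen (a - c) * k c)"
    by (rule integral_source_swap[OF _ bk]) measurable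
  also have "\<dots> = - (LINT c|Y. dpot Y c * k c)"
  proof -
    have "(LINT a|Y. dgreen (a - c)) = - dpot Y c" for c
      unfolding dpot_def using dgreen_minus[of "c - _"] by simp
    then show ?thesis by simp
  qed
  finally have sw: "(LINT a|Y. LINT c|Y. dgreen (a - c) * k c) = - (LINT c|Y. dpot Y c * k c)" .
  have "(LINT x|circle. dpot Y x * (dpot Y x * k' x)) =
     (LINT a|Y. LINT c|Y. dgreen (a - c) * k a - dgreen (a - c) * k c + G c + G a)"
    unfolding dpot_def kern[symmetric]
    by (rule convolution_swap2[OF _ _ _ abs_dgreen_le abs_dgreen_le b(2)]) measurable
  also have "\<dots> = (LINT a|Y. dpot Y a * k a - (LINT c|Y. dgreen (a - c) * k c) + (LINT c|Y. G c) + mass * G a)"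
    using i1 iG by (simp add: dpot_def mass_def)
  also have "\<dots> = 2 * (LINT a|Y. dpot Y a * k a) + 2 * mass * (LINT a|Y. G a)"
    using i2 i4 iG by (simp add: sw mass_def)
  finally show ?thesis by (simp add: G)
qed

text \<open>The left-hand side is what the motion of the particles contributes to the rate of change
  of \<integral> u f, damping apart; the right-hand side is the nonlocal term and the transport term
  of the equation. It equals \<open>integral_dpot_dpot\<close> for F' minus half of
  \<open>integral_dpot_sq_mult\<close> for F, with the terms in u_x^2 F' and u F' collected into w
  F'.\<close>

lemma spatial_identity:
  assumes per: "periodic1 f" "periodic1 f'" "periodic1 f''" and cont: "continuous_on UNIV f''"
    and der: "\<And>x. (f has_real_derivative f' x) (at x)" "\<And>x. (f' has_real_derivative f'' x) (at x)"
  defines "F \<equiv> \<lambda>y. LINT x|circle. green (x - y) * f x"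
    and "F' \<equiv> \<lambda>y. LINT x|circle. green (x - y) * f' x"
    and "w \<equiv> \<lambda>y. 2 * mass * pot Y y + (dpot Y y)\<^sup>2 / 2"
  shows "(LINT a|Y. pot Y a * F' a) - (LINT a|Y. dpot Y a * F a) =
    (LINT x|circle. circle_conv green w x * f' x) - (LINT x|circle. pot Y x * dpot Y x * f x)"
proof -
  have cf': "continuous_on UNIV f'" using der(2) DERIV_isCont continuous_at_imp_continuous_on by blast
  have cf: "continuous_on UNIV f" using der(1) DERIV_isCont continuous_at_imp_continuous_on by blast
  have d1: "circle_deriv f f'" by (rule circle_deriv_C1[OF per(1,2) cf' der(1)])
  have d2: "circle_deriv f' f''" by (rule circle_deriv_C1[OF per(2,3) cont der(2)])
  have [measurable]: "f \<in> borel_measurable borel" "f' \<in> borel_measurable borel"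
    using circle_derivD[OF d1] by auto
  define m where "m = (LINT x|circle. f x)"
  have F': "(F has_real_derivative F' y) (at y)" for y
    unfolding F_def F'_def by (rule has_derivative_green_conv[OF per(1,2) cf' der(1)])
  \<comment> \<open>F solves \<open>m\<close> - F'' = f, the defining property of the Green's
    function; it follows by two integrations by parts.\<close>
  have F'': "(F' has_real_derivative m - f y) (at y)" for y
  proof -
    have "(F' has_real_derivative (LINT x|circle. green (x - y) * f'' x)) (at y)"
      unfolding F'_def by (rule has_derivative_green_conv[OF per(2,3) cont der(2)])
    then show ?thesis by (simp add: green_by_parts[OF d2] dgreen_by_parts[OF d1] m_def)
  qed
  have pF: "periodic1 F" "periodic1 F'" unfolding F_def F'_def by (rule periodic1_green_conv)+
  have "continuous_on UNIV F'" using F'' DERIV_isCont continuous_at_imp_continuous_on by blast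
  then have D1: "circle_deriv F F'" using circle_deriv_C1[OF pF _ F'] by simp
  have D2: "circle_deriv F' (\<lambda>y. m - f y)"
    by (rule circle_deriv_C1[OF pF(2) _ _ F''])
       (use per(1) cf in \<open>auto simp: periodic1_def intro!: continuous_intros\<close>)
  have [measurable]: "F \<in> borel_measurable borel" "F' \<in> borel_measurable borel"
    using circle_derivD[OF D1] by auto
  obtain B where B: "\<And>x. \<bar>F' x\<bar> \<le> B" using circle_derivD[OF D2] by metis
  obtain A where A: "\<And>x. \<bar>f x\<bar> \<le> A" using circle_derivD[OF d1] by metis
  obtain A' where A': "\<And>x. \<bar>f' x\<bar> \<le> A'" using circle_derivD[OF d2] by metis
  have wm [measurable]: "w \<in> borel_measurable borel" unfolding w_def by measurable
  have wb: "\<bar>w x\<bar> \<le> 2 * mass * (2 * mass) + mass\<^sup>2" for x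
  proof -
    have "\<bar>2 * mass * pot Y x\<bar> \<le> 2 * mass * (2 * mass)"
      unfolding abs_mult using abs_pot_le mass_nonneg by (intro mult_mono) auto
    moreover have "\<bar>(dpot Y x)\<^sup>2 / 2\<bar> \<le> mass\<^sup>2"
    proof -
      have "(dpot Y x)\<^sup>2 \<le> mass\<^sup>2"
        using abs_dpot_le[of x] mass_nonneg by (simp add: abs_le_square_iff[symmetric])
      then show ?thesis using zero_le_power2[of mass] unfolding abs_divide abs_power2 abs_numeral by linarith
    qed
    moreover have "\<bar>w x\<bar> \<le> \<bar>2 * mass * pot Y x\<bar> + \<bar>(dpot Y x)\<^sup>2 / 2\<bar>"
      unfolding w_def by (rule abs_triangle_ineq)
    ultimately show ?thesis by linarith
  qed
  have conv: "(LINT x|circle. circle_conv green w x * f' x) = (LINT y|circle. w y * F' y)"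
  proof -
    have "(LINT x|circle. circle_conv green w x * f' x) = (LINT x|circle. LINT y|circle. green (x - y) * w y * f' x)"
      by (simp add: circle_conv_def)
    also have "\<dots> = (LINT y|circle. LINT x|circle. green (x - y) * w y * f' x)"
    proof (rule fubini_bounded(3)[OF finite_measure_circle finite_measure_circle])
      have [measurable_cong]: "sets circle = sets (restrict_space borel {0..<1::real})" by (rule sets_circle)
      have [measurable]: "(\<lambda>x. x) \<in> measurable (restrict_space borel {0..<1::real}) borel"
        by (rule measurable_restrict_space1) simp
      show "(\<lambda>(x, y). green (x - y) * w y * f' x) \<in> borel_measurable (circle \<Otimes>\<^sub>M circle)" by measurable
      show "\<bar>green (x - y) * w y * f' x\<bar> \<le> 2 * (2 * mass * (2 * mass) + mass\<^sup>2) * A'" for x y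
        unfolding abs_mult using abs_green_le wb A' mass_nonneg by (intro mult_mono) auto
    qed
    also have "\<dots> = (LINT y|circle. w y * F' y)"
      unfolding F'_def by (simp add: mult.assoc mult.left_commute)
    finally show ?thesis .
  qed
  have bp: "\<bar>pot Y x * F' x\<bar> \<le> 2 * mass * B" for x
    unfolding abs_mult using abs_pot_le B mass_nonneg by (intro mult_mono) auto
  have ip: "integrable circle (\<lambda>x. pot Y x * F' x)"
    by (rule integrable_circle_bounded[OF _ bp]) measurable
  have bd: "\<bar>dpot Y x * (dpot Y x * F' x)\<bar> \<le> mass * (mass * B)" for x
    unfolding abs_mult using abs_dpot_le B mass_nonneg
    by (intro mult_mono mult_nonneg_nonneg) auto
  have id: "integrable circle (\<lambda>x. dpot Y x * (dpot Y x * F' x))"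
    by (rule integrable_circle_bounded[OF _ bd]) measurable
  have bq: "\<bar>pot Y x * dpot Y x\<bar> \<le> 2 * mass * mass" for x
    unfolding abs_mult using abs_pot_le abs_dpot_le mass_nonneg by (intro mult_mono) auto
  have iq: "integrable circle (\<lambda>x. pot Y x * dpot Y x)"
    by (rule integrable_circle_bounded[OF _ bq]) measurable
  have br: "\<bar>pot Y x * dpot Y x * f x\<bar> \<le> 2 * mass * mass * A" for x
    using bq A mass_nonneg unfolding abs_mult[of "_ * _"] by (intro mult_mono) auto
  have ir: "integrable circle (\<lambda>x. pot Y x * dpot Y x * f x)"
    by (rule integrable_circle_bounded[OF _ br]) measurable
  have w: "(LINT y|circle. w y * F' y) =
      2 * mass * (LINT x|circle. pot Y x * F' x) + (LINT x|circle. dpot Y x * (dpot Y x * F' x)) / 2"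
  proof -
    have "(LINT y|circle. w y * F' y) =
        (LINT x|circle. 2 * mass * (pot Y x * F' x) + (dpot Y x * (dpot Y x * F' x)) / 2)"
      by (simp add: w_def power2_eq_square algebra_simps)
    also have "\<dots> = 2 * mass * (LINT x|circle. pot Y x * F' x) + (LINT x|circle. dpot Y x * (dpot Y x * F' x)) / 2"
      using ip id by simp
    finally show ?thesis .
  qed
  \<comment> \<open>The mean m of f drops out, because u u_x has integral zero.\<close>
  have "(LINT x|circle. dpot Y x * (pot Y x * (m - f x))) =
      (LINT x|circle. (pot Y x * dpot Y x) * m - pot Y x * dpot Y x * f x)"
    by (simp add: algebra_simps)
  also have "\<dots> = - (LINT x|circle. pot Y x * dpot Y x * f x)"
    using iq ir by (simp add: integral_pot_dpot)
  finally show ?thesis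
    using integral_dpot_dpot[OF D2] integral_dpot_sq_mult[OF D1] conv w
    by (simp add: field_simps)
qed

end

section \<open>Ordinary differential equations for bounded measurable functions\<close>

text \<open>Time is rounded down to multiples of 1/(n + 1). The rounded function is a countable
  gluing of measurable sections, and continuity in time gives pointwise convergence.\<close>

lemma caratheodory_measurable:
  fixes f :: "real \<Rightarrow> 'a \<Rightarrow> real"
  assumes m: "\<And>t. f t \<in> borel_measurable N"
    and c: "\<And>x. x \<in> space N \<Longrightarrow> continuous_on UNIV (\<lambda>t. f t x)"
  shows "(\<lambda>(t, x). f t x) \<in> borel_measurable (borel \<Otimes>\<^sub>M N)"
proof (rule borel_measurable_LIMSEQ_real)
  define g where "g n t = of_int \<lfloor>real (Suc n) * t\<rfloor> / real (Suc n)" for n t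
  show "(\<lambda>z. f (g n (fst z)) (snd z)) \<in> borel_measurable (borel \<Otimes>\<^sub>M N)" for n
    unfolding g_def
  proof (rule measurable_compose_countable[where f = "\<lambda>i z. f (of_int i / real (Suc n)) (snd z)"])
    show "(\<lambda>z. f (of_int i / real (Suc n)) (snd z)) \<in> borel_measurable (borel \<Otimes>\<^sub>M N)" for i
      using m by (rule measurable_compose[OF measurable_snd])
  qed measurable
  fix z :: "real \<times> 'a" assume "z \<in> space (borel \<Otimes>\<^sub>M N)"
  then have z: "snd z \<in> space N" by (auto simp: space_pair_measure)
  have "(\<lambda>n. g n t) \<longlonglongrightarrow> t" for t
  proof (rule LIMSEQ_norm_0[THEN LIM_zero_cancel])
    fix n
    have "\<bar>of_int \<lfloor>real (Suc n) * t\<rfloor> - real (Suc n) * t\<bar> < 1" by linarith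
    moreover have "g n t - t = (of_int \<lfloor>real (Suc n) * t\<rfloor> - real (Suc n) * t) / real (Suc n)"
      by (simp add: g_def field_simps)
    ultimately show "norm (g n t - t) < 1 / real (Suc n)"
      by (simp add: divide_strict_right_mono del: of_nat_Suc)
  qed
  then have "(\<lambda>n. f (g n (fst z)) (snd z)) \<longlonglongrightarrow> f (fst z) (snd z)"
    using continuous_on_tendsto_compose[OF c[OF z], of "\<lambda>n. g n (fst z)" "fst z" sequentially] by simp
  then show "(\<lambda>n. f (g n (fst z)) (snd z)) \<longlonglongrightarrow> (case z of (t, x) \<Rightarrow> f t x)"
    by (simp add: split_beta)
qed

lemma clamp_continuous_on:
  fixes f :: "real \<Rightarrow> 'a::topological_space"
  assumes "0 \<le> T" "continuous_on {0..T} f"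
  shows "continuous_on UNIV (\<lambda>t. f (max 0 (min T t)))"
  by (rule continuous_on_compose2[OF assms(2)]) (use assms(1) in \<open>auto intro!: continuous_intros\<close>)

lemma finite_measure_time: "finite_measure (restrict_space lborel {0..T::real})"
  by (rule finite_measureI) (simp add: emeasure_restrict_space space_restrict_space emeasure_lborel_Icc_eq)

lemma caratheodory_measurable_Icc:
  fixes f :: "real \<Rightarrow> 'a \<Rightarrow> real"
  assumes T: "0 \<le> T"
    and m: "\<And>t. t \<in> {0..T} \<Longrightarrow> f t \<in> borel_measurable N"
    and c: "\<And>x. x \<in> space N \<Longrightarrow> continuous_on {0..T} (\<lambda>t. f t x)"
  shows "(\<lambda>(t, x). f t x) \<in> borel_measurable (restrict_space lborel {0..T} \<Otimes>\<^sub>M N)"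
proof -
  have "(\<lambda>(t, x). f (max 0 (min T t)) x) \<in> borel_measurable (borel \<Otimes>\<^sub>M N)"
    using T by (intro caratheodory_measurable m clamp_continuous_on c) auto
  moreover have "(\<lambda>x. x) \<in> measurable (restrict_space lborel {0..T} \<Otimes>\<^sub>M N) (borel \<Otimes>\<^sub>M N)"
  proof -
    have "(\<lambda>x. x) \<in> measurable (restrict_space lborel {0..T}) borel"
      by (rule measurable_restrict_space1) simp
    then have "(\<lambda>z. (fst z, snd z)) \<in> measurable (restrict_space lborel {0..T} \<Otimes>\<^sub>M N) (borel \<Otimes>\<^sub>M N)"
      using measurable_compose[OF measurable_fst] by (intro measurable_Pair) auto
    then show ?thesis by simp
  qed
  ultimately have "(\<lambda>(t, x). f (max 0 (min T t)) x) \<in> borel_measurable (restrict_space lborel {0..T} \<Otimes>\<^sub>M N)"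
    by (rule measurable_compose[rotated])
  then show ?thesis
    by (rule measurable_cong[THEN iffD1, rotated]) (auto simp: space_pair_measure space_restrict_space)
qed

text \<open>Fubini combined with the fundamental theorem for each fixed x. In this integrated form,
  bounded pointwise derivatives suffice for the conservation laws and for the transport
  identity.\<close>

lemma integral_time_derivative:
  fixes F :: "real \<Rightarrow> 'a \<Rightarrow> real"
  assumes N: "finite_measure N" and T: "0 \<le> T"
    and der: "\<And>x t. x \<in> space N \<Longrightarrow> t \<in> {0..T} \<Longrightarrow>
      ((\<lambda>t. F t x) has_real_derivative F' t x) (at t within {0..T})"
    and cont: "\<And>x. x \<in> space N \<Longrightarrow> continuous_on {0..T} (\<lambda>t. F' t x)"
    and meas: "\<And>t. t \<in> {0..T} \<Longrightarrow> F' t \<in> borel_measurable N"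
    and bd: "\<And>t x. t \<in> {0..T} \<Longrightarrow> x \<in> space N \<Longrightarrow> \<bar>F' t x\<bar> \<le> B"
  shows "(LINT x|N. F T x - F 0 x) = (LINT t|restrict_space lborel {0..T}. LINT x|N. F' t x)"
proof -
  have "(LINT t|restrict_space lborel {0..T}. LINT x|N. F' t x) =
      (LINT x|N. LINT t|restrict_space lborel {0..T}. F' t x)"
    by (rule fubini_bounded(3)[OF finite_measure_time N caratheodory_measurable_Icc[OF T meas cont]])
       (use bd in \<open>auto simp: space_restrict_space\<close>)
  also have "\<dots> = (LINT x|N. F T x - F 0 x)"
  proof (rule Bochner_Integration.integral_cong[OF refl])
    fix x assume x: "x \<in> space N"
    have "(LINT t|restrict_space lborel {0..T}. F' t x) = (LINT t|lborel. indicator {0..T} t *\<^sub>R F' t x)"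
      by (rule integral_restrict_space) simp
    also have "\<dots> = F T x - F 0 x"
      by (rule integral_FTC_Icc[OF T])
         (use der[OF x] cont[OF x] in \<open>auto simp: has_real_derivative_iff_has_vector_derivative\<close>)
    finally show "(LINT t|restrict_space lborel {0..T}. F' t x) = F T x - F 0 x" .
  qed
  finally show ?thesis by simp
qed

text \<open>This keeps Picard iterates measurable in the label; taking coordinates reduces it to the
  real case of \<open>caratheodory_measurable_Icc\<close>.\<close>

lemma measurable_time_integral:
  fixes g :: "real \<Rightarrow> 'a \<Rightarrow> 'b::euclidean_space"
  assumes T: "0 \<le> T"
    and m: "\<And>t. t \<in> {0..T} \<Longrightarrow> g t \<in> borel_measurable N"
    and c: "\<And>x. x \<in> space N \<Longrightarrow> continuous_on {0..T} (\<lambda>t. g t x)"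
  shows "(\<lambda>x. integral {0..T} (\<lambda>t. g t x)) \<in> borel_measurable N"
proof (subst borel_measurable_euclidean_space, rule ballI)
  fix i :: 'b assume i: "i \<in> Basis"
  let ?R = "restrict_space lborel {0..T}"
  interpret R: finite_measure ?R by (rule finite_measure_time)
  have "(\<lambda>(t, x). g t x \<bullet> i) \<in> borel_measurable (?R \<Otimes>\<^sub>M N)"
    by (rule caratheodory_measurable_Icc[OF T])
       (use m c i in \<open>auto intro!: continuous_intros borel_measurable_inner\<close>)
  then have "(\<lambda>(x, t). g t x \<bullet> i) \<in> borel_measurable (N \<Otimes>\<^sub>M ?R)"
    using measurable_pair_swap by fastforce
  then have "(\<lambda>x. LINT t|?R. g t x \<bullet> i) \<in> borel_measurable N"
    by (rule R.borel_measurable_lebesgue_integral)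
  moreover have "(LINT t|?R. g t x \<bullet> i) = integral {0..T} (\<lambda>t. g t x) \<bullet> i" if x: "x \<in> space N" for x
  proof -
    have ci: "continuous_on {0..T} (\<lambda>t. g t x \<bullet> i)" using c[OF x] by (intro continuous_intros)
    have "(LINT t|?R. g t x \<bullet> i) = (LINT t:{0..T}|lborel. g t x \<bullet> i)"
      unfolding set_lebesgue_integral_def by (rule integral_restrict_space) simp
    also have "\<dots> = integral {0..T} (\<lambda>t. g t x \<bullet> i)"
      by (rule set_borel_integral_eq_integral(2)[OF borel_integrable_atLeastAtMost'[OF ci]])
    also have "\<dots> = integral {0..T} (\<lambda>t. g t x) \<bullet> i"
      by (rule integral_component_eq[OF integrable_continuous_real[OF c[OF x]]])
    finally show ?thesis .
  qed
  ultimately show "(\<lambda>x. integral {0..T} (\<lambda>t. g t x) \<bullet> i) \<in> borel_measurable N"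
    by (rule measurable_cong[THEN iffD1, rotated])
qed

section \<open>Picard iteration for nonlocal Lipschitz fields\<close>

text \<open>The bound holds at every point and not only almost everywhere, because the differential
  equation is solved for each label separately.\<close>

definition bounded_borel :: "'a measure \<Rightarrow> ('a \<Rightarrow> 'b::euclidean_space) \<Rightarrow> bool" where
  "bounded_borel N z \<longleftrightarrow> z \<in> borel_measurable N \<and> (\<exists>B. \<forall>x\<in>space N. norm (z x) \<le> B)"

primrec picard ::
  "(('a \<Rightarrow> 'b::euclidean_space) \<Rightarrow> 'a \<Rightarrow> 'b) \<Rightarrow> ('a \<Rightarrow> 'b) \<Rightarrow> nat \<Rightarrow> real \<Rightarrow> 'a \<Rightarrow> 'b" where
  "picard f z 0 t x = z x"
| "picard f z (Suc n) t x = z x + integral {0..t} (\<lambda>s. f (picard f z n s) x)"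

text \<open>The field is nonlocal: \<open>f z x\<close> depends on the whole function z. Distances
  between states are expressed by an arbitrary uniform bound d, which replaces the supremum
  norm.\<close>

locale lipschitz_field =
  fixes N :: "'a measure" and f :: "('a \<Rightarrow> 'b::euclidean_space) \<Rightarrow> 'a \<Rightarrow> 'b" and K L :: real
  assumes f_meas: "\<And>z. bounded_borel N z \<Longrightarrow> f z \<in> borel_measurable N"
    and f_bd: "\<And>z x. bounded_borel N z \<Longrightarrow> x \<in> space N \<Longrightarrow> norm (f z x) \<le> K"
    and f_lip: "\<And>z z' d x. bounded_borel N z \<Longrightarrow> bounded_borel N z' \<Longrightarrow>
      (\<And>x. x \<in> space N \<Longrightarrow> norm (z x - z' x) \<le> d) \<Longrightarrow> x \<in> space N \<Longrightarrow>
      norm (f z x - f z' x) \<le> L * d"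
    and K0: "0 \<le> K" and L0: "0 < L"
begin

text \<open>The invariant of the iteration. Lipschitz continuity in time, uniform over the labels,
  carries over to \<open>f (Z t) x\<close>, so that the next integral exists.\<close>

definition nice :: "(real \<Rightarrow> 'a \<Rightarrow> 'b) \<Rightarrow> bool" where
  "nice Z \<longleftrightarrow> (\<forall>t\<ge>0. bounded_borel N (Z t)) \<and>
     (\<forall>t\<ge>0. \<forall>s\<ge>0. \<forall>x\<in>space N. norm (Z t x - Z s x) \<le> K * \<bar>t - s\<bar>)"

lemma nice_continuous:
  assumes "nice Z" "x \<in> space N"
  shows "continuous_on {0..} (\<lambda>t. f (Z t) x)"
proof (rule lipschitz_on_continuous_on)
  show "(L * K)-lipschitz_on {0..} (\<lambda>t. f (Z t) x)"
  proof (rule lipschitz_onI)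
    fix s t :: real assume st: "s \<in> {0..}" "t \<in> {0..}"
    then have "norm (f (Z s) x - f (Z t) x) \<le> L * (K * \<bar>s - t\<bar>)"
      using assms by (intro f_lip) (auto simp: nice_def)
    then show "dist (f (Z s) x) (f (Z t) x) \<le> L * K * dist s t"
      by (simp add: dist_norm mult.assoc)
  qed (use K0 L0 in auto)
qed

lemma nice_integrable:
  assumes "nice Z" "x \<in> space N" "0 \<le> s"
  shows "(\<lambda>t. f (Z t) x) integrable_on {s..t}"
  by (rule integrable_continuous_real, rule continuous_on_subset[OF nice_continuous[OF assms(1,2)]])
     (use assms(3) in auto)

lemma norm_integral_le:
  assumes "nice Z" "x \<in> space N" "0 \<le> s" "s \<le> t"
  shows "norm (integral {s..t} (\<lambda>r. f (Z r) x)) \<le> K * (t - s)"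
proof (rule integral_bound[OF assms(4)])
  show "continuous_on {s..t} (\<lambda>r. f (Z r) x)"
    by (rule continuous_on_subset[OF nice_continuous[OF assms(1,2)]]) (use assms(3) in auto)
  show "\<And>r. r \<in> {s..t} \<Longrightarrow> norm (f (Z r) x) \<le> K"
    using assms by (auto intro!: f_bd simp: nice_def)
qed

lemma nice_step:
  assumes Z: "nice Z" and z: "bounded_borel N z"
  shows "nice (\<lambda>t x. z x + integral {0..t} (\<lambda>s. f (Z s) x))"
  unfolding nice_def
proof (intro conjI allI impI ballI)
  fix t :: real assume t: "0 \<le> t"
  have "(\<lambda>x. integral {0..t} (\<lambda>s. f (Z s) x)) \<in> borel_measurable N"
    by (rule measurable_time_integral[OF t])
       (use Z in \<open>auto intro!: f_meas continuous_on_subset[OF nice_continuous[OF Z]] simp: nice_def\<close>)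
  moreover obtain B where B: "\<And>x. x \<in> space N \<Longrightarrow> norm (z x) \<le> B" using z by (auto simp: bounded_borel_def)
  have "norm (z x + integral {0..t} (\<lambda>s. f (Z s) x)) \<le> B + K * t" if "x \<in> space N" for x
    using norm_integral_le[OF Z that, of 0 t] B[OF that] t by (intro norm_triangle_le) auto
  ultimately show "bounded_borel N (\<lambda>x. z x + integral {0..t} (\<lambda>s. f (Z s) x))"
    using z unfolding bounded_borel_def by auto
next
  have *: "norm (integral {0..t} (\<lambda>s. f (Z s) x) - integral {0..s} (\<lambda>s. f (Z s) x)) \<le> K * (t - s)"
    if "0 \<le> s" "s \<le> t" "x \<in> space N" for s t x
    using Henstock_Kurzweil_Integration.integral_combine[OF that(1,2) nice_integrable[OF Z that(3), of 0 t], symmetric]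
      norm_integral_le[OF Z that(3,1,2)] by simp
  fix s t :: real and x assume "0 \<le> t" "0 \<le> s" "x \<in> space N"
  then show "norm (z x + integral {0..t} (\<lambda>s. f (Z s) x) - (z x + integral {0..s} (\<lambda>s. f (Z s) x))) \<le> K * \<bar>t - s\<bar>"
    using *[of s t x] *[of t s x] by (cases "s \<le> t") (auto simp: norm_minus_commute)
qed

lemma nice_picard:
  assumes "bounded_borel N z"
  shows "nice (picard f z n)"
proof (induction n)
  case 0
  show ?case using assms K0 by (simp add: nice_def fun_eq_iff bounded_borel_def)
next
  case (Suc n)
  then show ?case using nice_step[OF Suc assms] by (simp add: fun_eq_iff nice_def bounded_borel_def)
qed

lemma norm_integral_diff_le:
  assumes Z: "nice Z" "nice Z'" and x: "x \<in> space N" and t: "0 \<le> t"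
    and d: "\<And>s x. 0 \<le> s \<Longrightarrow> x \<in> space N \<Longrightarrow> norm (Z s x - Z' s x) \<le> c * exp (2 * L * s)"
  shows "norm (integral {0..t} (\<lambda>s. f (Z s) x) - integral {0..t} (\<lambda>s. f (Z' s) x)) \<le> c / 2 * exp (2 * L * t)"
proof -
  have c0: "0 \<le> c" using d[of 0 x] x order_trans[OF norm_ge_zero] by fastforce
  \<comment> \<open>The antiderivative c / 2 * exp (2 * L * s) produces the contraction factor
    1/2.\<close>
  have hi: "((\<lambda>s. L * (c * exp (2 * L * s))) has_integral (c / 2 * exp (2 * L * t) - c / 2 * exp (2 * L * 0))) {0..t}"
    by (rule fundamental_theorem_of_calculus[OF t])
       (use L0 in \<open>auto intro!: derivative_eq_intros simp: has_real_derivative_iff_has_vector_derivative[symmetric]\<close>)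
  have "norm (integral {0..t} (\<lambda>s. f (Z s) x - f (Z' s) x)) \<le> integral {0..t} (\<lambda>s. L * (c * exp (2 * L * s)))"
  proof (rule integral_norm_bound_integral)
    show "(\<lambda>s. f (Z s) x - f (Z' s) x) integrable_on {0..t}"
      by (intro integrable_diff nice_integrable Z x) simp_all
    show "norm (f (Z s) x - f (Z' s) x) \<le> L * (c * exp (2 * L * s))" if "s \<in> {0..t}" for s
      using that Z x by (intro f_lip d) (auto simp: nice_def)
  qed (use hi in blast)
  also have "\<dots> \<le> c / 2 * exp (2 * L * t)"
    unfolding integral_unique[OF hi] using c0 by simp
  finally show ?thesis
    using nice_integrable[OF Z(1) x, of 0 t] nice_integrable[OF Z(2) x, of 0 t]
    by (simp add: Henstock_Kurzweil_Integration.integral_diff)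
qed

text \<open>The weight \<open>exp (2 * L * t)\<close> makes each iteration a contraction by the factor \<open>1 / 2\<close>.\<close>

lemma picard_step_le:
  assumes z: "bounded_borel N z" and t: "0 \<le> t" and x: "x \<in> space N"
  shows "norm (picard f z (Suc n) t x - picard f z n t x) \<le> (K / (2 * L) * (1 / 2) ^ n) * exp (2 * L * t)"
  using t x
proof (induction n arbitrary: t x)
  \<comment> \<open>The constant K / (2 * L) comes from K * t = K / (2 * L) * (2 * L * t) and the
    bound of 2 * L * t by its exponential.\<close>
  case 0
  have "norm (integral {0..t} (\<lambda>s. f (picard f z 0 s) x)) \<le> K * t"
    using norm_integral_le[OF nice_picard[OF z] 0(2), of 0 t 0] 0 by simp
  also have "\<dots> = K / (2 * L) * (2 * L * t)" using L0 by simp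
  also have "\<dots> \<le> K / (2 * L) * exp (2 * L * t)"
  proof (rule mult_left_mono)
    show "2 * L * t \<le> exp (2 * L * t)" using exp_ge_add_one_self[of "2 * L * t"] by linarith
  qed (use K0 L0 in simp)
  finally show ?case by simp
next
  case (Suc n)
  have "picard f z (Suc (Suc n)) t x - picard f z (Suc n) t x =
    integral {0..t} (\<lambda>s. f (picard f z (Suc n) s) x) - integral {0..t} (\<lambda>s. f (picard f z n s) x)"
    by (simp only: picard.simps(2) add_diff_cancel_left)
  then show ?case
    using norm_integral_diff_le[OF nice_picard[OF z] nice_picard[OF z] Suc.prems(2,1) Suc.IH]
    by (simp del: picard.simps)
qed

theorem solution_exists:
  assumes z: "bounded_borel N z"
  obtains Z where "\<And>x. x \<in> space N \<Longrightarrow> Z 0 x = z x"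
    and "\<And>t. 0 \<le> t \<Longrightarrow> bounded_borel N (Z t)"
    and "\<And>s t x. 0 \<le> s \<Longrightarrow> 0 \<le> t \<Longrightarrow> x \<in> space N \<Longrightarrow> norm (Z t x - Z s x) \<le> K * \<bar>t - s\<bar>"
    and "\<And>t x. 0 \<le> t \<Longrightarrow> x \<in> space N \<Longrightarrow>
      ((\<lambda>t. Z t x) has_vector_derivative f (Z t) x) (at t within {0..})"
    and "\<And>x. x \<in> space N \<Longrightarrow> continuous_on {0..} (\<lambda>t. f (Z t) x)"
proof -
  let ?P = "picard f z"
  define C where "C = K / (2 * L)"
  have C0: "0 \<le> C" using K0 L0 by (simp add: C_def)
  have step: "norm (?P (Suc n) t x - ?P n t x) \<le> C * (1 / 2) ^ n * exp (2 * L * t)"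
    if "0 \<le> t" "x \<in> space N" for n t x
    unfolding C_def by (rule picard_step_le[OF z that])
  \<comment> \<open>The last factor 2 - 2 * (1 / 2) ^ k is the sum of the first k powers of 1/2,
    starting from 1.\<close>
  have tail: "norm (?P (n + k) t x - ?P n t x) \<le> C * (1 / 2) ^ n * exp (2 * L * t) * (2 - 2 * (1 / 2) ^ k)"
    if tx: "0 \<le> t" "x \<in> space N" for n k t x
  proof (induction k)
    case (Suc k)
    have "norm (?P (n + Suc k) t x - ?P n t x) \<le>
        norm (?P (Suc (n + k)) t x - ?P (n + k) t x) + norm (?P (n + k) t x - ?P n t x)"
      using norm_triangle_ineq[of "?P (Suc (n + k)) t x - ?P (n + k) t x" "?P (n + k) t x - ?P n t x"] by simp
    also have "\<dots> \<le> C * (1 / 2) ^ (n + k) * exp (2 * L * t)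
       + C * (1 / 2) ^ n * exp (2 * L * t) * (2 - 2 * (1 / 2) ^ k)"
      by (rule add_mono[OF step[OF tx] Suc])
    also have "\<dots> = C * (1 / 2) ^ n * exp (2 * L * t) * (2 - 2 * (1 / 2) ^ Suc k)"
      by (simp add: power_add field_simps)
    finally show ?case .
  qed simp
  have tail2: "norm (?P m t x - ?P n t x) \<le> 2 * C * exp (2 * L * t) * (1 / 2) ^ n"
    if "0 \<le> t" "x \<in> space N" "n \<le> m" for m n t x
  proof -
    have "C * (1 / 2) ^ n * exp (2 * L * t) * (2 - 2 * (1 / 2) ^ (m - n)) \<le> C * (1 / 2) ^ n * exp (2 * L * t) * 2"
      using C0 by (intro mult_left_mono) auto
    then show ?thesis using tail[OF that(1,2), of n "m - n"] that(3) by (simp add: mult_ac)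
  qed
  define Z where "Z t x = lim (\<lambda>n. ?P n t x)" for t x
  have half: "(\<lambda>n. c * (1 / 2) ^ n) \<longlonglongrightarrow> (0::real)" for c
    by (intro tendsto_mult_right_zero LIMSEQ_power_zero) simp
  have conv: "(\<lambda>n. ?P n t x) \<longlonglongrightarrow> Z t x" if tx: "0 \<le> t" "x \<in> space N" for t x
  proof -
    have "Cauchy (\<lambda>n. ?P n t x)"
    proof (rule metric_CauchyI)
      fix e :: real assume e: "0 < e"
      have "\<forall>\<^sub>F n in sequentially. 2 * (2 * C * exp (2 * L * t)) * (1 / 2) ^ n < e"
        using order_tendstoD(2)[OF half e] .
      then obtain M where M: "2 * (2 * C * exp (2 * L * t)) * (1 / 2) ^ M < e"
        by (auto simp: eventually_sequentially)
      have "dist (?P m t x) (?P n t x) < e" if "m \<ge> M" "n \<ge> M" for m n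
      proof -
        have "dist (?P m t x) (?P n t x) \<le> norm (?P m t x - ?P M t x) + norm (?P n t x - ?P M t x)"
          using dist_triangle2[of "?P m t x" "?P n t x" "?P M t x"] by (simp add: dist_norm)
        then show ?thesis using tail2[OF tx that(1)] tail2[OF tx that(2)] M by simp
      qed
      then show "\<exists>M. \<forall>m\<ge>M. \<forall>n\<ge>M. dist (?P m t x) (?P n t x) < e" by blast
    qed
    then show ?thesis unfolding Z_def by (simp add: Cauchy_convergent_iff convergent_LIMSEQ_iff)
  qed
  have err: "norm (?P n t x - Z t x) \<le> 2 * C * (1 / 2) ^ n * exp (2 * L * t)"
    if tx: "0 \<le> t" "x \<in> space N" for n t x
  proof -
    have "norm (Z t x - ?P n t x) \<le> 2 * C * exp (2 * L * t) * (1 / 2) ^ n"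
      by (rule LIMSEQ_le_const2[OF tendsto_norm[OF tendsto_diff[OF conv[OF tx] tendsto_const]]])
         (use tail2[OF tx] in blast)
    then show ?thesis by (simp add: norm_minus_commute mult_ac)
  qed
  have lip: "norm (Z t x - Z s x) \<le> K * \<bar>t - s\<bar>" if "0 \<le> s" "0 \<le> t" "x \<in> space N" for s t x
    by (rule LIMSEQ_le_const2[OF tendsto_norm[OF tendsto_diff[OF conv[OF that(2,3)] conv[OF that(1,3)]]]])
       (use nice_picard[OF z] that in \<open>auto simp: nice_def\<close>)
  have bb: "bounded_borel N (Z t)" if t: "0 \<le> t" for t
  proof -
    have m: "Z t \<in> borel_measurable N"
    proof (rule borel_measurable_LIMSEQ_metric[where f = "\<lambda>n. ?P n t"])
      show "?P n t \<in> borel_measurable N" for n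
        using nice_picard[OF z, of n] t by (auto simp: nice_def bounded_borel_def)
    qed (use conv[OF t] in auto)
    obtain B where B: "\<And>x. x \<in> space N \<Longrightarrow> norm (z x) \<le> B" using z by (auto simp: bounded_borel_def)
    have "norm (Z t x) \<le> B + 2 * C * exp (2 * L * t)" if "x \<in> space N" for x
      using err[OF t that, of 0] B[OF that] norm_triangle_ineq2[of "Z t x" "z x"]
      by (simp add: norm_minus_commute)
    then show ?thesis using m unfolding bounded_borel_def by blast
  qed
  have nZ: "nice Z" unfolding nice_def using bb lip by blast
  have eq: "Z t x = z x + integral {0..t} (\<lambda>s. f (Z s) x)" if tx: "0 \<le> t" "x \<in> space N" for t x
  proof -
    have "(\<lambda>n. ?P (Suc n) t x - (z x + integral {0..t} (\<lambda>s. f (Z s) x))) \<longlonglongrightarrow> 0"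
    proof (rule Lim_null_comparison[OF always_eventually half], rule allI)
      fix n
      show "norm (?P (Suc n) t x - (z x + integral {0..t} (\<lambda>s. f (Z s) x))) \<le> C * exp (2 * L * t) * (1 / 2) ^ n"
        using norm_integral_diff_le[OF nice_picard[OF z] nZ tx(2,1) err] by (simp add: mult_ac)
    qed
    then have "(\<lambda>n. ?P (Suc n) t x) \<longlonglongrightarrow> z x + integral {0..t} (\<lambda>s. f (Z s) x)"
      by (rule LIM_zero_cancel)
    then show ?thesis using LIMSEQ_Suc[OF conv[OF tx]] LIMSEQ_unique by blast
  qed
  show ?thesis
  proof (rule that[of Z])
    fix t x assume tx: "0 \<le> (t::real)" "x \<in> space N"
    have "((\<lambda>t. integral {0..t} (\<lambda>s. f (Z s) x)) has_vector_derivative f (Z t) x) (at t within {0..t+1})"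
      by (rule integral_has_vector_derivative)
         (use tx in \<open>auto intro: continuous_on_subset[OF nice_continuous[OF nZ]]\<close>)
    then have "((\<lambda>t. z x + integral {0..t} (\<lambda>s. f (Z s) x)) has_vector_derivative f (Z t) x) (at t within {0..t+1})"
      by (auto intro!: derivative_eq_intros)
    also have "at t within {0..t+1} = at t within {0..}"
      by (rule at_within_nhd[of _ "{..<t+1}"]) (use tx in auto)
    finally show "((\<lambda>t. Z t x) has_vector_derivative f (Z t) x) (at t within {0..})"
      by (rule has_vector_derivative_transform[rotated 2]) (use tx eq in auto)
  qed (use eq bb lip nice_continuous[OF nZ] in auto)
qed

end

section \<open>The undamped particle flow\<close>

lemma abs_fst_le_norm: "\<bar>fst v\<bar> \<le> norm (v :: real \<times> real)"
  using norm_fst_le[of "fst v" "snd v"] by simp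

lemma abs_snd_le_norm: "\<bar>snd v\<bar> \<le> norm (v :: real \<times> real)"
  using norm_snd_le[of "snd v" "fst v"] by simp

lemma norm_le_abs_components: "norm (v :: real \<times> real) \<le> \<bar>fst v\<bar> + \<bar>snd v\<bar>"
  using norm_Pair_le[of "fst v" "snd v"] by simp

section \<open>The globally Lipschitz particle field\<close>

text \<open>A label is the initial position of a particle in [0, 1); an atom of \<open>nu\<close> is
  one label of positive measure.\<close>

locale labels =
  fixes nu :: "real measure"
  assumes fin_nu: "finite_measure nu" and sets_nu: "sets nu = sets circle"
begin

sublocale nu: finite_measure nu by (rule fin_nu)

lemma space_nu [simp]: "space nu = {0..<1}"
  using sets_eq_imp_space_eq[OF sets_nu] by simp

lemma measurable_label [measurable]: "(\<lambda>x. x) \<in> borel_measurable nu"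
proof -
  have "(\<lambda>x. x) \<in> borel_measurable circle" by (rule measurable_circleI) simp
  then show ?thesis using measurable_cong_sets[OF sets_nu refl] by blast
qed

definition M :: real where "M = measure nu {0..<1}"

lemma M_nonneg: "0 \<le> M" by (simp add: M_def)

text \<open>The weights divide by \<open>total\<close>, which vanishes together with M, so the zero
  measure is treated apart throughout.\<close>

lemma M_zero: "M = 0 \<Longrightarrow> (LINT x|nu. f x) = (0::real)"
proof -
  assume "M = 0"
  then have "space nu \<in> null_sets nu" 
    using sets.top[of nu] by (simp add: M_def nu.emeasure_eq_measure null_sets_def)
  then have "AE x in nu. f x = 0" by (rule AE_I') auto
  then show ?thesis by (rule integral_eq_zero_AE)
qed

text \<open>The second component of a state is the logarithm of the momentum density. Positivity is
  thus built in, and the undamped p_t = - p u_x becomes an equation with bounded right-hand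
  side.\<close>

definition total :: "(real \<Rightarrow> real \<times> real) \<Rightarrow> real" where
  "total z = (LINT x|nu. exp (snd (z x)))"

text \<open>The normalisation makes the weights have total mass \<open>M\<close> along every curve, which is what makes
  the vector field globally bounded and Lipschitz; along solutions \<open>total\<close> turns out to be constant.\<close>

definition weight :: "(real \<Rightarrow> real \<times> real) \<Rightarrow> real \<Rightarrow> real" where
  "weight z x = M * exp (snd (z x)) / total z"

text \<open>As long as \<open>fst \<circ> z\<close> is increasing with oscillation less than one, this is
  \<open>dgreen (fst (z x) - fst (z y))\<close>; unlike the latter it depends continuously on \<open>z\<close>.\<close>

definition ker :: "(real \<Rightarrow> real \<times> real) \<Rightarrow> real \<Rightarrow> real \<Rightarrow> real" where
  "ker z x y = max (- 1) (min 1 (fst (z x) - fst (z y))) - sgn (x - y) / 2"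

text \<open>The components are the velocity u at the particle and -u_x there, the logarithmic growth
  rate of its momentum density.\<close>

definition fld :: "(real \<Rightarrow> real \<times> real) \<Rightarrow> real \<Rightarrow> real \<times> real" where
  "fld z x = (LINT y|nu. weight z y * green (fst (z x) - fst (z y)), - (LINT y|nu. weight z y * ker z x y))"

lemma ker_antisym: "ker z y x = - ker z x y"
  by (auto simp: ker_def sgn_if max_def min_def)

lemma abs_ker_le: "\<bar>ker z x y\<bar> \<le> 2"
  by (auto simp: ker_def sgn_if max_def min_def)

context
  fixes z :: "real \<Rightarrow> real \<times> real"
  assumes z: "bounded_borel nu z"
begin

lemma measurable_state [measurable]: "z \<in> borel_measurable nu"
  using z by (simp add: bounded_borel_def)

lemma measurable_components [measurable]:
  "(\<lambda>x. fst (z x)) \<in> borel_measurable nu" "(\<lambda>x. snd (z x)) \<in> borel_measurable nu"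
proof -
  have [measurable]: "fst \<in> borel_measurable (borel :: (real \<times> real) measure)"
    "snd \<in> borel_measurable (borel :: (real \<times> real) measure)"
    by (auto intro!: borel_measurable_continuous_onI continuous_intros)
  show "(\<lambda>x. fst (z x)) \<in> borel_measurable nu" "(\<lambda>x. snd (z x)) \<in> borel_measurable nu" by measurable
qed

lemma state_bound: obtains B where "0 \<le> B" "\<And>x. x \<in> {0..<1} \<Longrightarrow> \<bar>snd (z x)\<bar> \<le> B"
proof -
  obtain B where "\<forall>x\<in>space nu. norm (z x) \<le> B" using z by (auto simp: bounded_borel_def)
  then have B: "norm (z x) \<le> B" if "x \<in> {0..<1}" for x using that by simp
  have "\<bar>snd (z x)\<bar> \<le> B" if "x \<in> {0..<1}" for x
    using B[OF that] abs_snd_le_norm[of "z x"] by simp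
  moreover have "0 \<le> B" using B[of 0] norm_ge_zero[of "z 0"] by (meson atLeastLessThan_iff order_refl order_trans zero_less_one)
  ultimately show ?thesis using that by blast
qed

lemma integrable_exp: "integrable nu (\<lambda>x. exp (snd (z x)))"
proof -
  obtain B where B: "\<And>x. x \<in> {0..<1} \<Longrightarrow> \<bar>snd (z x)\<bar> \<le> B" using state_bound by blast
  show ?thesis by (rule integrable_bounded[OF fin_nu, where B = "exp B"]) (use B in \<open>auto simp: abs_le_iff\<close>)
qed

lemma total_pos: "0 < M \<Longrightarrow> 0 < total z"
proof -
  assume M: "0 < M"
  obtain B where B: "\<And>x. x \<in> {0..<1} \<Longrightarrow> \<bar>snd (z x)\<bar> \<le> B" using state_bound by blast
  have "(LINT x|nu. exp (- B)) \<le> total z" unfolding total_def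
    by (rule integral_mono[OF _ integrable_exp]) (use B in \<open>auto simp: abs_le_iff minus_le_iff\<close>)
  moreover have "(LINT x|nu. exp (- B)) = exp (- B) * M" by (simp add: M_def)
  ultimately show ?thesis using M by (smt (verit) exp_gt_zero mult_pos_pos)
qed

lemma total_nonneg: "0 \<le> total z"
  by (simp add: total_def)

lemma weight_nonneg: "0 \<le> weight z x"
  using M_nonneg total_nonneg by (simp add: weight_def)

lemma measurable_weight [measurable]: "weight z \<in> borel_measurable nu"
  unfolding weight_def[abs_def] by measurable

lemma integrable_weight: "integrable nu (weight z)"
  unfolding weight_def[abs_def] using integrable_exp by simp

lemma integral_weight: "(LINT x|nu. weight z x) = M"
proof (cases "M = 0")
  case False
  then have "0 < total z" using M_nonneg total_pos by simp
  moreover have "(LINT x|nu. weight z x) = M * total z / total z"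
    unfolding weight_def total_def by simp
  ultimately show ?thesis by simp
qed (simp add: M_zero)

lemma weight_bound: obtains B where "\<And>x. x \<in> {0..<1} \<Longrightarrow> weight z x \<le> B"
proof -
  obtain B where B: "\<And>x. x \<in> {0..<1} \<Longrightarrow> \<bar>snd (z x)\<bar> \<le> B" using state_bound by blast
  have "weight z x \<le> M * exp B / total z" if "x \<in> {0..<1}" for x
    unfolding weight_def using B[OF that] M_nonneg total_nonneg
    by (intro divide_right_mono mult_left_mono) auto
  then show ?thesis using that by blast
qed

lemma integrable_weight_mult:
  assumes "k \<in> borel_measurable nu" "\<And>y. \<bar>k y\<bar> \<le> c"
  shows "integrable nu (\<lambda>y. weight z y * k y)"
proof (rule Bochner_Integration.integrable_bound[of _ "\<lambda>y. c * weight z y"])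
  show "integrable nu (\<lambda>y. c * weight z y)" using integrable_weight by simp
  show "AE y in nu. norm (weight z y * k y) \<le> norm (c * weight z y)"
  proof (rule AE_I2)
    fix y
    have "0 \<le> c" using assms(2) order_trans[OF abs_ge_zero] by blast
    then show "norm (weight z y * k y) \<le> norm (c * weight z y)"
      using assms(2)[of y] weight_nonneg[of y] by (simp add: abs_mult mult.commute mult_right_mono)
  qed
qed (use assms(1) in measurable)

lemma abs_integral_weight_le:
  assumes "\<And>y. \<bar>k y\<bar> \<le> c" "k \<in> borel_measurable nu"
  shows "\<bar>LINT y|nu. weight z y * k y\<bar> \<le> c * M"
proof -
  have "\<bar>LINT y|nu. weight z y * k y\<bar> \<le> (LINT y|nu. \<bar>weight z y * k y\<bar>)" by simp
  also have "\<dots> \<le> (LINT y|nu. c * weight z y)"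
  proof (rule integral_mono)
    show "integrable nu (\<lambda>y. \<bar>weight z y * k y\<bar>)" using integrable_weight_mult[OF assms(2,1)] by simp
    show "\<bar>weight z y * k y\<bar> \<le> c * weight z y" for y
      using assms(1)[of y] weight_nonneg[of y] by (simp add: abs_mult mult.commute mult_right_mono)
  qed (use integrable_weight in simp)
  finally show ?thesis by (simp add: integral_weight)
qed

lemma measurable_ker: "ker z x \<in> borel_measurable nu"
  unfolding ker_def[abs_def] by measurable

lemma measurable_green_state: "(\<lambda>y. green (c - fst (z y))) \<in> borel_measurable nu"
  by measurable

lemma fld_measurable: "fld z \<in> borel_measurable nu"
proof -
  have [measurable]: "(\<lambda>(x, y). weight z y * green (fst (z x) - fst (z y))) \<in> borel_measurable (nu \<Otimes>\<^sub>M nu)"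
    "(\<lambda>(x, y). weight z y * ker z x y) \<in> borel_measurable (nu \<Otimes>\<^sub>M nu)"
    unfolding ker_def by measurable
  show ?thesis unfolding fld_def[abs_def] by measurable
qed

lemma fld_bound: "norm (fld z x) \<le> 4 * M"
proof -
  have "norm (fld z x) \<le> \<bar>LINT y|nu. weight z y * green (fst (z x) - fst (z y))\<bar> + \<bar>LINT y|nu. weight z y * ker z x y\<bar>"
    using norm_le_abs_components[of "fld z x"] by (simp add: fld_def)
  also have "\<dots> \<le> 2 * M + 2 * M"
    by (intro add_mono abs_integral_weight_le abs_green_le abs_ker_le measurable_ker measurable_green_state)
  finally show ?thesis by simp
qed

end

text \<open>The numerator and \<open>total\<close> each change by a factor of at most exp d, hence
  the weight by at most exp (2 d). For d \<le> 1, exp (2 d) - 1 \<le> 2 d exp (2 d) \<le> 18 d,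
  since exp 2 \<le> 9, and the two weights together have mass 2 M. For larger d the trivial bound 2
  M is enough.\<close>

lemma weight_diff_le:
  assumes z: "bounded_borel nu z" and z': "bounded_borel nu z'"
    and d: "\<And>x. x \<in> {0..<1} \<Longrightarrow> norm (z x - z' x) \<le> d"
  shows "(LINT x|nu. \<bar>weight z x - weight z' x\<bar>) \<le> 36 * M * d"
proof (cases "M = 0")
  case False
  then have M: "0 < M" using M_nonneg by simp
  have d0: "0 \<le> d" using order_trans[OF norm_ge_zero d[of 0]] by simp
  have dd: "\<bar>snd (z x) - snd (z' x)\<bar> \<le> d" if "x \<in> {0..<1}" for x
    using d[OF that] abs_snd_le_norm[of "z x - z' x"] by simp
  have le: "weight w x \<le> exp (2 * d) * weight w' x"
    if w: "bounded_borel nu w" "bounded_borel nu w'"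
      and dw: "\<And>x. x \<in> {0..<1} \<Longrightarrow> \<bar>snd (w x) - snd (w' x)\<bar> \<le> d" and x: "x \<in> {0..<1}" for w w' x
  proof -
    have e: "exp (snd (w x)) \<le> exp d * exp (snd (w' x))" "exp (snd (w' x)) \<le> exp d * exp (snd (w x))"
      if "x \<in> {0..<1}" for x
      using dw[OF that] by (auto simp: exp_add[symmetric])
    have "total w' \<le> exp d * total w"
      unfolding total_def integral_mult_right_zero[symmetric]
      by (rule integral_mono) (use e w integrable_exp in auto)
    then have "1 / total w \<le> exp d / total w'"
      using total_pos[OF w(1) M] total_pos[OF w(2) M] by (simp add: field_simps)
    then have "(M * exp (snd (w x))) * (1 / total w) \<le> (M * (exp d * exp (snd (w' x)))) * (exp d / total w')"
      using e(1)[OF x] M total_pos[OF w(1) M] by (intro mult_mono mult_left_mono) auto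
    also have "\<dots> = exp (2 * d) * weight w' x"
      by (simp add: weight_def exp_double power2_eq_square)
    finally show ?thesis by (simp add: weight_def)
  qed
  have nn: "0 \<le> weight z x" "0 \<le> weight z' x" for x using weight_nonneg z z' by auto
  have i: "integrable nu (\<lambda>x. \<bar>weight z x - weight z' x\<bar>)" "integrable nu (\<lambda>x. weight z x + weight z' x)"
    using integrable_weight z z' by auto
  have s: "(LINT x|nu. weight z x + weight z' x) = 2 * M"
    using integrable_weight z z' by (simp add: integral_weight)
  show ?thesis
  proof (cases "d \<le> 1")
    case True
    have "\<bar>weight z x - weight z' x\<bar> \<le> (exp (2 * d) - 1) * (weight z x + weight z' x)" if x: "x \<in> {0..<1}" for x
    proof -
      have "weight z x \<le> exp (2 * d) * weight z' x" by (rule le[OF z z' dd x])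
      moreover have "weight z' x \<le> exp (2 * d) * weight z x"
        by (rule le[OF z' z _ x]) (use dd in \<open>simp add: abs_minus_commute\<close>)
      moreover have "0 \<le> (exp (2 * d) - 1) * weight z x" "0 \<le> (exp (2 * d) - 1) * weight z' x"
        using nn d0 by auto
      ultimately show ?thesis by (auto simp: abs_le_iff algebra_simps)
    qed
    then have "(LINT x|nu. \<bar>weight z x - weight z' x\<bar>) \<le> (LINT x|nu. (exp (2 * d) - 1) * (weight z x + weight z' x))"
      by (intro integral_mono[OF i(1)]) (use i(2) in auto)
    also have "\<dots> = (exp (2 * d) - 1) * (2 * M)" by (simp add: s)
    also have "\<dots> \<le> (18 * d) * (2 * M)"
    proof (rule mult_right_mono)
      have "exp (2 * d) - 1 \<le> 2 * d * exp (2 * d)"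
      proof -
        have "exp (2 * d) * (1 - 2 * d) \<le> exp (2 * d) * exp (- (2 * d))"
          using exp_ge_add_one_self[of "- (2 * d)"] by (intro mult_left_mono) auto
        then show ?thesis by (simp add: exp_minus field_simps)
      qed
      also have "exp (2 * d) \<le> 9"
      proof -
        have "exp (2 * d) \<le> exp (2 * 1)" using True by simp
        also have "\<dots> = (exp 1)\<^sup>2" by (rule exp_double)
        also have "\<dots> \<le> 3\<^sup>2" using exp_le by (intro power_mono) auto
        finally show ?thesis by simp
      qed
      then have "2 * d * exp (2 * d) \<le> 2 * d * 9" using d0 by (intro mult_left_mono) auto
      finally show "exp (2 * d) - 1 \<le> 18 * d" by simp
    qed (use M in simp)
    finally show ?thesis by (simp add: mult_ac)
  next
    case False
    have "(LINT x|nu. \<bar>weight z x - weight z' x\<bar>) \<le> (LINT x|nu. weight z x + weight z' x)"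
      by (intro integral_mono i) (use nn in \<open>auto simp: abs_le_iff\<close>)
    also have "\<dots> \<le> 36 * M * d" unfolding s using M False by (simp add: mult.assoc)
    finally show ?thesis .
  qed
qed (simp add: M_zero)

text \<open>The product is split as k (w - w') + (k - k') w'. The bound 2 on k doubles the constant
  36, and the mass M of w' multiplies e.\<close>

lemma integral_weight_diff_le:
  assumes z: "bounded_borel nu z" "bounded_borel nu z'"
    and d: "\<And>x. x \<in> {0..<1} \<Longrightarrow> norm (z x - z' x) \<le> d"
    and k: "k \<in> borel_measurable nu" "k' \<in> borel_measurable nu"
    and b: "\<And>y. \<bar>k y\<bar> \<le> 2" "\<And>y. \<bar>k' y\<bar> \<le> 2" "\<And>y. y \<in> {0..<1} \<Longrightarrow> \<bar>k y - k' y\<bar> \<le> e"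
  shows "\<bar>(LINT y|nu. weight z y * k y) - (LINT y|nu. weight z' y * k' y)\<bar> \<le> 72 * M * d + M * e"
proof -
  note i1 = integrable_weight_mult[OF z(1) k(1) b(1)] and i2 = integrable_weight_mult[OF z(2) k(2) b(2)]
  have iw: "integrable nu (\<lambda>y. 2 * \<bar>weight z y - weight z' y\<bar>)" "integrable nu (\<lambda>y. e * weight z' y)"
    using z integrable_weight by auto
  have "\<bar>(LINT y|nu. weight z y * k y) - (LINT y|nu. weight z' y * k' y)\<bar> =
      \<bar>LINT y|nu. weight z y * k y - weight z' y * k' y\<bar>" using i1 i2 by simp
  also have "\<dots> \<le> (LINT y|nu. \<bar>weight z y * k y - weight z' y * k' y\<bar>)" by simp
  also have "\<dots> \<le> (LINT y|nu. 2 * \<bar>weight z y - weight z' y\<bar> + e * weight z' y)"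
  proof (rule integral_mono)
    fix y assume y: "y \<in> space nu"
    have "weight z y * k y - weight z' y * k' y = k y * (weight z y - weight z' y) + (k y - k' y) * weight z' y"
      by (simp add: algebra_simps)
    also have "\<bar>\<dots>\<bar> \<le> \<bar>k y * (weight z y - weight z' y)\<bar> + \<bar>(k y - k' y) * weight z' y\<bar>" by (rule abs_triangle_ineq)
    also have "\<dots> \<le> 2 * \<bar>weight z y - weight z' y\<bar> + e * weight z' y"
      unfolding abs_mult abs_of_nonneg[OF weight_nonneg[OF z(2)]]
      using b y weight_nonneg[OF z(2)] by (intro add_mono mult_right_mono) auto
    finally show "\<bar>weight z y * k y - weight z' y * k' y\<bar> \<le> 2 * \<bar>weight z y - weight z' y\<bar> + e * weight z' y" .
  qed (use i1 i2 iw in auto)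
  also have "\<dots> = 2 * (LINT y|nu. \<bar>weight z y - weight z' y\<bar>) + e * M"
    using iw z integrable_weight by (simp add: integral_weight)
  finally show ?thesis using weight_diff_le[OF z d] by (simp add: mult_ac)
qed

text \<open>The constant is 147 = (72 + 1) + (72 + 2), from \<open>green\<close> and
  \<open>ker\<close> respectively; the added 1 keeps it positive when M = 0, as
  \<open>lipschitz_field\<close> demands.\<close>

lemma fld_lipschitz:
  assumes z: "bounded_borel nu z" "bounded_borel nu z'"
    and d: "\<And>x. x \<in> {0..<1} \<Longrightarrow> norm (z x - z' x) \<le> d" and x: "x \<in> {0..<1}"
  shows "norm (fld z x - fld z' x) \<le> (147 * M + 1) * d"
proof -
  have d0: "0 \<le> d" using order_trans[OF norm_ge_zero d[OF x]] .
  have f: "\<bar>(fst (z x) - fst (z y)) - (fst (z' x) - fst (z' y))\<bar> \<le> 2 * d" if "y \<in> {0..<1}" for y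
    using d[OF that] abs_fst_le_norm[of "z y - z' y"] d[OF x] abs_fst_le_norm[of "z x - z' x"]
    unfolding fst_diff by linarith
  have "norm (fld z x - fld z' x) \<le>
    \<bar>(LINT y|nu. weight z y * green (fst (z x) - fst (z y))) - (LINT y|nu. weight z' y * green (fst (z' x) - fst (z' y)))\<bar> +
    \<bar>(LINT y|nu. weight z y * ker z x y) - (LINT y|nu. weight z' y * ker z' x y)\<bar>"
    using norm_le_abs_components[of "fld z x - fld z' x"] by (simp add: fld_def abs_minus_commute)
  also have "\<dots> \<le> (72 * M * d + M * d) + (72 * M * d + M * (2 * d))"
  proof (rule add_mono; rule integral_weight_diff_le[OF z d])
    show "\<bar>green (fst (z x) - fst (z y)) - green (fst (z' x) - fst (z' y))\<bar> \<le> d" if "y \<in> {0..<1}" for y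
      using green_lipschitz[of "fst (z x) - fst (z y)" "fst (z' x) - fst (z' y)"] f[OF that] by simp
    \<comment> \<open>The sign depends on the labels only and cancels; the clipping to [-1, 1] does
      not increase distances.\<close>
    show "\<bar>ker z x y - ker z' x y\<bar> \<le> 2 * d" if "y \<in> {0..<1}" for y
      using f[OF that] by (auto simp: ker_def max_def min_def abs_le_iff)
  qed (use z in \<open>auto intro: measurable_ker measurable_green_state abs_green_le abs_ker_le\<close>)
  also have "\<dots> \<le> (147 * M + 1) * d" using d0 by (simp add: algebra_simps)
  finally show ?thesis .
qed

sublocale lipschitz_field nu fld "4 * M" "147 * M + 1"
  by unfold_locales
     (use fld_measurable fld_bound fld_lipschitz M_nonneg in auto)

end

lemma at_within_atLeast:
  fixes a t :: real
  assumes "a < t"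
  shows "at t within {a..} = at t"
  by (rule at_within_interior) (use assms in simp)

text \<open>\<open>(d t)\<^sup>2 * exp (2 * L * t)\<close> is nondecreasing, so \<open>d\<close> has no zero.\<close>

lemma positive_of_linear_growth:
  fixes d d' :: "real \<Rightarrow> real"
  assumes der: "\<And>t. 0 \<le> t \<Longrightarrow> (d has_real_derivative d' t) (at t within {0..})"
    and le: "\<And>t. 0 \<le> t \<Longrightarrow> \<bar>d' t\<bar> \<le> L * \<bar>d t\<bar>" and "0 < d 0" and t: "0 \<le> t"
  shows "0 < d t"
proof -
  have cont: "continuous_on {0..} d"
    by (rule DERIV_continuous_on[OF der]) simp
  have nz: "d s \<noteq> 0" if s: "0 \<le> s" for s
  proof -
    have "(d 0)\<^sup>2 * exp (2 * L * 0) \<le> (d s)\<^sup>2 * exp (2 * L * s)"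
    proof (rule DERIV_nonneg_imp_increasing_open[OF s])
      show "continuous_on {0..s} (\<lambda>s. (d s)\<^sup>2 * exp (2 * L * s))"
        by (intro continuous_intros continuous_on_subset[OF cont]) auto
      fix x assume x: "0 < x" "x < s"
      have "(d has_real_derivative d' x) (at x)" using der[of x] x at_within_atLeast[of 0 x] by simp
      then have "((\<lambda>s. (d s)\<^sup>2 * exp (2 * L * s)) has_real_derivative
          2 * exp (2 * L * x) * (d x * d' x + L * (d x)\<^sup>2)) (at x)"
        by (auto intro!: derivative_eq_intros simp: algebra_simps power2_eq_square)
      moreover have "- (d x * d' x) \<le> L * (d x)\<^sup>2"
      proof -
        have "- (d x * d' x) \<le> \<bar>d x\<bar> * \<bar>d' x\<bar>" by (simp add: abs_mult[symmetric])
        also have "\<dots> \<le> \<bar>d x\<bar> * (L * \<bar>d x\<bar>)" using le[of x] x by (intro mult_left_mono) auto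
        finally show ?thesis by (simp add: power2_eq_square mult_ac flip: abs_mult)
      qed
      ultimately show "\<exists>y. ((\<lambda>s. (d s)\<^sup>2 * exp (2 * L * s)) has_real_derivative y) (at x) \<and> 0 \<le> y"
        by (intro exI conjI) (assumption, simp)
    qed
    moreover have "0 < (d 0)\<^sup>2 * exp (2 * L * 0)" using assms(3) by simp
    ultimately show ?thesis by auto
  qed
  show ?thesis
  proof (rule ccontr)
    assume "\<not> 0 < d t"
    then have "\<exists>s\<ge>0. s \<le> t \<and> d s = 0"
      using IVT2'[of d t 0 0] assms(3) t continuous_on_subset[OF cont, of "{0..t}"] by fastforce
    then show False using nz by auto
  qed
qed

section \<open>Order, mass and energy along the particle flow\<close>

text \<open>The initial state (x, 0) puts each particle at its label with momentum density exp 0 =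
  1, so that \<open>nu\<close> itself is the initial momentum.\<close>

locale lagrangian = labels +
  fixes Z :: "real \<Rightarrow> real \<Rightarrow> real \<times> real"
  assumes Z0: "\<And>x. x \<in> {0..<1} \<Longrightarrow> Z 0 x = (x, 0)"
    and Z_bb: "\<And>t. 0 \<le> t \<Longrightarrow> bounded_borel nu (Z t)"
    and Z_lip: "\<And>s t x. 0 \<le> s \<Longrightarrow> 0 \<le> t \<Longrightarrow> x \<in> {0..<1} \<Longrightarrow> norm (Z t x - Z s x) \<le> 4 * M * \<bar>t - s\<bar>"
    and Z_der: "\<And>t x. 0 \<le> t \<Longrightarrow> x \<in> {0..<1} \<Longrightarrow>
      ((\<lambda>t. Z t x) has_vector_derivative fld (Z t) x) (at t within {0..})"
    and Z_cont: "\<And>x. x \<in> {0..<1} \<Longrightarrow> continuous_on {0..} (\<lambda>t. fld (Z t) x)"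
begin

definition Q where "Q t x = fst (Z t x)"
definition R where "R t x = snd (Z t x)"
definition Qd where "Qd t x = fst (fld (Z t) x)"
definition Rd where "Rd t x = snd (fld (Z t) x)"

lemma Q_der: "0 \<le> t \<Longrightarrow> x \<in> {0..<1} \<Longrightarrow> ((\<lambda>t. Q t x) has_real_derivative Qd t x) (at t within {0..})"
  unfolding Q_def Qd_def has_real_derivative_iff_has_vector_derivative
  by (rule bounded_linear.has_vector_derivative[OF bounded_linear_fst Z_der])

lemma R_der: "0 \<le> t \<Longrightarrow> x \<in> {0..<1} \<Longrightarrow> ((\<lambda>t. R t x) has_real_derivative Rd t x) (at t within {0..})"
  unfolding R_def Rd_def has_real_derivative_iff_has_vector_derivative
  by (rule bounded_linear.has_vector_derivative[OF bounded_linear_snd Z_der])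

lemma Qd_cont: "x \<in> {0..<1} \<Longrightarrow> continuous_on {0..} (\<lambda>t. Qd t x)"
  and Rd_cont: "x \<in> {0..<1} \<Longrightarrow> continuous_on {0..} (\<lambda>t. Rd t x)"
  unfolding Qd_def Rd_def
  by (rule continuous_on_fst[OF Z_cont] continuous_on_snd[OF Z_cont]; assumption)+

lemma Q_cont: "x \<in> {0..<1} \<Longrightarrow> continuous_on {0..} (\<lambda>t. Q t x)"
  and R_cont: "x \<in> {0..<1} \<Longrightarrow> continuous_on {0..} (\<lambda>t. R t x)"
  by (rule DERIV_continuous_on[OF Q_der] DERIV_continuous_on[OF R_der]; simp)+

lemma Q_meas: "0 \<le> t \<Longrightarrow> Q t \<in> borel_measurable nu"
  and R_meas: "0 \<le> t \<Longrightarrow> R t \<in> borel_measurable nu"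
  unfolding Q_def[abs_def] R_def[abs_def] using measurable_components[OF Z_bb] by auto

lemma fst_meas: "f \<in> borel_measurable nu \<Longrightarrow> (\<lambda>x. fst (f x :: real \<times> real)) \<in> borel_measurable nu"
  and snd_meas: "f \<in> borel_measurable nu \<Longrightarrow> (\<lambda>x. snd (f x :: real \<times> real)) \<in> borel_measurable nu"
  by (rule measurable_compose[where N = borel]; auto intro!: borel_measurable_continuous_onI continuous_intros)+

lemma Qd_meas: "0 \<le> t \<Longrightarrow> Qd t \<in> borel_measurable nu"
  and Rd_meas: "0 \<le> t \<Longrightarrow> Rd t \<in> borel_measurable nu"
  unfolding Qd_def[abs_def] Rd_def[abs_def] using fld_measurable[OF Z_bb] by (auto intro: fst_meas snd_meas)

lemma Qd_bd: "0 \<le> t \<Longrightarrow> \<bar>Qd t x\<bar> \<le> 4 * M"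
  and Rd_bd: "0 \<le> t \<Longrightarrow> \<bar>Rd t x\<bar> \<le> 4 * M"
  unfolding Qd_def Rd_def
  using fld_bound[OF Z_bb, of t x] abs_fst_le_norm[of "fld (Z t) x"] abs_snd_le_norm[of "fld (Z t) x"]
  by auto

lemma R_bd: "0 \<le> t \<Longrightarrow> x \<in> {0..<1} \<Longrightarrow> \<bar>R t x\<bar> \<le> 4 * M * t"
  using Z_lip[of 0 t x] Z0[of x] abs_snd_le_norm[of "Z t x - Z 0 x"] by (simp add: R_def)

lemma R0: "x \<in> {0..<1} \<Longrightarrow> R 0 x = 0" and Q0: "x \<in> {0..<1} \<Longrightarrow> Q 0 x = x"
  using Z0 by (auto simp: R_def Q_def)

text \<open>\<open>ker\<close> is antisymmetric: exchanging the two particles shows that the double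
  integral is its own negative. This is the law of action and reaction.\<close>

lemma weight_Rd: 
  assumes "bounded_borel nu z"
  shows "(LINT x|nu. weight z x * snd (fld z x)) = 0"
proof -
  have [measurable]: "(\<lambda>x. fst (z x)) \<in> borel_measurable nu" "weight z \<in> borel_measurable nu"
    using measurable_components[OF assms] measurable_weight[OF assms] by auto
  obtain B where B: "\<And>x. x \<in> {0..<1} \<Longrightarrow> weight z x \<le> B" using weight_bound[OF assms] by blast
  have nn: "0 \<le> weight z x" for x by (rule weight_nonneg[OF assms])
  let ?A = "LINT x|nu. LINT y|nu. weight z x * (weight z y * ker z x y)"
  have "?A = (LINT y|nu. LINT x|nu. weight z x * (weight z y * ker z x y))"
  proof (rule fubini_bounded(3)[OF fin_nu fin_nu])
    show "(\<lambda>(x, y). weight z x * (weight z y * ker z x y)) \<in> borel_measurable (nu \<Otimes>\<^sub>M nu)"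
      unfolding ker_def by measurable
    fix x y assume xy: "x \<in> space nu" "y \<in> space nu"
    have "0 \<le> B" using B[of x] nn[of x] xy by simp
    then show "\<bar>weight z x * (weight z y * ker z x y)\<bar> \<le> B * (B * 2)"
      unfolding abs_mult using nn B xy abs_ker_le by (intro mult_mono) auto
  qed
  also have "\<dots> = (LINT y|nu. LINT x|nu. - (weight z y * (weight z x * ker z y x)))"
  proof (intro Bochner_Integration.integral_cong refl)
    show "weight z x * (weight z y * ker z x y) = - (weight z y * (weight z x * ker z y x))" for x y
      using ker_antisym[of z x y] by simp
  qed
  also have "\<dots> = - ?A" by simp
  finally have "?A = 0" by simp
  then show ?thesis by (simp add: fld_def)
qed

text \<open>The rate of change of \<open>total\<close> is a multiple of the integral that vanishes
  in \<open>weight_Rd\<close>. Along the solution the normalising factor is therefore 1, and the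
  modified field coincides with that of the particle system.\<close>

lemma total_const: "0 \<le> T \<Longrightarrow> total (Z T) = M"
proof (cases "M = 0")
  case False
  assume T: "0 \<le> T"
  have M: "0 < M" using False M_nonneg by simp
  have "(LINT x|nu. exp (R T x) - exp (R 0 x)) =
      (LINT t|restrict_space lborel {0..T}. LINT x|nu. exp (R t x) * Rd t x)"
  proof (rule integral_time_derivative[OF fin_nu T, where B = "exp (4 * M * T) * (4 * M)"])
    fix x t assume x: "x \<in> space nu" and t: "t \<in> {0..T}"
    have "((\<lambda>t. exp (R t x)) has_real_derivative exp (R t x) * Rd t x) (at t within {0..})"
      using R_der[of t x] x t by (auto intro!: derivative_eq_intros)
    then show "((\<lambda>t. exp (R t x)) has_real_derivative exp (R t x) * Rd t x) (at t within {0..T})"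
      by (rule DERIV_subset) auto
    have "R t x \<le> 4 * M * t" using R_bd[of t x] x t by (simp add: abs_le_iff)
    also have "\<dots> \<le> 4 * M * T" using t M by (intro mult_left_mono) auto
    finally show "\<bar>exp (R t x) * Rd t x\<bar> \<le> exp (4 * M * T) * (4 * M)"
      unfolding abs_mult using Rd_bd[of t x] t by (intro mult_mono) auto
  next
    show "continuous_on {0..T} (\<lambda>t. exp (R t x) * Rd t x)" if "x \<in> space nu" for x
      using that by (intro continuous_intros continuous_on_subset[OF R_cont] continuous_on_subset[OF Rd_cont]) auto
    show "(\<lambda>x. exp (R t x) * Rd t x) \<in> borel_measurable nu" if "t \<in> {0..T}" for t
      using R_meas[of t] Rd_meas[of t] that by (intro borel_measurable_times measurable_compose[OF _ borel_measurable_exp]) auto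
  qed
  also have "\<dots> = (LINT t|restrict_space lborel {0..T}. 0)"
  proof (rule Bochner_Integration.integral_cong[OF refl])
    fix t assume "t \<in> space (restrict_space lborel {0..T})"
    then have t: "0 \<le> t" by (simp add: space_restrict_space)
    have tp: "0 < total (Z t)" by (rule total_pos[OF Z_bb[OF t] M])
    have "exp (R t x) * Rd t x = total (Z t) / M * (weight (Z t) x * snd (fld (Z t) x))" for x
      using tp M by (simp add: weight_def R_def Rd_def)
    then have "(LINT x|nu. exp (R t x) * Rd t x) =
        (LINT x|nu. total (Z t) / M * (weight (Z t) x * snd (fld (Z t) x)))" by presburger
    also have "\<dots> = total (Z t) / M * (LINT x|nu. weight (Z t) x * snd (fld (Z t) x))"
      by (rule integral_mult_right_zero)
    finally show "(LINT x|nu. exp (R t x) * Rd t x) = 0" by (simp add: weight_Rd[OF Z_bb[OF t]])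
  qed
  finally have z: "(LINT x|nu. exp (R T x) - exp (R 0 x)) = 0" by simp
  have "(LINT x|nu. exp (R T x) - exp (R 0 x)) = (LINT x|nu. exp (R T x)) - (LINT x|nu. exp (R 0 x))"
    unfolding R_def by (rule Bochner_Integration.integral_diff) (use integrable_exp[OF Z_bb] T in auto)
  moreover have "(LINT x|nu. exp (R 0 x)) = M"
    using Bochner_Integration.integral_cong[OF refl, of nu "\<lambda>x. exp (R 0 x)" "\<lambda>_. 1"] by (simp add: R0 M_def)
  ultimately show ?thesis using z by (simp add: total_def R_def)
qed (simp add: total_def M_zero)

definition E where "E t x = exp (R t x)"

lemma E_meas: "0 \<le> t \<Longrightarrow> E t \<in> borel_measurable nu"
  unfolding E_def[abs_def] using R_meas[of t] by measurable

lemma integral_E: "0 \<le> t \<Longrightarrow> (LINT y|nu. E t y) = M"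
  using total_const[of t] by (simp add: total_def E_def R_def)

lemma weight_eq_E: "0 \<le> t \<Longrightarrow> (LINT y|nu. weight (Z t) y * k y) = (LINT y|nu. E t y * k y)"
proof (cases "M = 0")
  case False
  assume "0 \<le> t"
  then have "weight (Z t) y = E t y" for y
    using False total_const[of t] by (simp add: weight_def E_def R_def)
  then show ?thesis by simp
qed (simp add: M_zero)

lemma Qd_eq: "0 \<le> t \<Longrightarrow> Qd t x = (LINT y|nu. E t y * green (Q t x - Q t y))"
  using weight_eq_E[of t "\<lambda>y. green (Q t x - Q t y)"] by (simp add: Qd_def fld_def Q_def)

text \<open>Velocities depend Lipschitz continuously on positions, because \<open>green\<close>
  does. The gap and its complement to 1 thus grow or decay at most exponentially, and
  \<open>positive_of_linear_growth\<close> excludes zeros.\<close>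

lemma order_preserved:
  assumes t: "0 \<le> t" and xy: "x \<in> {0..<1}" "y \<in> {0..<1}" "y < x"
  shows "0 < Q t x - Q t y" and "Q t x - Q t y < 1"
proof -
  \<comment> \<open>The shift n = 0 rules out a collision of x with y, and n = -1 a collision of x
    with the copy of y one period ahead.\<close>
  have le: "\<bar>Qd t x - Qd t y\<bar> \<le> M * \<bar>Q t x + of_int n - Q t y\<bar>" if t: "0 \<le> t" for t and n :: int
  proof -
    let ?k = "\<lambda>c y. green (fst (Z t c) - fst (Z t y))"
    have i: "integrable nu (\<lambda>y. weight (Z t) y * ?k c y)" for c
      by (rule integrable_weight_mult[OF Z_bb[OF t] _ abs_green_le]) (rule measurable_green_state[OF Z_bb[OF t]])
    have "Qd t x - Qd t y = (LINT c|nu. weight (Z t) c * (?k x c - ?k y c))"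
      unfolding Qd_def fld_def using i by (simp add: right_diff_distrib)
    also have "\<bar>\<dots>\<bar> \<le> \<bar>Q t x + of_int n - Q t y\<bar> * M"
    proof (rule abs_integral_weight_le[OF Z_bb[OF t]])
      show "\<bar>?k x c - ?k y c\<bar> \<le> \<bar>Q t x + of_int n - Q t y\<bar>" for c
      proof -
        have "?k x c = green (Q t x + of_int n - Q t c)"
          using periodic1_add_int[OF periodic1_green, of "Q t x - Q t c" n] by (simp add: Q_def algebra_simps)
        moreover have "\<bar>green (Q t x + of_int n - Q t c) - green (Q t y - Q t c)\<bar> \<le> \<bar>Q t x + of_int n - Q t y\<bar>"
        proof (rule order_trans[OF green_lipschitz])
          have eq: "Q t x + of_int n - Q t c - (Q t y - Q t c) = Q t x + of_int n - Q t y" by simp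
          show "\<bar>Q t x + of_int n - Q t c - (Q t y - Q t c)\<bar> / 2 \<le> \<bar>Q t x + of_int n - Q t y\<bar>"
            unfolding eq by simp
        qed
        ultimately show ?thesis by (simp add: Q_def)
      qed
      show "(\<lambda>c. ?k x c - ?k y c) \<in> borel_measurable nu"
        using measurable_green_state[OF Z_bb[OF t]] by (rule borel_measurable_diff) (rule measurable_green_state[OF Z_bb[OF t]])
    qed
    finally show ?thesis by (simp add: mult.commute)
  qed
  show "0 < Q t x - Q t y"
  proof (rule positive_of_linear_growth[where L = M, OF _ _ _ t])
    show "((\<lambda>t. Q t x - Q t y) has_real_derivative Qd t x - Qd t y) (at t within {0..})" if "0 \<le> t" for t
      using Q_der[OF that] xy by (auto intro!: derivative_intros)
    show "\<bar>Qd t x - Qd t y\<bar> \<le> M * \<bar>Q t x - Q t y\<bar>" if "0 \<le> t" for t using le[OF that, of 0] by simp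
  qed (use xy Q0 in auto)
  have "0 < 1 - (Q t x - Q t y)"
  proof (rule positive_of_linear_growth[where L = M and d = "\<lambda>t. 1 - (Q t x - Q t y)", OF _ _ _ t])
    show "((\<lambda>t. 1 - (Q t x - Q t y)) has_real_derivative - (Qd t x - Qd t y)) (at t within {0..})" if "0 \<le> t" for t
      using Q_der[OF that] xy by (auto intro!: derivative_eq_intros)
    show "\<bar>- (Qd t x - Qd t y)\<bar> \<le> M * \<bar>1 - (Q t x - Q t y)\<bar>" if "0 \<le> t" for t
      using le[OF that, of "-1"] by (simp add: abs_minus_commute algebra_simps)
  qed (use xy Q0 in auto)
  then show "Q t x - Q t y < 1" by simp
qed

lemma ker_eq:
  assumes t: "0 \<le> t" and xy: "x \<in> {0..<1}" "y \<in> {0..<1}"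
  shows "ker (Z t) x y = dgreen (Q t x - Q t y)"
proof -
  consider "x = y" | "y < x" | "x < y" by linarith
  then show ?thesis
  proof cases
    case 2
    then show ?thesis using order_preserved[OF t xy 2] by (simp add: ker_def Q_def dgreen_unit)
  next
    case 3
    then show ?thesis using order_preserved[OF t xy(2,1) 3] dgreen_minus[of "Q t y - Q t x"]
      by (simp add: ker_def Q_def dgreen_unit)
  qed (simp add: ker_def)
qed

lemma Rd_eq: "0 \<le> t \<Longrightarrow> x \<in> {0..<1} \<Longrightarrow> Rd t x = - (LINT y|nu. E t y * ker (Z t) x y)"
  using weight_eq_E[of t "ker (Z t) x"] by (simp add: Rd_def fld_def)

lemma E_bd: "0 \<le> t \<Longrightarrow> t \<le> T \<Longrightarrow> x \<in> {0..<1} \<Longrightarrow> \<bar>E t x\<bar> \<le> exp (4 * M * T)"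
proof -
  assume *: "0 \<le> t" "t \<le> T" "x \<in> {0..<1}"
  then have "R t x \<le> 4 * M * t" using R_bd[of t x] by (simp add: abs_le_iff)
  also have "\<dots> \<le> 4 * M * T" using * M_nonneg by (intro mult_left_mono) auto
  finally show ?thesis by (simp add: E_def)
qed

lemma E_der: "0 \<le> t \<Longrightarrow> x \<in> {0..<1} \<Longrightarrow> ((\<lambda>t. E t x) has_real_derivative E t x * Rd t x) (at t within {0..})"
  unfolding E_def using R_der[of t x] by (auto intro!: derivative_eq_intros)

text \<open>For distinct labels the gap stays strictly between 0 and 1 in absolute value, so the
  corner of \<open>green\<close> is never met. For equal labels the function is constant and
  \<open>ker\<close> is 0.\<close>

lemma green_Q_der:
  assumes t: "0 \<le> t" and xy: "x \<in> {0..<1}" "y \<in> {0..<1}"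
  shows "((\<lambda>t. green (Q t x - Q t y)) has_real_derivative ker (Z t) x y * (Qd t x - Qd t y)) (at t within {0..})"
proof (cases "x = y")
  case False
  have ni: "Q t x - Q t y \<notin> \<int>"
  proof
    assume "Q t x - Q t y \<in> \<int>"
    then obtain n :: int where n: "Q t x - Q t y = of_int n" by (auto elim: Ints_cases)
    have "0 < \<bar>Q t x - Q t y\<bar> \<and> \<bar>Q t x - Q t y\<bar> < 1"
    proof (cases "y < x")
      case True
      then show ?thesis using order_preserved[OF t xy] by simp
    next
      case False
      then show ?thesis using order_preserved[OF t xy(2,1)] \<open>x \<noteq> y\<close> by simp
    qed
    then show False unfolding n by (simp flip: of_int_abs)
  qed
  have "((\<lambda>t. Q t x - Q t y) has_real_derivative Qd t x - Qd t y) (at t within {0..})"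
    using Q_der[OF t] xy by (auto intro!: derivative_intros)
  from DERIV_chain2[OF DERIV_green[OF ni] this] show ?thesis by (simp add: ker_eq[OF t xy])
qed (simp add: ker_def)

text \<open>Hamilton's equations: up to the factor E, velocity and force are the partial derivatives
  of this double integral, so its rate of change cancels particle by particle.\<close>

lemma energy_const:
  assumes T: "0 \<le> T"
  shows "(LINT x|nu. LINT y|nu. E T x * E T y * green (Q T x - Q T y)) = (LINT x|nu. LINT y|nu. green (x - y))"
proof -
  let ?N = "nu \<Otimes>\<^sub>M nu"
  interpret P: pair_sigma_finite nu nu by unfold_locales
  have fN: "finite_measure ?N" by (simp add: fin_nu finite_measure_pair_measure)
  define F where "F t = (\<lambda>(x, y). E t x * E t y * green (Q t x - Q t y))" for t
  \<comment> \<open>The contribution of the motion of x; by the symmetry of \<open>green\<close>,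
    that of y is the transpose.\<close>
  define G where "G t x y = E t x * E t y * (Rd t x * green (Q t x - Q t y) + ker (Z t) x y * Qd t x)" for t x y
  define F' where "F' t = (\<lambda>(x, y). G t x y + G t y x)" for t
  define B where "B = exp (4 * M * T)"
  have M0: "0 \<le> M" by (rule M_nonneg)
  have Gb: "\<bar>G t x y\<bar> \<le> B * B * (4 * M * 2 + 2 * (4 * M))" if "t \<in> {0..T}" "x \<in> {0..<1}" "y \<in> {0..<1}" for t x y
  proof -
    have 1: "\<bar>Rd t x * green (Q t x - Q t y)\<bar> \<le> 4 * M * 2" "\<bar>ker (Z t) x y * Qd t x\<bar> \<le> 2 * (4 * M)"
      unfolding abs_mult using that M0 by (intro mult_mono Rd_bd Qd_bd abs_green_le abs_ker_le; simp)+
    have "\<bar>Rd t x * green (Q t x - Q t y) + ker (Z t) x y * Qd t x\<bar> \<le> 4 * M * 2 + 2 * (4 * M)"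
      by (rule order_trans[OF abs_triangle_ineq add_mono[OF 1]])
    then show ?thesis unfolding G_def abs_mult
      using that by (intro mult_mono) (auto simp: B_def intro!: E_bd)
  qed
  have Gm: "(\<lambda>(x, y). G t x y) \<in> borel_measurable ?N" if t: "0 \<le> t" for t
  proof -
    note [measurable] = E_meas[OF t] Q_meas[OF t] Rd_meas[OF t] Qd_meas[OF t] measurable_components[OF Z_bb[OF t]]
    show ?thesis unfolding G_def ker_def by measurable
  qed
  have Gm': "(\<lambda>(x, y). G t y x) \<in> borel_measurable ?N" if "0 \<le> t" for t
    using measurable_pair_swap[OF Gm[OF that]] by (simp add: split_beta)
  have Fm: "F t \<in> borel_measurable ?N" if t: "0 \<le> t" for t
  proof -
    note [measurable] = E_meas[OF t] Q_meas[OF t]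
    show ?thesis unfolding F_def by measurable
  qed
  have Fb: "\<bar>F t p\<bar> \<le> B * B * 2" if tp: "t \<in> {0..T}" "p \<in> space ?N" for t p
  proof -
    obtain x y where p: "p = (x, y)" "x \<in> {0..<1}" "y \<in> {0..<1}"
      using tp(2) by (auto simp: space_pair_measure)
    show ?thesis unfolding F_def p(1) case_prod_conv abs_mult
      using tp p by (intro mult_mono abs_green_le) (auto simp: B_def intro!: E_bd)
  qed
  have Fi: "integrable ?N (F t)" if t: "t \<in> {0..T}" for t
    by (rule integrable_bounded[OF fN Fm Fb]) (use t in auto)
  have "(LINT p|?N. F T p - F 0 p) = (LINT t|restrict_space lborel {0..T}. LINT p|?N. F' t p)"
  proof (rule integral_time_derivative[OF fN T, where B = "2 * (B * B * (4 * M * 2 + 2 * (4 * M)))"])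
    fix p :: "real \<times> real" and t assume "p \<in> space ?N" and t: "t \<in> {0..T}"
    then obtain x y where p: "p = (x, y)" and xy: "x \<in> {0..<1}" "y \<in> {0..<1}" by (auto simp: space_pair_measure)
    have "((\<lambda>t. E t x * E t y * green (Q t x - Q t y)) has_real_derivative F' t p) (at t within {0..})"
      using E_der[of t x] E_der[of t y] green_Q_der[of t x y] t xy ker_antisym[of "Z t" x y] green_minus[of "Q t x - Q t y"]
      by (auto intro!: derivative_eq_intros simp: F'_def G_def p algebra_simps)
    then have "((\<lambda>t. F t p) has_real_derivative F' t p) (at t within {0..})" by (simp add: F_def p)
    then show "((\<lambda>t. F t p) has_real_derivative F' t p) (at t within {0..T})"
      by (rule DERIV_subset) auto
    show "\<bar>F' t p\<bar> \<le> 2 * (B * B * (4 * M * 2 + 2 * (4 * M)))"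
      using Gb[OF t xy] Gb[OF t xy(2,1)] unfolding F'_def p case_prod_conv
      by (intro order_trans[OF abs_triangle_ineq]) linarith
  next
    fix p assume "p \<in> space ?N"
    then obtain x y where p: "p = (x, y)" and xy: "x \<in> {0..<1}" "y \<in> {0..<1}" by (auto simp: space_pair_measure)
    have c: "continuous_on {0..T} (\<lambda>t. Q t x)" "continuous_on {0..T} (\<lambda>t. R t x)"
       "continuous_on {0..T} (\<lambda>t. Qd t x)" "continuous_on {0..T} (\<lambda>t. Rd t x)"  if "x \<in> {0..<1}" for x
      by (rule continuous_on_subset[OF Q_cont[OF that]] continuous_on_subset[OF R_cont[OF that]]
          continuous_on_subset[OF Qd_cont[OF that]] continuous_on_subset[OF Rd_cont[OF that]]; force)+
    show "continuous_on {0..T} (\<lambda>t. F' t p)"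
      unfolding F'_def p case_prod_conv G_def ker_def E_def Q_def[symmetric]
      by (intro continuous_intros c[OF xy(1)] c[OF xy(2)] continuous_on_compose2[OF continuous_on_green[of UNIV]])
         (auto intro!: continuous_intros c[OF xy(1)] c[OF xy(2)])
  next
    fix t assume "t \<in> {0..T}"
    then show "F' t \<in> borel_measurable ?N"
      unfolding F'_def using Gm[of t] Gm'[of t] by (simp add: split_beta)
  qed
  also have "\<dots> = (LINT t|restrict_space lborel {0..T}. 0)"
  proof (rule Bochner_Integration.integral_cong[OF refl])
    fix t assume "t \<in> space (restrict_space lborel {0..T})"
    then have tT: "t \<in> {0..T}" and t: "0 \<le> t" by (auto simp: space_restrict_space)
    have i: "integrable ?N (\<lambda>(x, y). G t x y)" "integrable ?N (\<lambda>(x, y). G t y x)"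
      by (rule integrable_bounded[OF fN Gm[OF t], where B = "B * B * (4 * M * 2 + 2 * (4 * M))"]
        integrable_bounded[OF fN Gm'[OF t], where B = "B * B * (4 * M * 2 + 2 * (4 * M))"];
        use Gb[OF tT] in \<open>auto simp: space_pair_measure\<close>)+
    have "(LINT p|?N. F' t p) = (LINT p|?N. (case p of (x, y) \<Rightarrow> G t x y)) + (LINT p|?N. (case p of (x, y) \<Rightarrow> G t y x))"
    proof -
      have "F' t = (\<lambda>p. (case p of (x, y) \<Rightarrow> G t x y) + (case p of (x, y) \<Rightarrow> G t y x))"
        by (auto simp: F'_def)
      then show ?thesis using Bochner_Integration.integral_add[OF i] by (simp only:)
    qed
    also have "(LINT p|?N. (case p of (x, y) \<Rightarrow> G t x y)) = (LINT x|nu. LINT y|nu. G t x y)"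
      using P.integral_fst'[OF i(1)] by simp
    also have "(LINT p|?N. (case p of (x, y) \<Rightarrow> G t y x)) = (LINT y|nu. LINT x|nu. G t y x)"
      using P.integral_snd[OF i(2)] by simp
    also have "(LINT x|nu. LINT y|nu. G t x y) = (LINT x|nu. 0)"
    proof (rule Bochner_Integration.integral_cong[OF refl])
      fix x assume x: "x \<in> space nu"
      note [measurable] = E_meas[OF t] Q_meas[OF t] measurable_ker[OF Z_bb[OF t]]
      have Eb: "\<bar>E t y * green (Q t x - Q t y)\<bar> \<le> B * 2" "\<bar>E t y * ker (Z t) x y\<bar> \<le> B * 2" if "y \<in> {0..<1}" for y
        unfolding abs_mult using tT that
        by (intro mult_mono abs_green_le abs_ker_le; auto simp: B_def intro!: E_bd)+
      have ii: "integrable nu (\<lambda>y. E t y * green (Q t x - Q t y))" "integrable nu (\<lambda>y. E t y * ker (Z t) x y)"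
        by (rule integrable_bounded[OF fin_nu _ Eb(1)] integrable_bounded[OF fin_nu _ Eb(2)]; simp)+
      have "(LINT y|nu. G t x y) = (LINT y|nu. E t x * Rd t x * (E t y * green (Q t x - Q t y)) + E t x * Qd t x * (E t y * ker (Z t) x y))"
        by (simp add: G_def algebra_simps)
      also have "\<dots> = E t x * Rd t x * (LINT y|nu. E t y * green (Q t x - Q t y)) + E t x * Qd t x * (LINT y|nu. E t y * ker (Z t) x y)"
        using ii by simp
      \<comment> \<open>Integrated over y, the two kernels give \<open>Qd\<close> and
        \<open>- Rd\<close>, so the terms are Rd Qd and - Qd Rd, both times E.\<close>
      also have "\<dots> = 0" using Rd_eq[OF t, of x] Qd_eq[OF t, of x] x by simp
      finally show "(LINT y|nu. G t x y) = 0" .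
    qed
    finally show "(LINT p|?N. F' t p) = 0" by simp
  qed
  finally have "(LINT p|?N. F T p - F 0 p) = 0" by simp
  then have "(LINT p|?N. F T p) = (LINT p|?N. F 0 p)" using Fi T by simp
  moreover have "(LINT p|?N. F t p) = (LINT x|nu. LINT y|nu. E t x * E t y * green (Q t x - Q t y))" if "t \<in> {0..T}" for t
    using P.integral_fst'[OF Fi[OF that]] by (simp add: F_def)
  moreover have "(LINT x|nu. LINT y|nu. E 0 x * E 0 y * green (Q 0 x - Q 0 y)) = (LINT x|nu. LINT y|nu. green (x - y))"
    by (intro Bochner_Integration.integral_cong refl) (simp add: E_def R0 Q0)
  ultimately show ?thesis using T by simp
qed

end

section \<open>Test functions\<close>

lemma smooth_differentiable: "smooth f \<Longrightarrow> f differentiable (at x)"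
  unfolding smooth_def using C_k.simps(2) by blast

lemma smooth_continuous_on: "smooth f \<Longrightarrow> continuous_on S f"
  unfolding smooth_def using C_k.simps(1) continuous_on_subset by blast

lemma smooth_frechet: "smooth f \<Longrightarrow> smooth (\<lambda>x. frechet_derivative f (at x) v)"
  unfolding smooth_def using C_k.simps(2) by blast

lemma smooth_frechet_works: "smooth f \<Longrightarrow> (f has_derivative frechet_derivative f (at x)) (at x)"
  using smooth_differentiable frechet_derivative_works by blast

lemma DERIV_smooth:
  fixes f :: "real \<Rightarrow> real"
  assumes "smooth f"
  shows "(f has_real_derivative frechet_derivative f (at x) 1) (at x)"
proof -
  have d: "(f has_derivative frechet_derivative f (at x)) (at x)" by (rule smooth_frechet_works[OF assms])
  have "frechet_derivative f (at x) h = frechet_derivative f (at x) 1 * h" for h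
    using linear_scale[OF has_derivative_linear[OF d], of h 1] by simp
  then have "frechet_derivative f (at x) = (\<lambda>h. frechet_derivative f (at x) 1 * h)" by blast
  then show ?thesis using d by (simp add: has_field_derivative_def)
qed

lemma deriv_eq_frechet: "smooth f \<Longrightarrow> deriv f = (\<lambda>x. frechet_derivative f (at x) (1::real))"
  using DERIV_smooth DERIV_imp_deriv by blast

lemma circle_test_deriv:
  assumes "\<phi> \<in> circle_test"
  shows "deriv \<phi> \<in> circle_test" and "(\<phi> has_real_derivative deriv \<phi> x) (at x)"
proof -
  have s: "smooth \<phi>" "periodic1 \<phi>" using assms by (auto simp: circle_test_def)
  show D: "(\<phi> has_real_derivative deriv \<phi> x) (at x)" for x
    using DERIV_smooth[OF s(1)] deriv_eq_frechet[OF s(1)] by simp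
  have "deriv \<phi> (x + 1) = deriv \<phi> x" for x
  proof -
    have "((\<lambda>x. \<phi> (x + 1)) has_real_derivative deriv \<phi> (x + 1)) (at x)"
      using D[of "x + 1"] DERIV_shift by blast
    then show ?thesis using s(2) D[of x] DERIV_unique unfolding periodic1_def by simp
  qed
  then show "deriv \<phi> \<in> circle_test"
    using smooth_frechet[OF s(1), of 1] by (simp add: circle_test_def periodic1_def deriv_eq_frechet[OF s(1)])
qed

lemma circle_test_continuous: "\<phi> \<in> circle_test \<Longrightarrow> continuous_on S \<phi>"
  by (auto simp: circle_test_def intro: smooth_continuous_on)

lemma circle_deriv_test: "\<phi> \<in> circle_test \<Longrightarrow> circle_deriv \<phi> (deriv \<phi>)"
  using circle_test_deriv(2) circle_test_continuous[OF circle_test_deriv(1)]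
    circle_test_deriv(1)[of \<phi>] by (intro circle_deriv_C1) (auto simp: circle_test_def)

text \<open>A derivative of a cosine is a cosine with phase advanced by pi / 2, so the family with
  free amplitude and phase is closed under differentiation.\<close>

lemma C_k_cos: "C_k k (\<lambda>x. c * cos (a * x + b))"
proof (induction k arbitrary: c b)
  case 0
  show ?case by (auto intro!: continuous_intros)
next
  case (Suc k)
  have D: "((\<lambda>x. c * cos (a * x + b)) has_derivative (\<lambda>v. v * (c * a * cos (a * x + (b + pi / 2))))) (at x)" for x
  proof -
    have "((\<lambda>x. c * cos (a * x + b)) has_real_derivative c * a * cos (a * x + (b + pi / 2))) (at x)"
      by (auto intro!: derivative_eq_intros simp: cos_add sin_add) (simp add: algebra_simps)
    then show ?thesis by (simp add: has_field_derivative_def mult_commute_abs)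
  qed
  have "frechet_derivative (\<lambda>x. c * cos (a * x + b)) (at x) v = v * c * a * cos (a * x + (b + pi / 2))" for x v
    using frechet_derivative_at[OF D, of x, symmetric] by simp
  moreover have "(\<lambda>x. c * cos (a * x + b)) differentiable (at x)" for x
    using D unfolding differentiable_def by blast
  ultimately show ?case using Suc by simp
qed

lemma cos_circle_test: "(\<lambda>x. c * cos (2 * pi * real n * x + b)) \<in> circle_test"
proof -
  have "cos (2 * pi * real n * (x + 1) + b) = cos (2 * pi * real n * x + b)" for x
  proof -
    have "2 * pi * real n * (x + 1) + b = (2 * pi * real n * x + b) + 2 * pi * real n" by (simp add: algebra_simps)
    also have "cos \<dots> = cos (2 * pi * real n * x + b)"
      using cos_2npi[of n] sin_2npi[of n] by (simp add: cos_add mult.commute mult.left_commute)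
    finally show ?thesis .
  qed
  then show ?thesis using C_k_cos[of _ c "2 * pi * real n" b] by (simp add: circle_test_def smooth_def periodic1_def)
qed

lemma const_circle_test: "(\<lambda>x. c) \<in> circle_test"
  using cos_circle_test[of c 0 0] by simp

section \<open>Test functions of time and space\<close>

lemma frechet_derivative_pair:
  fixes f :: "real \<times> real \<Rightarrow> real"
  assumes "smooth f"
  shows "(f has_derivative (\<lambda>(h, k). h * frechet_derivative f (at z) (1, 0) + k * frechet_derivative f (at z) (0, 1))) (at z)"
proof -
  let ?D = "frechet_derivative f (at z)"
  have d: "(f has_derivative ?D) (at z)" by (rule smooth_frechet_works[OF assms])
  then interpret linear ?D by (rule has_derivative_linear)
  have e: "?D (h, k) = h * ?D (1, 0) + k * ?D (0, 1)" for h k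
    using add[of "(h, 0)" "(0, k)"] scale[of h "(1, 0)"] scale[of k "(0, 1)"] by simp
  have "?D = (\<lambda>(h, k). h * ?D (1, 0) + k * ?D (0, 1))"
  proof (rule ext)
    show "?D v = (\<lambda>(h, k). h * ?D (1, 0) + k * ?D (0, 1)) v" for v
      using e[of "fst v" "snd v"] by (simp only: split_beta prod.collapse)
  qed
  then show ?thesis using d by (simp only:)
qed

lemma smooth_partials:
  assumes s: "smooth (\<lambda>(t, x). \<phi> t x)"
  defines "f \<equiv> \<lambda>(t, x). \<phi> t x"
  shows "d_t \<phi> t x = frechet_derivative f (at (t, x)) (1, 0)"
    and "d_x \<phi> t x = frechet_derivative f (at (t, x)) (0, 1)"
    and "((\<lambda>t. \<phi> t x) has_real_derivative d_t \<phi> t x) (at t)"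
    and "(\<phi> t has_real_derivative d_x \<phi> t x) (at x)"
proof -
  note D = frechet_derivative_pair[OF s, of "(t, x)", folded f_def]
  have "((\<lambda>s. f (s, x)) has_derivative (\<lambda>h. h * frechet_derivative f (at (t, x)) (1, 0))) (at t)"
    using has_derivative_compose[OF has_derivative_Pair[OF has_derivative_ident has_derivative_const] D] by simp
  then have 1: "((\<lambda>t. \<phi> t x) has_real_derivative frechet_derivative f (at (t, x)) (1, 0)) (at t)"
    by (simp add: has_field_derivative_def f_def mult_commute_abs)
  have "((\<lambda>s. f (t, s)) has_derivative (\<lambda>h. h * frechet_derivative f (at (t, x)) (0, 1))) (at x)"
    using has_derivative_compose[OF has_derivative_Pair[OF has_derivative_const has_derivative_ident] D] by simp
  then have 2: "(\<phi> t has_real_derivative frechet_derivative f (at (t, x)) (0, 1)) (at x)"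
    by (simp add: has_field_derivative_def f_def mult_commute_abs)
  show "d_t \<phi> t x = frechet_derivative f (at (t, x)) (1, 0)"
    "d_x \<phi> t x = frechet_derivative f (at (t, x)) (0, 1)"
    unfolding d_t_def d_x_def using 1 2 DERIV_imp_deriv by blast+
  then show "((\<lambda>t. \<phi> t x) has_real_derivative d_t \<phi> t x) (at t)"
    "(\<phi> t has_real_derivative d_x \<phi> t x) (at x)" using 1 2 by auto
qed

text \<open>The derivative is taken within S because particle paths are differentiated within [0,
  \<infinity>), one-sidedly at time 0.\<close>

lemma smooth_chain:
  assumes s: "smooth (\<lambda>(t, x). \<phi> t x)" and c: "(c has_real_derivative c') (at t within S)"
  shows "((\<lambda>t. \<phi> t (c t)) has_real_derivative d_t \<phi> t (c t) + d_x \<phi> t (c t) * c') (at t within S)"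
proof -
  have g: "((\<lambda>t. (t, c t)) has_derivative (\<lambda>h. (h, c' * h))) (at t within S)"
    using c by (auto intro!: derivative_eq_intros simp: has_field_derivative_def)
  have "((\<lambda>t. case (t, c t) of (t, x) \<Rightarrow> \<phi> t x) has_derivative
    (\<lambda>h. h * d_t \<phi> t (c t) + c' * h * d_x \<phi> t (c t))) (at t within S)"
    using has_derivative_compose[OF g frechet_derivative_pair[OF s]]
    by (simp add: smooth_partials[OF s])
  moreover have "(\<lambda>h. h * d_t \<phi> t (c t) + c' * h * d_x \<phi> t (c t)) = (*) (d_t \<phi> t (c t) + d_x \<phi> t (c t) * c')"
    by (rule ext) (simp add: algebra_simps)
  ultimately show ?thesis by (simp add: has_field_derivative_def)
qed

lemma cylinder_testD:
  assumes "\<phi> \<in> cylinder_test I"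
  shows "smooth (\<lambda>(t, x). \<phi> t x)" "periodic1 (\<phi> t)"
    and "continuous_on S (\<lambda>(t, x). \<phi> t x)"
  using assms smooth_continuous_on by (auto simp: cylinder_test_def)

lemma cylinder_test_partials:
  assumes "\<phi> \<in> cylinder_test I"
  shows "d_t \<phi> \<in> cylinder_test I" "d_x \<phi> \<in> cylinder_test I"
proof -
  note s = cylinder_testD(1)[OF assms] and per = cylinder_testD(2)[OF assms]
  obtain K where K: "compact K" "K \<subseteq> I" "\<And>t x. t \<notin> K \<Longrightarrow> \<phi> t x = 0" using assms by (auto simp: cylinder_test_def)
  have sm: "smooth (\<lambda>(t, x). d_t \<phi> t x)" "smooth (\<lambda>(t, x). d_x \<phi> t x)"
  proof -
    have "(\<lambda>(t, x). d_t \<phi> t x) = (\<lambda>z. frechet_derivative (\<lambda>(t, x). \<phi> t x) (at z) (1, 0))"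
      "(\<lambda>(t, x). d_x \<phi> t x) = (\<lambda>z. frechet_derivative (\<lambda>(t, x). \<phi> t x) (at z) (0, 1))"
      by (simp_all add: fun_eq_iff smooth_partials(1,2)[OF s])
    then show "smooth (\<lambda>(t, x). d_t \<phi> t x)" "smooth (\<lambda>(t, x). d_x \<phi> t x)"
      using smooth_frechet[OF s] by simp_all
  qed
  have p: "periodic1 (d_t \<phi> t)" for t
    using per by (simp add: periodic1_def d_t_def)
  have "d_x \<phi> t (x + 1) = d_x \<phi> t x" for t x
  proof -
    have "((\<lambda>x. \<phi> t (x + 1)) has_real_derivative d_x \<phi> t (x + 1)) (at x)"
      using smooth_partials(4)[OF s, of t "x + 1"] DERIV_shift by blast
    then show ?thesis using per smooth_partials(4)[OF s, of t x] DERIV_unique unfolding periodic1_def by simp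
  qed
  then have p': "periodic1 (d_x \<phi> t)" for t by (simp add: periodic1_def)
  have z: "d_x \<phi> t x = 0" if "t \<notin> K" for t x
  proof -
    have "\<phi> t = (\<lambda>_. 0)" using K(3)[OF that] by auto
    then show ?thesis by (simp add: d_x_def)
  qed
  have z': "d_t \<phi> t x = 0" if "t \<notin> K" for t x
  proof -
    have "open (- K)" using K(1) compact_imp_closed by blast
    then have "\<forall>\<^sub>F s in nhds t. s \<in> - K" using that by (intro eventually_nhds_in_open) auto
    then have "\<forall>\<^sub>F s in nhds t. \<phi> s x = 0" by eventually_elim (use K in auto)
    then have "((\<lambda>s. \<phi> s x) has_real_derivative 0) (at t)"
      using DERIV_cong_ev[OF refl _ refl, of "\<lambda>s. \<phi> s x" "\<lambda>_. 0"] by simp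
    then show ?thesis by (simp add: d_t_def DERIV_imp_deriv)
  qed
  show "d_t \<phi> \<in> cylinder_test I" "d_x \<phi> \<in> cylinder_test I"
    unfolding cylinder_test_def using sm p p' K(1,2) z z' by auto
qed

lemma cylinder_test_bounded:
  assumes "\<phi> \<in> cylinder_test I"
  obtains B where "\<And>t x. \<bar>\<phi> t x\<bar> \<le> B"
proof -
  obtain K where K: "compact K" "\<And>t x. t \<notin> K \<Longrightarrow> \<phi> t x = 0" using assms by (auto simp: cylinder_test_def)
  have "compact ((\<lambda>(t, x). \<phi> t x) ` (K \<times> {0..1}))"
    by (intro compact_continuous_image cylinder_testD(3)[OF assms] compact_Times K compact_Icc)
  then obtain B where B: "\<forall>y\<in>(\<lambda>(t, x). \<phi> t x) ` (K \<times> {0..1}). norm y \<le> B"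
    using compact_imp_bounded bounded_iff by metis
  have "\<bar>\<phi> t x\<bar> \<le> max 0 B" for t x
  proof (cases "t \<in> K")
    case True
    have "\<phi> t x = \<phi> t (frac x)" by (rule periodic1_frac[OF cylinder_testD(2)[OF assms], symmetric])
    moreover have "\<bar>\<phi> t (frac x)\<bar> \<le> B" using B True frac_ge_0[of x] frac_lt_1[of x] by force
    ultimately show ?thesis by simp
  qed (simp add: K(2))
  then show ?thesis using that by blast
qed

lemma cylinder_test_support:
  assumes "\<phi> \<in> cylinder_test I" "I \<subseteq> {0<..}"
  obtains T where "0 < T" "\<And>t x. t \<notin> I \<inter> {0<..<T} \<Longrightarrow> \<phi> t x = 0"
proof -
  obtain K where K: "compact K" "K \<subseteq> I" "\<And>t x. t \<notin> K \<Longrightarrow> \<phi> t x = 0" using assms by (auto simp: cylinder_test_def)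
  obtain b where b: "\<And>t. t \<in> K \<Longrightarrow> \<bar>t\<bar> \<le> b" using compact_imp_bounded[OF K(1)] by (auto simp: bounded_iff)
  have "K \<subseteq> I \<inter> {0<..<max 0 b + 1}" using K(2) assms(2) b by force
  then show ?thesis using that[of "max 0 b + 1"] K(3) by (meson subset_iff add_nonneg_pos max.cobounded1 zero_less_one)
qed

lemma cylinder_test_measurable:
  "\<phi> \<in> cylinder_test I \<Longrightarrow> (\<lambda>(t, x). \<phi> t x) \<in> borel_measurable (borel \<Otimes>\<^sub>M borel)"
  using borel_measurable_continuous_onI[OF cylinder_testD(3)] by (simp add: borel_prod)

text \<open>Since F vanishes for times outside I and [0, T], every open set I of times can be
  replaced by the same closed window.\<close>

lemma integral_cylinder:
  fixes F :: "real \<Rightarrow> real \<Rightarrow> real"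
  assumes m: "(\<lambda>(t, x). F t x) \<in> borel_measurable (borel \<Otimes>\<^sub>M borel)" and I: "I \<in> sets borel"
    and b: "\<And>t x. 0 \<le> t \<Longrightarrow> t \<le> T \<Longrightarrow> \<bar>F t x\<bar> \<le> B" and z: "\<And>t x. t \<notin> I \<inter> {0..T} \<Longrightarrow> F t x = 0"
  shows "(LINT (t, x)|cylinder I. F t x) = (LINT t|restrict_space lborel {0..T}. LINT x|circle. F t x)"
    and "integrable (cylinder I) (\<lambda>(t, x). F t x)"
proof -
  have IS: "I \<times> {0..<1} \<in> sets (lborel :: (real \<times> real) measure)"
    using I by (simp add: borel_prod[symmetric])
  define G where "G = (\<lambda>z. indicator (I \<times> {0..<1}) z *\<^sub>R (case z of (t, x) \<Rightarrow> F t x))"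
  have G: "G z = indicator ({0..T} \<times> {0..1}) z *\<^sub>R G z" for z
    using z by (auto simp: G_def indicator_def split: prod.splits)
  have Gm: "G \<in> borel_measurable borel"
  proof -
    have "(\<lambda>(t, x). F t x) \<in> borel_measurable borel" using m by (simp add: borel_prod)
    moreover have "I \<times> {0..<1} \<in> sets (borel :: (real \<times> real) measure)" using IS by simp
    ultimately show ?thesis unfolding G_def by simp
  qed
  have box: "{0..T} \<times> {0..1::real} = cbox (0, 0) (T, 1)" by (auto simp: cbox_Pair_eq)
  have "integrable lborel (\<lambda>z. indicator ({0..T} \<times> {0..1}) z *\<^sub>R G z)"
  proof (rule integrableI_bounded_set_indicator)
    show "emeasure lborel ({0..T} \<times> {0..1::real}) < \<infinity>" unfolding box by (rule emeasure_lborel_cbox_finite)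
    show "AE z in lborel. z \<in> {0..T} \<times> {0..1} \<longrightarrow> norm (G z) \<le> \<bar>B\<bar>"
    proof (intro AE_I2 impI)
      fix z :: "real \<times> real" assume "z \<in> {0..T} \<times> {0..1}"
      then have "\<bar>F (fst z) (snd z)\<bar> \<le> \<bar>B\<bar>" using b[of "fst z" "snd z"] by auto
      then show "norm (G z) \<le> \<bar>B\<bar>" by (auto simp: G_def split_beta indicator_def)
    qed
  qed (use Gm box in auto)
  then have iG: "integrable lborel G" by (simp only: G[symmetric])
  then show "integrable (cylinder I) (\<lambda>(t, x). F t x)"
    unfolding cylinder_def G_def using IS by (subst integrable_restrict_space) auto
  have "(LINT (t, x)|cylinder I. F t x) = (LINT z|lborel. G z)"
    unfolding cylinder_def G_def using IS by (subst integral_restrict_space) auto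
  also have "\<dots> = (LINT t|lborel. LINT x|lborel. G (t, x))"
    using lborel_pair.integral_fst'[of G] iG by (simp add: lborel_prod)
  also have "\<dots> = (LINT t|lborel. indicator {0..T} t *\<^sub>R (LINT x|circle. F t x))"
  proof (rule Bochner_Integration.integral_cong[OF refl])
    fix t
    have "(LINT x|circle. F t x) = (LINT x|lborel. indicator {0..<1} x *\<^sub>R F t x)"
      unfolding circle_def by (rule integral_restrict_space) simp
    moreover have "G (t, x) = indicator {0..T} t *\<^sub>R (indicator {0..<1} x *\<^sub>R F t x)" for x
      using z[of t x] by (auto simp: G_def indicator_def)
    ultimately show "(LINT x|lborel. G (t, x)) = indicator {0..T} t *\<^sub>R (LINT x|circle. F t x)" by simp
  qed
  also have "\<dots> = (LINT t|restrict_space lborel {0..T}. LINT x|circle. F t x)"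
    by (rule integral_restrict_space[symmetric]) simp
  finally show "(LINT (t, x)|cylinder I. F t x) = (LINT t|restrict_space lborel {0..T}. LINT x|circle. F t x)" .
qed

section \<open>Uniqueness of weak derivatives\<close>

text \<open>Arbitrary phases cover sines as well, and integer frequencies admit the difference k - l
  that arises when a product is turned into a sum.\<close>

inductive_set trig :: "(real \<Rightarrow> real) set" where
  cos: "(\<lambda>x. c * cos (2 * pi * of_int k * x + b)) \<in> trig"
| add: "f \<in> trig \<Longrightarrow> g \<in> trig \<Longrightarrow> (\<lambda>x. f x + g x) \<in> trig"

lemma trig_mult_cos: "g \<in> trig \<Longrightarrow> (\<lambda>x. (c * cos (2 * pi * of_int k * x + b)) * g x) \<in> trig"
proof (induction rule: trig.induct)
  case (cos d l a)
  have "(c * cos (2 * pi * of_int k * x + b)) * (d * cos (2 * pi * of_int l * x + a)) =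
      (c * d / 2) * cos (2 * pi * of_int (k - l) * x + (b - a)) + (c * d / 2) * cos (2 * pi * of_int (k + l) * x + (b + a))" for x
  proof -
    have "2 * pi * of_int (k - l) * x + (b - a) = (2 * pi * of_int k * x + b) - (2 * pi * of_int l * x + a)"
      "2 * pi * of_int (k + l) * x + (b + a) = (2 * pi * of_int k * x + b) + (2 * pi * of_int l * x + a)"
      by (simp_all add: algebra_simps)
    then show ?thesis by (simp only: cos_diff cos_add) (simp add: algebra_simps)
  qed
  then show ?case using trig.add[OF trig.cos trig.cos] by presburger
next
  case (add f g)
  then show ?case using trig.add[OF add.IH] by (simp add: distrib_left)
qed

lemma trig_mult: "f \<in> trig \<Longrightarrow> g \<in> trig \<Longrightarrow> (\<lambda>x. f x * g x) \<in> trig"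
proof (induction rule: trig.induct)
  case (cos c k b)
  then show ?case by (rule trig_mult_cos)
next
  case (add f f')
  then show ?case using trig.add[of "\<lambda>x. f x * g x" "\<lambda>x. f' x * g x"] by (simp add: distrib_right)
qed

text \<open>A real-linear form on the unit circle is a combination of cosine and sine, and
  \<open>trig\<close> is closed under sums and products. This makes Stone-Weierstrass on the unit
  circle applicable.\<close>

lemma trig_polynomial:
  "real_polynomial_function P \<Longrightarrow> (\<lambda>x. P (cis (2 * pi * x))) \<in> trig"
proof (induction rule: real_polynomial_function.induct)
  case (linear f)
  have "f (cis t) = f 1 * cos t + f \<i> * cos (t + - pi / 2)" for t
  proof -
    have "cis t = cos t *\<^sub>R 1 + sin t *\<^sub>R \<i>" by (simp add: complex_eq_iff)
    then have "f (cis t) = cos t *\<^sub>R f 1 + sin t *\<^sub>R f \<i>"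
      by (simp only: bounded_linear.linear[OF linear, THEN linear_add] bounded_linear.linear[OF linear, THEN linear_scale])
    then show ?thesis by (simp add: cos_diff mult.commute)
  qed
  then show ?case using trig.add[OF trig.cos[of "f 1" 1 0] trig.cos[of "f \<i>" 1 "- pi / 2"]] by simp
next
  case (const c)
  show ?case using trig.cos[of c 0 0] by simp
next
  case (add f g)
  then show ?case by (intro trig.add)
next
  case (mult f g)
  then show ?case by (intro trig_mult)
qed

lemma trig_continuous: "f \<in> trig \<Longrightarrow> continuous_on UNIV f"
  by (induction rule: trig.induct) (auto intro!: continuous_intros)

lemma trig_bounded: "f \<in> trig \<Longrightarrow> \<exists>B. \<forall>x. \<bar>f x\<bar> \<le> B"
proof (induction rule: trig.induct)
  case (cos c k b)
  have "\<bar>c * cos (2 * pi * of_int k * x + b)\<bar> \<le> \<bar>c\<bar> * 1" for x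
    unfolding abs_mult by (intro mult_left_mono) auto
  then show ?case by blast
next
  case (add f g)
  then show ?case by (meson abs_triangle_ineq add_mono order_trans)
qed

lemma integrable_mult_bounded:
  fixes h f :: "'a \<Rightarrow> real"
  assumes "integrable N h" "f \<in> borel_measurable N" "\<And>x. x \<in> space N \<Longrightarrow> \<bar>f x\<bar> \<le> B"
  shows "integrable N (\<lambda>x. h x * f x)"
proof (rule Bochner_Integration.integrable_bound[of _ "\<lambda>x. B * h x"])
  show "AE x in N. norm (h x * f x) \<le> norm (B * h x)"
  proof (rule AE_I2)
    fix x assume "x \<in> space N"
    then have "\<bar>f x\<bar> \<le> \<bar>B\<bar>" using assms(3) by force
    then show "norm (h x * f x) \<le> norm (B * h x)"
      by (simp add: abs_mult mult.commute mult_right_mono)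
  qed
  show "(\<lambda>x. h x * f x) \<in> borel_measurable N"
    using assms borel_measurable_integrable[OF assms(1)] by measurable
qed (use assms in simp)

lemma cis_eq_iff_unit:
  assumes "x \<in> {0..<1}" "y \<in> {0..<1}" "cis (2 * pi * x) = cis (2 * pi * y)"
  shows "x = y"
proof -
  have "sin (2 * pi * x) = sin (2 * pi * y) \<and> cos (2 * pi * x) = cos (2 * pi * y)"
    using assms(3) by (simp add: complex_eq_iff)
  then obtain n :: int where "2 * pi * x = 2 * pi * y + 2 * pi * of_int n"
    unfolding sin_cos_eq_iff by (auto simp: mult_ac)
  then have "2 * pi * (x - y) = 2 * pi * of_int n" by (simp add: algebra_simps)
  then have n: "x - y = of_int n" by simp
  then have "\<bar>real_of_int n\<bar> < 1" using assms(1,2) by auto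
  then have "n = 0" by linarith
  then show ?thesis using n by simp
qed

section \<open>Integrable functions orthogonal to all cosines\<close>

context
  fixes h :: "real \<Rightarrow> real"
  assumes h: "integrable circle h"
    and orth: "\<And>n b. (LINT x|circle. h x * cos (2 * pi * real n * x + b)) = 0"
begin

lemma trig_orthogonal: "f \<in> trig \<Longrightarrow> (LINT x|circle. h x * f x) = 0"
proof (induction rule: trig.induct)
  case (cos c k b)
  have "(LINT x|circle. h x * cos (2 * pi * of_int k * x + b)) = 0"
  proof (cases "0 \<le> k")
    case True
    then show ?thesis using orth[of "nat k" b] by simp
  next
    case False
    have "cos (2 * pi * real (nat (- k)) * x + - b) = cos (2 * pi * of_int k * x + b)" for x
      using cos_minus[of "2 * pi * of_int k * x + b"] False by simp
    then show ?thesis using orth[of "nat (- k)" "- b"] by simp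
  qed
  then show ?case by (simp add: mult.left_commute)
next
  case (add f g)
  have i: "integrable circle (\<lambda>x. h x * f x)" if f: "f \<in> trig" for f
  proof -
    obtain B where "\<And>x. \<bar>f x\<bar> \<le> B" using trig_bounded[OF f] by blast
    then show ?thesis
      by (intro integrable_mult_bounded[OF h] measurable_circleI borel_measurable_continuous_onI trig_continuous f)
  qed
  show ?case using i[OF add.hyps(1)] i[OF add.hyps(2)] add.IH by (simp add: distrib_left)
qed

text \<open>By Stone-Weierstrass, g is uniformly close on the unit circle to a polynomial, which is
  orthogonal to h; the error is at most e times the L1 norm of h.\<close>

lemma continuous_orthogonal:
  assumes g: "continuous_on UNIV (g :: complex \<Rightarrow> real)"
  shows "(LINT x|circle. h x * g (cis (2 * pi * x))) = 0"
proof -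
  let ?e = "\<lambda>x. cis (2 * pi * x)"
  have ge: "continuous_on UNIV (\<lambda>x. g (?e x))"
    by (intro continuous_on_compose2[OF g] continuous_intros) auto
  have "\<bar>LINT x|circle. h x * g (?e x)\<bar> \<le> e * (LINT x|circle. \<bar>h x\<bar>)" if e: "0 < e" for e
  proof -
    obtain P where P: "real_polynomial_function P" "\<And>z. z \<in> sphere 0 1 \<Longrightarrow> \<bar>g z - P z\<bar> < e"
      using Stone_Weierstrass_real_polynomial_function[of "sphere 0 1" g e] e continuous_on_subset[OF g] by auto
    have t: "(\<lambda>x. P (?e x)) \<in> trig" by (rule trig_polynomial[OF P(1)])
    obtain B where B: "\<And>x. \<bar>P (?e x)\<bar> \<le> B" using trig_bounded[OF t] by blast
    have c: "\<bar>g (?e x) - P (?e x)\<bar> \<le> e" for x using P(2)[of "?e x"] by simp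
    have bd: "\<bar>g (?e x)\<bar> \<le> B + e" for x using c[of x] B[of x] by linarith
    have m: "(\<lambda>x. P (?e x)) \<in> borel_measurable circle" "(\<lambda>x. g (?e x)) \<in> borel_measurable circle"
      by (auto intro!: measurable_circleI borel_measurable_continuous_onI trig_continuous t ge)
    have i: "integrable circle (\<lambda>x. h x * P (?e x))" "integrable circle (\<lambda>x. h x * g (?e x))"
      by (rule integrable_mult_bounded[OF h m(1) B] integrable_mult_bounded[OF h m(2) bd])+
    have "(LINT x|circle. h x * g (?e x)) = (LINT x|circle. h x * g (?e x) - h x * P (?e x))"
      using i trig_orthogonal[OF t] by simp
    also have "\<bar>\<dots>\<bar> \<le> (LINT x|circle. \<bar>h x * g (?e x) - h x * P (?e x)\<bar>)" by simp
    also have "\<dots> \<le> (LINT x|circle. e * \<bar>h x\<bar>)"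
    proof (rule integral_mono)
      show "\<bar>h x * g (?e x) - h x * P (?e x)\<bar> \<le> e * \<bar>h x\<bar>" for x
      proof -
        have "\<bar>h x * g (?e x) - h x * P (?e x)\<bar> = \<bar>g (?e x) - P (?e x)\<bar> * \<bar>h x\<bar>"
          by (simp add: abs_mult[symmetric] algebra_simps)
        also have "\<dots> \<le> e * \<bar>h x\<bar>" by (rule mult_right_mono[OF c]) simp
        finally show ?thesis .
      qed
    qed (use i h in auto)
    finally show ?thesis by simp
  qed
  then have "\<bar>LINT x|circle. h x * g (?e x)\<bar> \<le> 0 + e" if "0 < e" for e
  proof -
    assume *: "\<And>e. 0 < e \<Longrightarrow> \<bar>LINT x|circle. h x * g (?e x)\<bar> \<le> e * (LINT x|circle. \<bar>h x\<bar>)"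
    define I where "I = (LINT x|circle. \<bar>h x\<bar>)"
    have I: "0 \<le> I" by (simp add: I_def)
    \<comment> \<open>Dividing by I + 1 rather than by I avoids the case I = 0.\<close>
    have "\<bar>LINT x|circle. h x * g (?e x)\<bar> \<le> e / (I + 1) * I"
      using that I unfolding I_def by (intro *) (simp only: I_def[symmetric], simp)
    also have "\<dots> \<le> e * 1" using that I by (simp add: field_simps)
    finally show ?thesis by simp
  qed
  then have "\<bar>LINT x|circle. h x * g (?e x)\<bar> \<le> 0" using field_le_epsilon by blast
  then show ?thesis by simp
qed

text \<open>The interval corresponds to a compact arc, whose indicator is the pointwise limit of the
  continuous cut-offs \<open>g n\<close>, and |h| dominates. Points of (a, 1) lie outside the arc
  because the parametrisation is injective on [0, 1).\<close>

lemma interval_orthogonal: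
  assumes a: "0 \<le> a" "a < 1"
  shows "(LINT x|circle. h x * indicator {..a} x) = 0"
proof -
  let ?e = "\<lambda>x. cis (2 * pi * x)"
  let ?C = "?e ` {0..a}"
  define g where "g n z = max 0 (1 - real n * infdist z ?C)" for n z
  have cC: "compact ?C" by (intro compact_continuous_image continuous_intros compact_Icc)
  have neC: "?C \<noteq> {}" using a by auto
  have cg: "continuous_on UNIV (g n)" for n unfolding g_def by (intro continuous_intros)
  have "(\<lambda>n. LINT x|circle. h x * g n (?e x)) \<longlonglongrightarrow> (LINT x|circle. h x * indicator {..a} x)"
  proof (rule integral_dominated_convergence)
    show "(\<lambda>x. h x * indicator {..a} x) \<in> borel_measurable circle"
      by (rule borel_measurable_times[OF borel_measurable_integrable[OF h] measurable_circleI]) simp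
    show "(\<lambda>x. h x * g n (?e x)) \<in> borel_measurable circle" for n
      by (rule borel_measurable_times[OF borel_measurable_integrable[OF h] measurable_circleI])
         (intro borel_measurable_continuous_onI continuous_on_compose2[OF cg] continuous_intros, auto)
    show "integrable circle (\<lambda>x. \<bar>h x\<bar>)" using h by simp
    show "AE x in circle. norm (h x * g n (?e x)) \<le> \<bar>h x\<bar>" for n
      using infdist_nonneg[of _ ?C] by (intro AE_I2) (auto simp: g_def abs_mult intro!: mult_left_le)
    show "AE x in circle. (\<lambda>n. h x * g n (?e x)) \<longlonglongrightarrow> h x * indicator {..a} x"
    proof (rule AE_I2)
      fix x assume "x \<in> space circle"
      then have x: "x \<in> {0..<1}" by simp
      show "(\<lambda>n. h x * g n (?e x)) \<longlonglongrightarrow> h x * indicator {..a} x"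
      proof (cases "x \<le> a")
        case True
        then have "infdist (?e x) ?C = 0" using x by (intro infdist_zero) auto
        then show ?thesis using True by (simp add: g_def)
      next
        case False
        have "?e x \<notin> ?C"
        proof
          assume "?e x \<in> ?C"
          then obtain y where "y \<in> {0..a}" "?e x = ?e y" by auto
          then show False using cis_eq_iff_unit[of x y] x a False by auto
        qed
        then have d: "0 < infdist (?e x) ?C"
          using in_closed_iff_infdist_zero[OF compact_imp_closed[OF cC] neC, of "?e x"] infdist_nonneg[of "?e x" ?C] by simp
        obtain N where N: "1 < real N * infdist (?e x) ?C" using reals_Archimedean3[OF d] by blast
        have "\<forall>\<^sub>F n in sequentially. h x * g n (?e x) = h x * indicator {..a} x"
        proof (rule eventually_sequentiallyI[of N])
          fix n assume "N \<le> n"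
          then have "real N * infdist (?e x) ?C \<le> real n * infdist (?e x) ?C"
            using d by (intro mult_right_mono) auto
          then have "g n (?e x) = 0" using N by (simp add: g_def)
          then show "h x * g n (?e x) = h x * indicator {..a} x" using False by simp
        qed
        then show ?thesis by (rule tendsto_eventually)
      qed
    qed
  qed
  then show ?thesis using continuous_orthogonal[OF cg] by (simp add: LIMSEQ_const_iff)
qed

text \<open>The half-lines {..a} generate the Borel sets and are stable under intersection, so the
  integral of h vanishes over every Borel set, and h is zero by uniqueness of densities.\<close>

lemma orthogonal_AE_zero: "AE x in circle. h x = 0"
proof -
  have tot: "(LINT x|circle. h x) = 0" using orth[of 0 0] by simp
  have B: "(LINT x|circle. indicator A x *\<^sub>R h x) = 0" if "A \<in> sets borel" for A
  proof -
    have cs: "sigma_sets UNIV (range (atMost :: real \<Rightarrow> _)) = sets borel"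
      unfolding borel_eq_atMost by simp
    have "Int_stable (range (atMost :: real \<Rightarrow> _))"
      by (auto simp: Int_stable_def)
    moreover have "range (atMost :: real \<Rightarrow> _) \<subseteq> Pow UNIV" by simp
    moreover have "A \<in> sigma_sets UNIV (range atMost)" using that unfolding cs .
    ultimately show ?thesis
    proof (induction rule: sigma_sets_induct_disjoint)
      case (basic A)
      then obtain a where a: "A = {..a}" by auto
      consider "a < 0" | "0 \<le> a" "a < 1" | "1 \<le> a" by linarith
      then show ?case
      proof cases
        case 1
        then have "(LINT x|circle. indicator A x *\<^sub>R h x) = (LINT x|circle. 0)"
          by (intro Bochner_Integration.integral_cong refl) (auto simp: a)
        then show ?thesis by simp
      next
        case 2
        then show ?thesis using interval_orthogonal[OF 2] by (simp add: a mult.commute)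
      next
        case 3
        then have "(LINT x|circle. indicator A x *\<^sub>R h x) = (LINT x|circle. h x)"
          by (intro Bochner_Integration.integral_cong refl) (auto simp: a)
        then show ?thesis using tot by simp
      qed
    next
      case empty
      show ?case by simp
    next
      case (compl A)
      have m: "A \<in> sets borel" using compl.hyps cs by simp
      have "integrable circle (\<lambda>x. h x * indicator A x)"
        by (rule integrable_mult_bounded[OF h measurable_circleI, where B = 1]) (use m in \<open>auto simp: indicator_def\<close>)
      then have i: "integrable circle (\<lambda>x. indicator A x *\<^sub>R h x)" by (simp add: mult.commute)
      have "(LINT x|circle. indicator (UNIV - A) x *\<^sub>R h x) = (LINT x|circle. h x - indicator A x *\<^sub>R h x)"
        by (intro Bochner_Integration.integral_cong refl) (auto simp: indicator_def)
      then show ?case using i h compl.IH tot by simp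
    next
      case (union A)
      have m: "A i \<in> sets borel" for i using union.hyps cs by auto
      have e: "(LINT x|circle. indicator (A i) x *\<^sub>R h x) = (LINT x:A i \<inter> {0..<1}|circle. h x)" for i
        unfolding set_lebesgue_integral_def
        by (intro Bochner_Integration.integral_cong refl) (auto simp: indicator_def)
      have mc: "A i \<inter> {0..<1} \<in> sets circle" for i
        using m[of i] unfolding sets_circle sets_restrict_space by auto
      have "(LINT x|circle. indicator (\<Union>i. A i) x *\<^sub>R h x) = (LINT x:(\<Union>i. A i \<inter> {0..<1})|circle. h x)"
        unfolding set_lebesgue_integral_def
        by (intro Bochner_Integration.integral_cong refl) (auto simp: indicator_def)
      also have "\<dots> = (\<Sum>i. LINT x:(A i \<inter> {0..<1})|circle. h x)"
      proof (rule lebesgue_integral_countable_add)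
        show "set_integrable circle (\<Union>i. A i \<inter> {0..<1}) h"
          unfolding set_integrable_def
          by (rule integrable_mult_indicator[OF sets.countable_UN h]) (use mc in blast)
        show "i \<noteq> j \<Longrightarrow> (A i \<inter> {0..<1}) \<inter> (A j \<inter> {0..<1}) = {}" for i j
          using union.hyps(1) by (auto simp: disjoint_family_on_def)
      qed (rule mc)
      also have "\<dots> = 0" using union.IH e by simp
      finally show ?case .
    qed
  qed
  have "AE x in circle. h x = (\<lambda>_. 0) x"
  proof (rule density_unique_real[OF h])
    fix A assume "A \<in> sets circle"
    then have "A \<in> sets borel" unfolding sets_circle by (auto simp: sets_restrict_space)
    then show "(LINT x:A|circle. h x) = (LINT x:A|circle. 0)"
      using B unfolding set_lebesgue_integral_def by simp
  qed simp
  then show ?thesis by simp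
qed

end

section \<open>Uniqueness of weak derivatives and of momenta\<close>

lemma circle_test_bounded:
  assumes "\<phi> \<in> circle_test" obtains B where "\<And>x. \<bar>\<phi> x\<bar> \<le> B"
  using periodic1_bounded[of \<phi>] assms circle_test_continuous[OF assms, of UNIV] by (auto simp: circle_test_def)

lemma integrable_mult_test:
  assumes "integrable circle h" "\<phi> \<in> circle_test"
  shows "integrable circle (\<lambda>x. h x * \<phi> x)"
proof -
  obtain B where B: "\<And>x. \<bar>\<phi> x\<bar> \<le> B" using circle_test_bounded[OF assms(2)] by blast
  show ?thesis
    by (rule integrable_mult_bounded[OF assms(1) _ B])
       (intro measurable_circleI borel_measurable_continuous_onI circle_test_continuous assms)
qed

text \<open>The difference is orthogonal to all cosines. Norms of the representative chosen by
  \<open>weak_deriv\<close> can hence be computed from any other weak derivative.\<close>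

lemma weak_deriv_unique:
  assumes v: "has_weak_deriv f v" and w: "has_weak_deriv f w"
  shows "AE x in circle. v x = w x"
proof -
  have iv: "integrable circle v" and iw: "integrable circle w"
    using assms by (auto simp: has_weak_deriv_def)
  have "AE x in circle. v x - w x = 0"
  proof (rule orthogonal_AE_zero)
    show "integrable circle (\<lambda>x. v x - w x)" using iv iw by simp
    fix n b
    let ?\<phi> = "\<lambda>x. cos (2 * pi * real n * x + b)"
    have t: "?\<phi> \<in> circle_test" using cos_circle_test[of 1 n b] by simp
    have "(LINT x|circle. f x * deriv ?\<phi> x) = - (LINT x|circle. v x * ?\<phi> x)"
      "(LINT x|circle. f x * deriv ?\<phi> x) = - (LINT x|circle. w x * ?\<phi> x)"
      using v w t unfolding has_weak_deriv_def by blast+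
    then have "(LINT x|circle. v x * ?\<phi> x) = (LINT x|circle. w x * ?\<phi> x)" by linarith
    then show "(LINT x|circle. (v x - w x) * ?\<phi> x) = 0"
      using integrable_mult_test[OF iv t] integrable_mult_test[OF iw t] by (simp add: left_diff_distrib)
  qed
  then show ?thesis by simp
qed

text \<open>Cosines are eigenfunctions of the second derivative, so the momentum determines every
  Fourier coefficient of nonzero frequency; the constant test function gives the mean. This
  identifies the constructed u at time 0 with the given initial function.\<close>

lemma momentum_determines:
  assumes f: "integrable circle f" and g: "integrable circle g"
    and eq: "\<And>\<phi>. \<phi> \<in> circle_test \<Longrightarrow> momentum f \<phi> = momentum g \<phi>"
  shows "AE x in circle. f x = g x"
proof -
  have m: "mean f = mean g"
    using eq[OF const_circle_test[of 1]] by (simp add: momentum_def)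
  have "AE x in circle. f x - g x = 0"
  proof (rule orthogonal_AE_zero)
    show "integrable circle (\<lambda>x. f x - g x)" using f g by simp
    fix n b
    let ?a = "2 * pi * real n"
    let ?\<phi> = "\<lambda>x. cos (?a * x + b)"
    have t: "?\<phi> \<in> circle_test" using cos_circle_test[of 1 n b] by simp
    have d1: "deriv ?\<phi> = (\<lambda>x. - ?a * sin (?a * x + b))"
      by (rule ext, rule DERIV_imp_deriv) (auto intro!: derivative_eq_intros)
    have d2: "deriv (\<lambda>x. - ?a * sin (?a * x + b)) = (\<lambda>x. - (?a\<^sup>2) * ?\<phi> x)"
      by (rule ext, rule DERIV_imp_deriv) (auto intro!: derivative_eq_intros simp: power2_eq_square)
    have "(LINT x|circle. f x * (- (?a\<^sup>2) * ?\<phi> x)) = (LINT x|circle. g x * (- (?a\<^sup>2) * ?\<phi> x))"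
      using eq[OF t] m unfolding momentum_def d1 d2 by simp
    moreover have "(LINT x|circle. k x * (- (?a\<^sup>2) * ?\<phi> x)) = - (?a\<^sup>2) * (LINT x|circle. k x * ?\<phi> x)" for k
    proof -
      have "(\<lambda>x. k x * (- (?a\<^sup>2) * ?\<phi> x)) = (\<lambda>x. - (?a\<^sup>2) * (k x * ?\<phi> x))"
        by (rule ext) (rule mult.left_commute)
      then show ?thesis by (simp only: integral_mult_right_zero)
    qed
    ultimately have *: "?a\<^sup>2 * (LINT x|circle. f x * ?\<phi> x) = ?a\<^sup>2 * (LINT x|circle. g x * ?\<phi> x)" by simp
    have "(LINT x|circle. f x * ?\<phi> x) = (LINT x|circle. g x * ?\<phi> x)"
    \<comment> \<open>At frequency 0 the factor from the second derivative vanishes and the equality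
      of the means is used.\<close>
    proof (cases "n = 0")
      case True
      then show ?thesis using m by (simp add: mean_def)
    next
      case False
      then show ?thesis using * by simp
    qed
    then show "(LINT x|circle. (f x - g x) * ?\<phi> x) = 0"
      using integrable_mult_test[OF f t] integrable_mult_test[OF g t] by (simp add: left_diff_distrib)
  qed
  then show ?thesis by simp
qed

section \<open>The damped flow\<close>

text \<open>Measurability and continuity are required at all real times, so that joint measurability
  holds on the whole line; the dynamics concern t \<ge> 0. The truncated kernel \<open>ker\<close>
  has been replaced by \<open>dgreen\<close>, and B is uniform in time.\<close>

locale damped_flow = labels +
  fixes lam :: real and q p :: "real \<Rightarrow> real \<Rightarrow> real" and B :: real
  assumes lam_pos: "0 < lam"
    and q_meas: "\<And>t. q t \<in> borel_measurable nu" and p_meas: "\<And>t. p t \<in> borel_measurable nu"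
    and q_cont: "\<And>x. x \<in> {0..<1} \<Longrightarrow> continuous_on UNIV (\<lambda>t. q t x)"
    and p_cont: "\<And>x. x \<in> {0..<1} \<Longrightarrow> continuous_on UNIV (\<lambda>t. p t x)"
    and q_0: "\<And>x. x \<in> {0..<1} \<Longrightarrow> q 0 x = x" and p_0: "\<And>x. x \<in> {0..<1} \<Longrightarrow> p 0 x = 1"
    and p_nonneg: "\<And>t x. 0 \<le> p t x" and p_le: "\<And>t x. x \<in> {0..<1} \<Longrightarrow> p t x \<le> B"
    and q_der: "\<And>t x. 0 \<le> t \<Longrightarrow> x \<in> {0..<1} \<Longrightarrow>
      ((\<lambda>t. q t x) has_real_derivative (LINT y|nu. p t y * green (q t x - q t y))) (at t within {0..})"
    and p_der: "\<And>t x. 0 \<le> t \<Longrightarrow> x \<in> {0..<1} \<Longrightarrow>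
      ((\<lambda>t. p t x) has_real_derivative - lam * p t x - p t x * (LINT y|nu. p t y * dgreen (q t x - q t y)))
        (at t within {0..})"
    and green_cont: "\<And>x. x \<in> {0..<1} \<Longrightarrow> continuous_on {0..} (\<lambda>t. LINT y|nu. p t y * green (q t x - q t y))"
    and dgreen_cont: "\<And>x. x \<in> {0..<1} \<Longrightarrow> continuous_on {0..} (\<lambda>t. LINT y|nu. p t y * dgreen (q t x - q t y))"
    and p_mass: "\<And>t. 0 \<le> t \<Longrightarrow> (LINT y|nu. p t y) = M * exp (- lam * t)"
    and p_energy: "\<And>t. 0 \<le> t \<Longrightarrow> (LINT x|nu. LINT y|nu. p t x * p t y * green (q t x - q t y)) =
      exp (- 2 * lam * t) * (LINT x|nu. LINT y|nu. green (x - y))"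

text \<open>The substitution \<open>s = (1 - exp (- lam * t)) / lam\<close> of time, together with a factor
  \<open>exp (- lam * t)\<close>, turns the undamped flow into the damped one.\<close>

lemma (in lagrangian) damped_flow_exists:
  assumes lam: "0 < lam"
  shows "\<exists>q p B. damped_flow nu lam q p B"
proof -
  \<comment> \<open>\<open>max 0 t\<close> keeps s nonnegative at negative times, where the undamped
    flow is not controlled.\<close>
  define s where "s t = (1 - exp (- lam * max 0 t)) / lam" for t
  have s0: "0 \<le> s t" and s1: "s t \<le> 1 / lam" for t
    using lam by (auto simp: s_def field_simps)
  have s_der: "(s has_real_derivative exp (- lam * t)) (at t within {0..})" if "0 \<le> t" for t
  proof -
    have "((\<lambda>t. (1 - exp (- lam * t)) / lam) has_real_derivative exp (- lam * t)) (at t within {0..})"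
      using lam by (auto intro!: derivative_eq_intros)
    then show ?thesis unfolding has_field_derivative_def
      by (rule has_derivative_transform[rotated 2]) (use that in \<open>auto simp: s_def\<close>)
  qed
  have s_cont: "continuous_on S s" for S unfolding s_def using lam by (intro continuous_intros) auto
  have chain: "((\<lambda>t. f (s t)) has_real_derivative f' * exp (- lam * t)) (at t within {0..})"
    if "(f has_real_derivative f') (at (s t) within {0..})" "0 \<le> t" for f f' t
  proof -
    have "(f has_real_derivative f') (at (s t) within s ` {0..})"
      using that(1) by (rule DERIV_subset) (use s0 in auto)
    from DERIV_image_chain[OF this s_der[OF that(2)]] show ?thesis by (simp add: o_def)
  qed
  define q where "q t = Q (s t)" for t
  define p where "p t x = exp (- lam * max 0 t) * E (s t) x" for t x
  have int_p: "(LINT y|nu. p t y * k y) = exp (- lam * t) * (LINT y|nu. E (s t) y * k y)" if "0 \<le> t" for t k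
    using that by (simp add: p_def mult.assoc)
  have comp: "continuous_on S (\<lambda>t. f (s t))" if "continuous_on {0..} f" for S and f :: "real \<Rightarrow> real"
    by (rule continuous_on_compose2[OF that s_cont]) (use s0 in auto)
  have V: "(LINT y|nu. p t y * green (q t x - q t y)) = exp (- lam * t) * Qd (s t) x" if "0 \<le> t" for t x
    using int_p[OF that] Qd_eq[OF s0, of t x] by (simp add: q_def)
  have W: "(LINT y|nu. p t y * dgreen (q t x - q t y)) = - (exp (- lam * t) * Rd (s t) x)"
    if t: "0 \<le> t" and x: "x \<in> {0..<1}" for t x
  proof -
    have "(LINT y|nu. E (s t) y * dgreen (q t x - q t y)) = (LINT y|nu. E (s t) y * ker (Z (s t)) x y)"
      by (rule Bochner_Integration.integral_cong) (auto simp: q_def ker_eq[OF s0 x])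
    then show ?thesis using int_p[OF t] Rd_eq[OF s0 x, of t] by simp
  qed
  \<comment> \<open>The new time stays below 1 / lam and the logarithm of the momentum density grows
    at rate at most 4 M, hence this bound.\<close>
  have "damped_flow nu lam q p (exp (4 * M * (1 / lam)))"
  proof unfold_locales
    show "0 < lam" by (rule lam)
    show "q t \<in> borel_measurable nu" "p t \<in> borel_measurable nu" for t
      using Q_meas[OF s0] E_meas[OF s0, of t] unfolding q_def p_def by auto
    fix x :: real assume x: "x \<in> {0..<1}"
    show "continuous_on UNIV (\<lambda>t. q t x)" unfolding q_def by (rule comp[OF Q_cont[OF x]])
    show "continuous_on UNIV (\<lambda>t. p t x)" unfolding p_def E_def
      by (intro continuous_intros comp[OF R_cont[OF x]])
    show "q 0 x = x" "p 0 x = 1" using x by (auto simp: q_def p_def s_def Q0 E_def R0)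
    show "p t x \<le> exp (4 * M * (1 / lam))" for t
    proof -
      have "p t x \<le> 1 * \<bar>E (s t) x\<bar>" unfolding p_def
        using lam by (intro mult_mono) (auto simp: E_def mult_nonneg_nonneg)
      then show ?thesis using E_bd[OF s0 s1 x, of t] by simp
    qed
    show "continuous_on {0..} (\<lambda>t. LINT y|nu. p t y * green (q t x - q t y))"
    proof (rule continuous_on_eq)
      show "continuous_on {0..} (\<lambda>t. exp (- lam * max 0 t) * Qd (s t) x)"
        by (intro continuous_intros comp[OF Qd_cont[OF x]])
    qed (simp add: V)
    show "continuous_on {0..} (\<lambda>t. LINT y|nu. p t y * dgreen (q t x - q t y))"
    proof (rule continuous_on_eq)
      show "continuous_on {0..} (\<lambda>t. - (exp (- lam * max 0 t) * Rd (s t) x))"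
        by (intro continuous_intros comp[OF Rd_cont[OF x]])
    qed (simp add: W[OF _ x])
    fix t :: real assume t: "0 \<le> t"
    show "((\<lambda>t. q t x) has_real_derivative (LINT y|nu. p t y * green (q t x - q t y))) (at t within {0..})"
      using chain[OF Q_der[OF s0 x] t] V[OF t, of x] by (simp add: q_def mult.commute)
    have "((\<lambda>t. exp (- lam * t) * E (s t) x) has_real_derivative
       exp (- lam * t) * (E (s t) x * Rd (s t) x * exp (- lam * t)) + (exp (- lam * t) * (- lam)) * E (s t) x) (at t within {0..})"
      by (rule DERIV_mult'[OF _ chain[OF E_der[OF s0 x] t]]) (auto intro!: derivative_eq_intros)
    then have "((\<lambda>t. p t x) has_real_derivative
       exp (- lam * t) * (E (s t) x * Rd (s t) x * exp (- lam * t)) + (exp (- lam * t) * (- lam)) * E (s t) x) (at t within {0..})"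
      unfolding has_field_derivative_def
      by (rule has_derivative_transform[rotated 2]) (use t in \<open>auto simp: p_def\<close>)
    moreover have "exp (- lam * t) * (E (s t) x * Rd (s t) x * exp (- lam * t)) + (exp (- lam * t) * (- lam)) * E (s t) x =
       - lam * p t x - p t x * (LINT y|nu. p t y * dgreen (q t x - q t y))"
      unfolding W[OF t x] using t by (simp add: p_def algebra_simps)
    ultimately show "((\<lambda>t. p t x) has_real_derivative - lam * p t x - p t x * (LINT y|nu. p t y * dgreen (q t x - q t y)))
        (at t within {0..})" by simp
  next
    fix t :: real assume t: "0 \<le> t"
    show "(LINT y|nu. p t y) = M * exp (- lam * t)"
      using int_p[OF t, of "\<lambda>_. 1"] integral_E[OF s0, of t] by simp
    have "p t x * p t y * green (q t x - q t y) =
        exp (- 2 * lam * t) * (E (s t) x * E (s t) y * green (Q (s t) x - Q (s t) y))" for x y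
      using t by (simp add: p_def q_def exp_add[symmetric] mult_ac)
    then show "(LINT x|nu. LINT y|nu. p t x * p t y * green (q t x - q t y)) =
      exp (- 2 * lam * t) * (LINT x|nu. LINT y|nu. green (x - y))"
      by (simp add: energy_const[OF s0])
  qed (simp add: p_def E_def)
  then show ?thesis by blast
qed

lemma (in labels) damped_flow_exists:
  assumes "0 < lam"
  obtains q p B where "damped_flow nu lam q p B"
proof -
  have "bounded_borel nu (\<lambda>x. (x, 0 :: real))"
    unfolding bounded_borel_def
  proof (intro conjI exI ballI)
    show "(\<lambda>x. (x, 0 :: real)) \<in> borel_measurable nu" by (rule borel_measurable_Pair) measurable
    show "norm (x, 0 :: real) \<le> 1" if "x \<in> space nu" for x using that by (simp add: norm_Pair)
  qed
  then obtain Z where Z: "\<And>x. x \<in> space nu \<Longrightarrow> Z 0 x = (x, 0)"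
    "\<And>t. 0 \<le> t \<Longrightarrow> bounded_borel nu (Z t)"
    "\<And>s t x. 0 \<le> s \<Longrightarrow> 0 \<le> t \<Longrightarrow> x \<in> space nu \<Longrightarrow> norm (Z t x - Z s x) \<le> 4 * M * \<bar>t - s\<bar>"
    "\<And>t x. 0 \<le> t \<Longrightarrow> x \<in> space nu \<Longrightarrow> ((\<lambda>t. Z t x) has_vector_derivative fld (Z t) x) (at t within {0..})"
    "\<And>x. x \<in> space nu \<Longrightarrow> continuous_on {0..} (\<lambda>t. fld (Z t) x)"
    by (rule solution_exists) blast
  interpret lagrangian nu Z by unfold_locales (use Z in auto)
  show ?thesis using damped_flow_exists[OF assms] that by blast
qed

section \<open>The transported measure and its potential\<close>

context damped_flow
begin

definition Y :: "real \<Rightarrow> real measure" where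
  "Y t = distr (density nu (\<lambda>x. ennreal (p t x))) borel (q t)"

lemma B_nonneg: "0 \<le> B"
  using p_nonneg[of 0 0] p_le[of 0 0] by simp

lemma abs_p_le: "x \<in> {0..<1} \<Longrightarrow> \<bar>p t x\<bar> \<le> B"
  using p_nonneg p_le by simp

lemma integrable_p: "integrable nu (p t)"
  by (rule integrable_bounded[OF fin_nu p_meas, where B = B]) (simp add: abs_p_le)

lemma integral_Y:
  assumes [measurable]: "f \<in> borel_measurable borel"
  shows "(LINT a|Y t. f a) = (LINT x|nu. p t x * f (q t x))"
proof -
  note [measurable] = q_meas[of t] p_meas[of t]
  have "(LINT a|Y t. f a) = (LINT x|density nu (\<lambda>x. ennreal (p t x)). f (q t x))"
    unfolding Y_def by (rule integral_distr) measurable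
  also have "\<dots> = (LINT x|nu. p t x * f (q t x))"
    using integral_density[of "\<lambda>x. f (q t x)" nu "p t"] p_nonneg by simp
  finally show ?thesis .
qed

lemma emeasure_Y: "emeasure (Y t) UNIV = ennreal (LINT x|nu. p t x)"
proof -
  note [measurable] = q_meas[of t] p_meas[of t]
  have "emeasure (Y t) UNIV = emeasure (density nu (\<lambda>x. ennreal (p t x))) (space nu)"
    unfolding Y_def by (subst emeasure_distr) (use sets.top[of nu] in auto)
  also have "\<dots> = (\<integral>\<^sup>+x. ennreal (p t x) * indicator (space nu) x \<partial>nu)"
    by (rule emeasure_density) (use sets.top[of nu] in auto)
  also have "\<dots> = (\<integral>\<^sup>+x. ennreal (p t x) \<partial>nu)"
    by (rule nn_integral_cong) simp
  also have "\<dots> = ennreal (LINT x|nu. p t x)"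
    by (rule nn_integral_eq_integral[OF integrable_p]) (simp add: p_nonneg)
  finally show ?thesis .
qed

sublocale Y: source "Y t" for t
proof (rule source.intro)
  show "sets (Y t) = sets borel" by (simp add: Y_def)
  show "finite_measure (Y t)"
    by (rule finite_measureI) (use emeasure_Y[of t] in \<open>simp add: Y_def\<close>)
qed

lemma mass_Y: "0 \<le> t \<Longrightarrow> Y.mass t = M * exp (- lam * t)"
  unfolding Y.mass_def measure_def emeasure_Y using p_mass[of t] M_nonneg by simp

lemma mass_le: "0 \<le> t \<Longrightarrow> Y.mass t \<le> M"
  using mass_Y[of t] M_nonneg lam_pos by (simp add: mult_left_le)

definition u :: "real \<Rightarrow> real \<Rightarrow> real" where "u t = pot (Y t)"
definition ux :: "real \<Rightarrow> real \<Rightarrow> real" where "ux t = dpot (Y t)"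

lemma u_eq: "u t x = (LINT y|nu. p t y * green (x - q t y))"
  and ux_eq: "ux t x = (LINT y|nu. p t y * dgreen (x - q t y))"
  unfolding u_def ux_def pot_def dpot_def by (rule integral_Y, measurable)+

lemma u_bd: "0 \<le> t \<Longrightarrow> \<bar>u t x\<bar> \<le> 2 * M" and ux_bd: "0 \<le> t \<Longrightarrow> \<bar>ux t x\<bar> \<le> M"
  using Y.abs_pot_le[of t x] Y.abs_dpot_le[of t x] mass_le[of t] by (auto simp: u_def ux_def)

lemma u_meas [measurable]: "u t \<in> borel_measurable borel" and ux_meas [measurable]: "ux t \<in> borel_measurable borel"
  by (simp_all add: u_def ux_def)

lemma joint_q: "(\<lambda>(t, x). q t x) \<in> borel_measurable (borel \<Otimes>\<^sub>M nu)"
  and joint_p: "(\<lambda>(t, x). p t x) \<in> borel_measurable (borel \<Otimes>\<^sub>M nu)"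
  by (rule caratheodory_measurable[OF q_meas q_cont] caratheodory_measurable[OF p_meas p_cont]; simp)+

lemma joint_flow [measurable]:
  assumes [measurable]: "f \<in> borel_measurable N" "g \<in> measurable N nu"
  shows "(\<lambda>z. q (f z) (g z)) \<in> borel_measurable N" "(\<lambda>z. p (f z) (g z)) \<in> borel_measurable N"
  using measurable_compose[OF _ joint_q, of "\<lambda>z. (f z, g z)" N] measurable_compose[OF _ joint_p, of "\<lambda>z. (f z, g z)" N]
  by (simp_all add: assms)

lemma joint_u: "(\<lambda>(t, x). u t x) \<in> borel_measurable (borel \<Otimes>\<^sub>M borel)"
  and joint_ux: "(\<lambda>(t, x). ux t x) \<in> borel_measurable (borel \<Otimes>\<^sub>M borel)"
proof -
  have "(\<lambda>(z, y). p (fst z) y * green (snd z - q (fst z) y)) \<in> borel_measurable ((borel \<Otimes>\<^sub>M borel) \<Otimes>\<^sub>M nu)"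
    "(\<lambda>(z, y). p (fst z) y * dgreen (snd z - q (fst z) y)) \<in> borel_measurable ((borel \<Otimes>\<^sub>M borel) \<Otimes>\<^sub>M nu)"
    by measurable
  from this[THEN nu.borel_measurable_lebesgue_integral]
  show "(\<lambda>(t, x). u t x) \<in> borel_measurable (borel \<Otimes>\<^sub>M borel)"
    "(\<lambda>(t, x). ux t x) \<in> borel_measurable (borel \<Otimes>\<^sub>M borel)"
    by (simp_all add: u_eq ux_eq split_beta)
qed

lemma joint_u_comp [measurable]:
  assumes [measurable]: "f \<in> borel_measurable N" "g \<in> borel_measurable N"
  shows "(\<lambda>z. u (f z) (g z)) \<in> borel_measurable N" "(\<lambda>z. ux (f z) (g z)) \<in> borel_measurable N"
  using measurable_compose[OF _ joint_u, of "\<lambda>z. (f z, g z)" N] measurable_compose[OF _ joint_ux, of "\<lambda>z. (f z, g z)" N]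
  by (simp_all add: assms)

text \<open>\<open>green\<close> is continuous across its corner, so the integrand converges at
  every label, dominated by a constant on the finite measure \<open>nu\<close>.\<close>

lemma continuous_u: "continuous_on UNIV (\<lambda>(t, x). u t x)"
proof (unfold continuous_on_sequentially, intro ballI allI impI, elim conjE)
  fix z :: "nat \<Rightarrow> real \<times> real" and w
  assume "z \<longlonglongrightarrow> w"
  then have z: "(\<lambda>n. fst (z n)) \<longlonglongrightarrow> fst w" "(\<lambda>n. snd (z n)) \<longlonglongrightarrow> snd w"
    by (auto intro: tendsto_fst tendsto_snd)
  have "(\<lambda>n. LINT y|nu. p (fst (z n)) y * green (snd (z n) - q (fst (z n)) y)) \<longlonglongrightarrow>
      (LINT y|nu. p (fst w) y * green (snd w - q (fst w) y))"
  proof (rule integral_dominated_convergence[where w = "\<lambda>_. B * 2"])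
    show "(\<lambda>y. p (fst w) y * green (snd w - q (fst w) y)) \<in> borel_measurable nu" by measurable
    show "(\<lambda>y. p (fst (z n)) y * green (snd (z n) - q (fst (z n)) y)) \<in> borel_measurable nu" for n by measurable
    show "AE y in nu. (\<lambda>n. p (fst (z n)) y * green (snd (z n) - q (fst (z n)) y)) \<longlonglongrightarrow>
        p (fst w) y * green (snd w - q (fst w) y)"
    proof (rule AE_I2)
      fix y assume "y \<in> space nu"
      then have y: "y \<in> {0..<1}" by simp
      have "(\<lambda>n. p (fst (z n)) y) \<longlonglongrightarrow> p (fst w) y" "(\<lambda>n. q (fst (z n)) y) \<longlonglongrightarrow> q (fst w) y"
        using continuous_on_tendsto_compose[OF p_cont[OF y] z(1)]
          continuous_on_tendsto_compose[OF q_cont[OF y] z(1)] by simp_all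
      then show "(\<lambda>n. p (fst (z n)) y * green (snd (z n) - q (fst (z n)) y)) \<longlonglongrightarrow>
          p (fst w) y * green (snd w - q (fst w) y)"
        by (intro tendsto_mult continuous_on_tendsto_compose[OF continuous_on_green[of UNIV]] tendsto_diff z) auto
    qed
    show "AE y in nu. norm (p (fst (z n)) y * green (snd (z n) - q (fst (z n)) y)) \<le> B * 2" for n
      using abs_p_le B_nonneg by (intro AE_I2) (auto simp: abs_mult intro!: mult_mono abs_green_le)
  qed simp
  then show "((\<lambda>(t, x). u t x) \<circ> z) \<longlonglongrightarrow> (case w of (t, x) \<Rightarrow> u t x)"
    by (simp add: o_def split_beta u_eq)
qed

text \<open>By the symmetry of \<open>green\<close> this is the inverse of the operator A applied to
  f. Pairing u with f amounts to integrating it over Y, so particles see a test function only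
  through it.\<close>

definition green_test :: "(real \<Rightarrow> real) \<Rightarrow> real \<Rightarrow> real" where
  "green_test f a = (LINT x|circle. green (x - a) * f x)"

definition p' :: "real \<Rightarrow> real \<Rightarrow> real" where
  "p' t y = - lam * p t y - p t y * ux t (q t y)"

lemma p'_meas [measurable]: "p' t \<in> borel_measurable nu"
  unfolding p'_def by measurable

lemma p'_bd: "0 \<le> t \<Longrightarrow> y \<in> {0..<1} \<Longrightarrow> \<bar>p' t y\<bar> \<le> (lam + M) * B"
proof -
  assume t: "0 \<le> t" and y: "y \<in> {0..<1}"
  have "\<bar>p t y * ux t (q t y)\<bar> \<le> B * M"
    unfolding abs_mult using abs_p_le[OF y] ux_bd[OF t] B_nonneg by (intro mult_mono) auto
  moreover have "\<bar>- lam * p t y\<bar> \<le> lam * B"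
    unfolding abs_mult using abs_p_le[OF y] lam_pos by (intro mult_mono) auto
  ultimately have "\<bar>p' t y\<bar> \<le> lam * B + B * M" unfolding p'_def by (intro order_trans[OF abs_triangle_ineq4] add_mono)
  then show ?thesis by (simp add: algebra_simps)
qed

lemma measurable_id_circle [measurable]: "(\<lambda>x. x) \<in> borel_measurable circle"
  by (rule measurable_circleI) simp

lemma test_slice:
  assumes "\<phi> \<in> cylinder_test I"
  shows "\<phi> t \<in> borel_measurable borel" "circle_deriv (\<phi> t) (d_x \<phi> t)"
proof -
  note dx = cylinder_test_partials(2)[OF assms]
  have c: "continuous_on UNIV (\<psi> t)" if "\<psi> \<in> cylinder_test I" for \<psi>
    using continuous_on_compose2[OF cylinder_testD(3)[OF that, of UNIV], of UNIV "\<lambda>x. (t, x)"]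
    by (simp add: continuous_on_Pair)
  show "\<phi> t \<in> borel_measurable borel" by (rule borel_measurable_continuous_onI[OF c[OF assms]])
  show "circle_deriv (\<phi> t) (d_x \<phi> t)"
    by (rule circle_deriv_C1[OF cylinder_testD(2)[OF assms] cylinder_testD(2)[OF dx] c[OF dx]
        smooth_partials(4)[OF cylinder_testD(1)[OF assms]]])
qed

text \<open>After the shift of \<open>x\<close> by \<open>q t y\<close>, time enters \<open>p t y * green x * \<phi> t (x + q t y)\<close> only through
  differentiable factors, so its total derivative can be integrated over time for fixed \<open>x\<close> and \<open>y\<close>.\<close>

lemma transport_identity:
  assumes \<phi>: "\<phi> \<in> cylinder_test I" and T: "0 \<le> T" and z: "\<And>x. \<phi> 0 x = 0" "\<And>x. \<phi> T x = 0"
  shows "(LINT t|restrict_space lborel {0..T}. (LINT x|circle. u t x * d_t \<phi> t x) +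
    (LINT y|nu. p' t y * green_test (\<phi> t) (q t y) + p t y * u t (q t y) * green_test (d_x \<phi> t) (q t y))) = 0"
proof -
  let ?N = "nu \<Otimes>\<^sub>M circle"
  interpret C: finite_measure circle by (rule finite_measure_circle)
  interpret P: pair_sigma_finite nu circle by unfold_locales
  have fN: "finite_measure ?N" by (simp add: fin_nu finite_measure_circle finite_measure_pair_measure)
  note s = cylinder_testD(1)[OF \<phi>]
  note dt = cylinder_test_partials(1)[OF \<phi>] and dx = cylinder_test_partials(2)[OF \<phi>]
  obtain C0 where C0: "\<And>t x. \<bar>\<phi> t x\<bar> \<le> C0" using cylinder_test_bounded[OF \<phi>] by blast
  obtain C1 where C1: "\<And>t x. \<bar>d_t \<phi> t x\<bar> \<le> C1" using cylinder_test_bounded[OF dt] by blast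
  obtain C2 where C2: "\<And>t x. \<bar>d_x \<phi> t x\<bar> \<le> C2" using cylinder_test_bounded[OF dx] by blast
  have Cn: "0 \<le> C0" "0 \<le> C1" "0 \<le> C2" using order_trans[OF abs_ge_zero] C0 C1 C2 by blast+
  note [measurable] = test_slice(1)[OF \<phi>] test_slice(1)[OF dt] test_slice(1)[OF dx] q_meas p_meas
  define F where "F t = (\<lambda>(y, x). p t y * (green x * \<phi> t (x + q t y)))" for t
  define G where "G t y x = green x * (p' t y * \<phi> t (x + q t y) +
      p t y * (d_t \<phi> t (x + q t y) + d_x \<phi> t (x + q t y) * u t (q t y)))" for t y x
  define K where "K = 2 * ((lam + M) * B * C0 + B * (C1 + C2 * (2 * M)))"
  have Gb: "\<bar>G t y x\<bar> \<le> K" if t: "0 \<le> t" and y: "y \<in> {0..<1}" for t y x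
  proof -
    have 1: "\<bar>p' t y * \<phi> t (x + q t y)\<bar> \<le> (lam + M) * B * C0"
      unfolding abs_mult using p'_bd[OF t y] C0 lam_pos M_nonneg B_nonneg by (intro mult_mono) auto
    have "\<bar>d_x \<phi> t (x + q t y) * u t (q t y)\<bar> \<le> C2 * (2 * M)"
      unfolding abs_mult using C2 u_bd[OF t] Cn by (intro mult_mono) auto
    then have "\<bar>d_t \<phi> t (x + q t y) + d_x \<phi> t (x + q t y) * u t (q t y)\<bar> \<le> C1 + C2 * (2 * M)"
      by (intro order_trans[OF abs_triangle_ineq add_mono[OF C1]])
    then have "\<bar>p t y * (d_t \<phi> t (x + q t y) + d_x \<phi> t (x + q t y) * u t (q t y))\<bar> \<le> B * (C1 + C2 * (2 * M))"
      unfolding abs_mult using abs_p_le[OF y] B_nonneg by (intro mult_mono) auto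
    note 2 = order_trans[OF abs_triangle_ineq add_mono[OF 1 this]]
    show ?thesis unfolding G_def K_def abs_mult[of "green x"]
      by (rule mult_mono[OF abs_green_le 2]) auto
  qed
  have Gm: "(\<lambda>(y, x). G t y x) \<in> borel_measurable ?N" for t
    unfolding G_def by measurable
  have e1: "(LINT z|?N. F T z - F 0 z) = (LINT t|restrict_space lborel {0..T}. LINT z|?N. (case z of (y, x) \<Rightarrow> G t y x))"
  proof (rule integral_time_derivative[OF fN T, where B = K])
    fix z t assume zz: "z \<in> space ?N" and t: "t \<in> {0..T}"
    then obtain y x where z: "z = (y, x)" "y \<in> {0..<1}" by (auto simp: space_pair_measure)
    have t0: "0 \<le> t" using t by simp
    have "((\<lambda>t. x + q t y) has_real_derivative u t (q t y)) (at t within {0..})"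
      using q_der[OF t0 z(2)] by (auto intro!: derivative_eq_intros simp: u_eq)
    note D1 = smooth_chain[OF s this]
    have D2: "((\<lambda>t. p t y) has_real_derivative p' t y) (at t within {0..})"
      using p_der[OF t0 z(2)] by (simp add: p'_def ux_eq)
    have "((\<lambda>t. p t y * (green x * \<phi> t (x + q t y))) has_real_derivative G t y x) (at t within {0..})"
      using DERIV_mult'[OF D2 DERIV_cmult[OF D1, of "green x"]] by (simp add: G_def algebra_simps)
    then have "((\<lambda>t. F t z) has_real_derivative (case z of (y, x) \<Rightarrow> G t y x)) (at t within {0..})"
      by (simp add: F_def z)
    then show "((\<lambda>t. F t z) has_real_derivative (case z of (y, x) \<Rightarrow> G t y x)) (at t within {0..T})"
      by (rule DERIV_subset) auto
    show "\<bar>case z of (y, x) \<Rightarrow> G t y x\<bar> \<le> K" using Gb[OF t0 z(2)] by (simp add: z)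
  next
    fix z assume "z \<in> space ?N"
    then obtain y x where z: "z = (y, x)" and y: "y \<in> {0..<1}" by (auto simp: space_pair_measure)
    have cq: "continuous_on {0..T} (\<lambda>t. q t y)" and cp: "continuous_on {0..T} (\<lambda>t. p t y)"
      using q_cont[OF y] p_cont[OF y] continuous_on_subset by blast+
    have cu: "continuous_on {0..T} (\<lambda>t. u t (q t y))" "continuous_on {0..T} (\<lambda>t. ux t (q t y))"
      unfolding u_eq ux_eq by (rule continuous_on_subset[OF green_cont[OF y]] continuous_on_subset[OF dgreen_cont[OF y]]; force)+
    have cf: "continuous_on {0..T} (\<lambda>t. f t (x + q t y))" if "f \<in> cylinder_test I" for f
    proof -
      have "continuous_on {0..T} (\<lambda>t. (t, x + q t y))" by (intro continuous_intros cq)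
      then show ?thesis
        using continuous_on_compose2[OF cylinder_testD(3)[OF that, of UNIV], of "{0..T}" "\<lambda>t. (t, x + q t y)"] by simp
    qed
    show "continuous_on {0..T} (\<lambda>t. case z of (y, x) \<Rightarrow> G t y x)"
      unfolding z case_prod_conv G_def p'_def
      by (intro continuous_intros cp cu cf \<phi> dt dx)
  qed (rule Gm)
  have e2: "(LINT z|?N. F T z - F 0 z) = 0"
    using z by (simp add: F_def split_beta)
  have e3: "(LINT z|?N. (case z of (y, x) \<Rightarrow> G t y x)) = (LINT x|circle. u t x * d_t \<phi> t x) +
    (LINT y|nu. p' t y * green_test (\<phi> t) (q t y) + p t y * u t (q t y) * green_test (d_x \<phi> t) (q t y))"
    if t: "t \<in> {0..T}" for t
  proof -
    have t0: "0 \<le> t" using t by simp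
    have iN: "integrable ?N (\<lambda>(y, x). G t y x)"
      by (rule integrable_bounded[OF fN Gm, where B = K]) (use Gb[OF t0] in \<open>auto simp: space_pair_measure\<close>)
    have sh: "(LINT x|circle. green x * f t (x + a)) = green_test (f t) a" "integrable circle (\<lambda>x. green x * f t (x + a))"
      and gb: "\<bar>green_test (f t) a\<bar> \<le> 2 * L" and gm: "green_test (f t) \<in> borel_measurable borel"
      if f: "f \<in> cylinder_test I" and L: "\<And>t x. \<bar>f t x\<bar> \<le> L" for f a L
    proof -
      note [measurable] = test_slice(1)[OF f]
      show "(LINT x|circle. green x * f t (x + a)) = green_test (f t) a"
        unfolding green_test_def
        by (rule shift_kernel[symmetric, OF periodic1_green measurable_green abs_green_le cylinder_testD(2)[OF f] _ L]) measurable
      have "\<bar>green x * f t (x + a)\<bar> \<le> 2 * L" for x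
        unfolding abs_mult by (rule mult_mono[OF abs_green_le L]) auto
      then show "integrable circle (\<lambda>x. green x * f t (x + a))"
        by (rule integrable_circle_bounded[rotated]) measurable
      have L0: "0 \<le> L" using order_trans[OF abs_ge_zero L] .
      have "\<bar>green (x - a) * f t x\<bar> \<le> 2 * L" for x
        unfolding abs_mult by (rule mult_mono[OF abs_green_le L]) auto
      then show "\<bar>green_test (f t) a\<bar> \<le> 2 * L"
        unfolding green_test_def using abs_integral_bounded[OF finite_measure_circle, of "\<lambda>x. green (x - a) * f t x" "2 * L"] L0
        by simp
      show "green_test (f t) \<in> borel_measurable borel"
        unfolding green_test_def[abs_def]
        by (rule convolution_swap(2)[OF Y.fin Y.sets_Y measurable_green _ abs_green_le L]) measurable
    qed
    note s0 = sh[OF \<phi> C0] and s1 = sh[OF dt C1] and s2 = sh[OF dx C2]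
    note [measurable] = gm[OF \<phi> C0] gm[OF dt C1] gm[OF dx C2]
    have inner: "(LINT x|circle. G t y x) = (p' t y * green_test (\<phi> t) (q t y) + p t y * u t (q t y) * green_test (d_x \<phi> t) (q t y))
       + p t y * green_test (d_t \<phi> t) (q t y)" for y
    proof -
      have "(LINT x|circle. G t y x) = (LINT x|circle. p' t y * (green x * \<phi> t (x + q t y)) +
          (p t y * (green x * d_t \<phi> t (x + q t y)) + p t y * u t (q t y) * (green x * d_x \<phi> t (x + q t y))))"
        by (simp add: G_def algebra_simps)
      also have "\<dots> = p' t y * green_test (\<phi> t) (q t y) +
          (p t y * green_test (d_t \<phi> t) (q t y) + p t y * u t (q t y) * green_test (d_x \<phi> t) (q t y))"
        using s0(2)[of "q t y"] s1(2)[of "q t y"] s2(2)[of "q t y"] by (simp add: s0(1) s1(1) s2(1))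
      finally show ?thesis by simp
    qed
    have i1: "integrable nu (\<lambda>y. p' t y * green_test (\<phi> t) (q t y))"
      by (rule integrable_bounded[OF fin_nu, where B = "(lam + M) * B * (2 * C0)"])
         (use p'_bd[OF t0] gb[OF \<phi> C0] lam_pos M_nonneg B_nonneg in \<open>auto simp: abs_mult intro!: mult_mono\<close>)
    have i2: "integrable nu (\<lambda>y. p t y * u t (q t y) * green_test (d_x \<phi> t) (q t y))"
    proof (rule integrable_bounded[OF fin_nu])
      show "\<bar>p t y * u t (q t y) * green_test (d_x \<phi> t) (q t y)\<bar> \<le> B * (2 * M) * (2 * C2)" if "y \<in> space nu" for y
        unfolding abs_mult
        by (rule mult_mono[OF mult_mono[OF abs_p_le u_bd[OF t0]] gb[OF dx C2]])
           (use that M_nonneg B_nonneg in auto)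
    qed measurable
    have i3: "integrable nu (\<lambda>y. p t y * green_test (d_t \<phi> t) (q t y))"
      by (rule integrable_bounded[OF fin_nu, where B = "B * (2 * C1)"])
         (use abs_p_le gb[OF dt C1] B_nonneg in \<open>auto simp: abs_mult intro!: mult_mono\<close>)
    \<comment> \<open>The part of G with \<open>d_t \<phi>\<close> is the particle form of the first
      integral in the claim.\<close>
    have "(LINT x|circle. u t x * d_t \<phi> t x) = (LINT a|Y t. green_test (d_t \<phi> t) a)"
      unfolding u_def pot_def green_test_def
      by (rule convolution_swap(1)[OF Y.fin Y.sets_Y measurable_green _ abs_green_le C1]) measurable
    also have "\<dots> = (LINT y|nu. p t y * green_test (d_t \<phi> t) (q t y))"
      by (rule integral_Y) measurable
    finally have ut: "(LINT x|circle. u t x * d_t \<phi> t x) = (LINT y|nu. p t y * green_test (d_t \<phi> t) (q t y))" .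
    have "(LINT z|?N. (case z of (y, x) \<Rightarrow> G t y x)) = (LINT y|nu. LINT x|circle. G t y x)"
      using P.integral_fst'[OF iN] by simp
    then show ?thesis unfolding inner ut using i1 i2 i3 by simp
  qed
  have "(LINT t|restrict_space lborel {0..T}. (LINT x|circle. u t x * d_t \<phi> t x) +
      (LINT y|nu. p' t y * green_test (\<phi> t) (q t y) + p t y * u t (q t y) * green_test (d_x \<phi> t) (q t y))) =
    (LINT t|restrict_space lborel {0..T}. LINT z|?N. (case z of (y, x) \<Rightarrow> G t y x))"
    by (rule Bochner_Integration.integral_cong[OF refl], rule e3[symmetric]) (simp add: space_restrict_space)
  then show ?thesis using e1 e2 by (simp only:)
qed

end

section \<open>The weak solution\<close>

lemma has_weak_deriv_weak_deriv: "has_weak_deriv f v \<Longrightarrow> has_weak_deriv f (weak_deriv f)"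
  unfolding weak_deriv_def by (rule someI[of "has_weak_deriv f" v])

lemma weak_deriv_AE_eq: "has_weak_deriv f v \<Longrightarrow> AE x in circle. weak_deriv f x = v x"
  by (rule weak_deriv_unique[OF has_weak_deriv_weak_deriv])

lemma L2_norm_weak_deriv:
  assumes "has_weak_deriv f v"
  shows "L2_norm (weak_deriv f) = L2_norm v"
proof -
  have [measurable]: "weak_deriv f \<in> borel_measurable circle" "v \<in> borel_measurable circle"
    using assms has_weak_deriv_weak_deriv[OF assms] by (auto simp: has_weak_deriv_def dest: borel_measurable_integrable)
  have "(LINT x|circle. (weak_deriv f x)\<^sup>2) = (LINT x|circle. (v x)\<^sup>2)"
    by (rule integral_cong_AE) (use weak_deriv_AE_eq[OF assms] in auto)
  then show ?thesis by (simp add: L2_norm_def)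
qed

lemma square_integrable_bounded:
  assumes "f \<in> borel_measurable borel" "\<And>x. \<bar>f x\<bar> \<le> C"
  shows "square_integrable circle f"
proof -
  have "\<bar>(f x)\<^sup>2\<bar> \<le> C\<^sup>2" for x using assms(2)[of x] by (metis abs_ge_zero abs_power2 power2_abs power_mono)
  then have "integrable circle (\<lambda>x. (f x)\<^sup>2)" by (intro integrable_circle_bounded) (use assms in auto)
  then show ?thesis using assms by (auto simp: square_integrable_def)
qed

lemma L2_norm_le:
  assumes "f \<in> borel_measurable borel" "\<And>x. \<bar>f x\<bar> \<le> C"
  shows "L2_norm f \<le> C"
proof -
  have C: "0 \<le> C" using order_trans[OF abs_ge_zero assms(2)] .
  have b: "\<bar>(f x)\<^sup>2\<bar> \<le> C\<^sup>2" for x using assms(2)[of x] by (metis abs_ge_zero abs_power2 power2_abs power_mono)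
  have "(LINT x|circle. (f x)\<^sup>2) \<le> C\<^sup>2"
    using abs_integral_bounded[OF finite_measure_circle b] by simp
  then show ?thesis unfolding L2_norm_def using C by (simp add: real_le_lsqrt)
qed

lemma L2_norm_nonneg: "0 \<le> L2_norm f"
  by (simp add: L2_norm_def)

lemma Linf_AE_bounded:
  assumes "f \<in> borel_measurable circle" "AE x in circle. \<bar>f x\<bar> \<le> C" "0 \<le> C"
  shows "Linf f" "Linf_norm f \<le> C"
proof -
  have e: "esssup circle (\<lambda>x. ereal \<bar>f x\<bar>) \<le> ereal C"
    by (rule esssup_I) (use assms in auto)
  then have "esssup circle (\<lambda>x. ereal \<bar>f x\<bar>) < \<infinity>" by (rule order_le_less_trans) simp
  then show "Linf f" using assms(1) by (simp add: Linf_def)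
  show "Linf_norm f \<le> C" unfolding Linf_norm_def using e assms(3)
    by (cases "esssup circle (\<lambda>x. ereal \<bar>f x\<bar>)") auto
qed

text \<open>For a positive measure, the sum over a disjoint family is the measure of its
  union.\<close>

lemma M_norm_le:
  assumes "finite_measure \<nu>"
  shows "M_norm \<nu> \<le> ennreal (measure \<nu> (space \<nu>))"
  unfolding M_norm_def total_variation_def
proof (rule SUP_least, elim CollectE conjE)
  interpret finite_measure \<nu> by fact
  fix P assume P: "finite P" "P \<subseteq> sets \<nu>" "disjoint P"
  have "(\<Sum>A\<in>P. ennreal \<bar>measure \<nu> A\<bar>) = ennreal (\<Sum>A\<in>P. measure \<nu> A)"
    by (simp add: sum_ennreal)
  also have "(\<Sum>A\<in>P. measure \<nu> A) = measure \<nu> (\<Union>A\<in>P. A)"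
    by (rule finite_measure_finite_Union[symmetric, where A = "\<lambda>A. A"])
       (use P in \<open>auto simp: disjoint_family_on_def disjoint_def\<close>)
  also have "\<dots> \<le> measure \<nu> (space \<nu>)" by (rule bounded_measure)
  finally show "(\<Sum>A\<in>P. ennreal \<bar>measure \<nu> A\<bar>) \<le> ennreal (measure \<nu> (space \<nu>))"
    by (simp add: ennreal_leI)
qed

lemma cylinder_test_window:
  assumes \<phi>: "\<phi> \<in> cylinder_test I" and I: "I \<subseteq> {0<..}"
  obtains T where "0 < T" "\<And>x. \<phi> 0 x = 0" "\<And>x. \<phi> T x = 0"
    "\<And>t x. t \<notin> I \<inter> {0..T} \<Longrightarrow> \<phi> t x = 0 \<and> d_t \<phi> t x = 0 \<and> d_x \<phi> t x = 0"
proof -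
  obtain T0 where T0: "0 < T0" "\<And>t x. t \<notin> I \<inter> {0<..<T0} \<Longrightarrow> \<phi> t x = 0"
    using cylinder_test_support[OF \<phi> I] by blast
  obtain T1 where T1: "0 < T1" "\<And>t x. t \<notin> I \<inter> {0<..<T1} \<Longrightarrow> d_t \<phi> t x = 0"
    using cylinder_test_support[OF cylinder_test_partials(1)[OF \<phi>] I] by blast
  obtain T2 where T2: "0 < T2" "\<And>t x. t \<notin> I \<inter> {0<..<T2} \<Longrightarrow> d_x \<phi> t x = 0"
    using cylinder_test_support[OF cylinder_test_partials(2)[OF \<phi>] I] by blast
  show ?thesis
  proof (rule that[of "max T0 (max T1 T2)"])
    fix t x assume "t \<notin> I \<inter> {0..max T0 (max T1 T2)}"
    then have "t \<notin> I \<inter> {0<..<T0}" "t \<notin> I \<inter> {0<..<T1}" "t \<notin> I \<inter> {0<..<T2}" by auto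
    then show "\<phi> t x = 0 \<and> d_t \<phi> t x = 0 \<and> d_x \<phi> t x = 0" using T0(2) T1(2) T2(2) by blast
  qed (use T0 in auto)
qed

text \<open>The common last step for both weak derivatives and the weak equation: for a test
  function supported in [0, T], it is enough that the slices, integrated over time, cancel.\<close>

lemma cylinder_balance:
  fixes F G :: "real \<Rightarrow> real \<Rightarrow> real"
  assumes I: "I \<in> sets borel"
    and mF: "(\<lambda>(t, x). F t x) \<in> borel_measurable (borel \<Otimes>\<^sub>M borel)"
    and mG: "(\<lambda>(t, x). G t x) \<in> borel_measurable (borel \<Otimes>\<^sub>M borel)"
    and bF: "\<And>t x. 0 \<le> t \<Longrightarrow> \<bar>F t x\<bar> \<le> C" and bG: "\<And>t x. 0 \<le> t \<Longrightarrow> \<bar>G t x\<bar> \<le> D"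
    and zF: "\<And>t x. t \<notin> I \<inter> {0..T} \<Longrightarrow> F t x = 0" and zG: "\<And>t x. t \<notin> I \<inter> {0..T} \<Longrightarrow> G t x = 0"
    and eq: "(LINT t|restrict_space lborel {0..T}. (LINT x|circle. F t x) + (LINT x|circle. G t x)) = 0"
  shows "(LINT (t, x)|cylinder I. F t x) = - (LINT (t, x)|cylinder I. G t x)"
proof -
  let ?R = "restrict_space lborel {0..T}"
  have i: "integrable ?R (\<lambda>t. LINT x|circle. H t x)"
    if m: "(\<lambda>(t, x). H t x) \<in> borel_measurable (borel \<Otimes>\<^sub>M borel)" and b: "\<And>t x. 0 \<le> t \<Longrightarrow> \<bar>H t x\<bar> \<le> C"
    for H :: "real \<Rightarrow> real \<Rightarrow> real" and C
  proof (rule fubini_bounded(1)[OF finite_measure_time finite_measure_circle])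
    have "(\<lambda>x. x) \<in> measurable ?R borel" by (rule measurable_restrict_space1) simp
    moreover have "(\<lambda>x. x) \<in> borel_measurable circle" by (rule measurable_circleI) simp
    ultimately have "(\<lambda>z. (fst z, snd z)) \<in> measurable (?R \<Otimes>\<^sub>M circle) (borel \<Otimes>\<^sub>M borel)"
      using measurable_compose[OF measurable_fst] measurable_compose[OF measurable_snd]
      by (intro measurable_Pair) auto
    from measurable_compose[OF this m] show "(\<lambda>(t, x). H t x) \<in> borel_measurable (?R \<Otimes>\<^sub>M circle)"
      by (simp add: split_beta)
    show "\<bar>H t x\<bar> \<le> C" if "t \<in> space ?R" for t x using that b by (simp add: space_restrict_space)
  qed
  have "(LINT t|?R. LINT x|circle. F t x) + (LINT t|?R. LINT x|circle. G t x) = 0"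
    using eq i[OF mF bF] i[OF mG bG] by simp
  then show ?thesis
    using integral_cylinder(1)[OF mF I bF zF] integral_cylinder(1)[OF mG I bG zG] by simp
qed

lemma frac_measurable_circle: "frac \<in> measurable borel circle"
  unfolding circle_def
proof (rule measurable_restrict_space2)
  show "(frac :: real \<Rightarrow> real) \<in> measurable borel lborel" unfolding frac_def[abs_def] by simp
qed (auto simp: frac_lt_1)

section \<open>Regularity, energy and momentum of the solution\<close>

context damped_flow
begin

lemma has_weak_deriv_u: "0 \<le> t \<Longrightarrow> has_weak_deriv (u t) (ux t)"
  unfolding has_weak_deriv_def
proof (intro conjI ballI)
  assume t: "0 \<le> t"
  show "integrable circle (u t)" "integrable circle (ux t)"
    using u_bd[OF t] ux_bd[OF t] by (auto intro!: integrable_circle_bounded)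
  show "periodic1 (ux t)" by (simp add: ux_def Y.periodic1_dpot)
  show "(LINT x|circle. u t x * deriv \<phi> x) = - (LINT x|circle. ux t x * \<phi> x)" if "\<phi> \<in> circle_test" for \<phi>
    unfolding u_def ux_def by (rule Y.pot_by_parts[OF circle_deriv_test[OF that]])
qed

lemma periodic1_u: "periodic1 (u t)"
  by (simp add: u_def Y.periodic1_pot)

lemma u_in_H1: "0 \<le> t \<Longrightarrow> u t \<in> H1"
  unfolding H1_def using periodic1_u has_weak_deriv_u[of t]
    square_integrable_bounded[of "u t" "2 * M"] square_integrable_bounded[of "ux t" M] u_bd ux_bd by auto

lemma H1_norm_le: "0 \<le> t \<Longrightarrow> H1_norm (u t) \<le> sqrt ((2 * M)\<^sup>2 + M\<^sup>2)"
  unfolding H1_norm_def L2_norm_weak_deriv[OF has_weak_deriv_u]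
  by (intro real_sqrt_le_mono add_mono power_mono L2_norm_le L2_norm_nonneg u_bd ux_bd) auto

lemma u_W1inf:
  assumes t: "0 \<le> t"
  shows "u t \<in> W1inf" "W1inf_norm (u t) \<le> 3 * M"
proof -
  note d = has_weak_deriv_u[OF t]
  have "u t \<in> borel_measurable circle" "AE x in circle. \<bar>u t x\<bar> \<le> 2 * M" "0 \<le> 2 * M"
    using u_bd[OF t] M_nonneg by auto
  note u = Linf_AE_bounded[OF this]
  have "Linf (ux t)"
    by (rule Linf_AE_bounded[where C = M]) (use ux_bd[OF t] M_nonneg in auto)
  then show "u t \<in> W1inf" using u periodic1_u d by (auto simp: W1inf_def)
  have "weak_deriv (u t) \<in> borel_measurable circle"
    using has_weak_deriv_weak_deriv[OF d] by (auto simp: has_weak_deriv_def dest: borel_measurable_integrable)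
  moreover have "AE x in circle. \<bar>weak_deriv (u t) x\<bar> \<le> M"
    using weak_deriv_AE_eq[OF d] by eventually_elim (use ux_bd[OF t] in simp)
  ultimately have "Linf_norm (weak_deriv (u t)) \<le> M" using M_nonneg by (rule Linf_AE_bounded)
  then show "W1inf_norm (u t) \<le> 3 * M" using u by (simp add: W1inf_norm_def)
qed

lemma mean_u: "0 \<le> t \<Longrightarrow> mean (u t) = M * exp (- lam * t)"
  by (simp add: u_def Y.mean_pot mass_Y)

lemma integral_Y_pot: "(LINT a|Y t. pot (Y t) a) = (LINT x|nu. LINT y|nu. p t x * p t y * green (q t x - q t y))"
proof -
  have "(LINT a|Y t. pot (Y t) a) = (LINT x|nu. p t x * u t (q t x))"
    using integral_Y[OF u_meas, of t t] by (simp add: u_def)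
  then show ?thesis by (simp add: u_eq mult.assoc)
qed

text \<open>By \<open>integral_dpot_sq\<close> the squared norm is the Hamiltonian minus the squared
  mass, and both carry the factor exp (- 2 * lam * t).\<close>

lemma energy_decay: "0 \<le> t \<Longrightarrow> L2_norm (ux t) = exp (- lam * t) * L2_norm (ux 0)"
proof -
  assume t: "0 \<le> t"
  let ?H = "LINT x|nu. LINT y|nu. green (x - y)"
  have "(LINT x|circle. (ux t x)\<^sup>2) = exp (- 2 * lam * t) * (?H - M\<^sup>2)" if "0 \<le> t" for t
  proof -
    have "(exp (- lam * t))\<^sup>2 = exp (- 2 * lam * t)" by (simp add: power2_eq_square exp_add[symmetric])
    then show ?thesis using that unfolding ux_def Y.integral_dpot_sq integral_Y_pot p_energy[OF that] mass_Y[OF that]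
      by (simp add: power_mult_distrib algebra_simps)
  qed
  from this[OF t] this[of 0] have "(LINT x|circle. (ux t x)\<^sup>2) = (exp (- lam * t))\<^sup>2 * (LINT x|circle. (ux 0 x)\<^sup>2)"
    by (simp add: power2_eq_square exp_add[symmetric])
  then show ?thesis by (simp add: L2_norm_def real_sqrt_mult)
qed

text \<open>Two integrations by parts lead from u over u_x to Y; the remaining mass term cancels the
  mean.\<close>

lemma momentum_u:
  assumes t: "0 \<le> t" and \<phi>: "\<phi> \<in> circle_test"
  shows "momentum (u t) \<phi> = (LINT a|Y t. \<phi> a)"
proof -
  note d1 = circle_deriv_test[OF \<phi>] and d2 = circle_deriv_test[OF circle_test_deriv(1)[OF \<phi>]]
  have "(LINT x|circle. u t x * deriv (deriv \<phi>) x) = - ((LINT a|Y t. \<phi> a) - Y.mass t * (LINT x|circle. \<phi> x))"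
    unfolding u_def Y.pot_by_parts[OF d2] Y.dpot_by_parts[OF d1] by simp
  then show ?thesis by (simp add: momentum_def u_def Y.mean_pot)
qed

text \<open>\<open>frac\<close> carries the measure from the line to the circle. Periodic test
  functions do not notice, and the mass is preserved.\<close>

lemma momentum_measure:
  assumes t: "0 \<le> t"
  shows "\<exists>\<nu>\<in>M_plus. represents \<nu> (momentum (u t)) \<and> M_norm \<nu> \<le> ennreal M"
proof
  let ?\<nu> = "distr (Y t) circle frac"
  have fr: "frac \<in> measurable (Y t) circle"
    using frac_measurable_circle measurable_cong_sets[OF Y.sets_Y[of t] refl] by blast
  have fm: "finite_measure ?\<nu>" by (rule Y.finite_measure_distr[OF fr])
  then show "?\<nu> \<in> M_plus" by (simp add: M_plus_def)
  have "(LINT x|?\<nu>. \<phi> x) = momentum (u t) \<phi>" if \<phi>: "\<phi> \<in> circle_test" for \<phi>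
  proof -
    have "(LINT x|?\<nu>. \<phi> x) = (LINT a|Y t. \<phi> (frac a))"
      by (rule integral_distr[OF fr])
         (intro measurable_circleI borel_measurable_continuous_onI circle_test_continuous \<phi>)
    also have "\<dots> = (LINT a|Y t. \<phi> a)" using \<phi> by (simp add: periodic1_frac circle_test_def)
    finally show ?thesis by (simp add: momentum_u[OF t \<phi>])
  qed
  moreover have "measure ?\<nu> (space ?\<nu>) \<le> M"
  proof -
    have "measure ?\<nu> (space ?\<nu>) = Y.mass t"
    proof -
      have "{0..<1} \<in> sets circle" using sets.top[of circle] by simp
      moreover have "frac -` {0..<1} = (UNIV :: real set)" by (auto simp: frac_lt_1)
      ultimately show ?thesis using measure_distr[OF fr, of "{0..<1}"] by (simp add: Y.mass_def)
    qed
    then show ?thesis using mass_le[OF t] by simp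
  qed
  ultimately show "represents ?\<nu> (momentum (u t)) \<and> M_norm ?\<nu> \<le> ennreal M"
    using M_norm_le[OF fm] by (auto simp: represents_def intro: order_trans ennreal_leI)
qed

section \<open>The weak equation and the weak derivatives in time and space\<close>

definition flux :: "real \<Rightarrow> real \<Rightarrow> real" where
  "flux t y = 2 * M * exp (- lam * t) * u t y + (ux t y)\<^sup>2 / 2"

lemma flux_bd: "0 \<le> t \<Longrightarrow> \<bar>flux t y\<bar> \<le> 2 * M * (2 * M) + M\<^sup>2"
proof -
  assume t: "0 \<le> t"
  have "\<bar>2 * M * exp (- lam * t)\<bar> \<le> 2 * M"
    using t lam_pos M_nonneg by (simp add: abs_mult mult_left_le)
  then have "\<bar>2 * M * exp (- lam * t) * u t y\<bar> \<le> 2 * M * (2 * M)"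
    unfolding abs_mult[of _ "u t y"] using u_bd[OF t] M_nonneg by (intro mult_mono) auto
  moreover have "\<bar>(ux t y)\<^sup>2 / 2\<bar> \<le> M\<^sup>2"
  proof -
    have "(ux t y)\<^sup>2 \<le> M\<^sup>2" using ux_bd[OF t, of y] M_nonneg by (simp add: abs_le_square_iff[symmetric])
    then show ?thesis using zero_le_power2[of M] unfolding abs_divide abs_power2 abs_numeral by linarith
  qed
  ultimately show ?thesis unfolding flux_def using abs_triangle_ineq by (rule_tac order_trans[OF abs_triangle_ineq]) linarith
qed

lemma Y_measurable: "f \<in> borel_measurable borel \<Longrightarrow> f \<in> borel_measurable (Y t)"
  using measurable_cong_sets[OF Y.sets_Y[of t] refl] by blast

lemma green_test_meas: "f \<in> borel_measurable borel \<Longrightarrow> (\<And>x. \<bar>f x\<bar> \<le> L) \<Longrightarrow> green_test f \<in> borel_measurable borel"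
  unfolding green_test_def[abs_def]
  by (rule convolution_swap(2)[OF Y.fin Y.sets_Y measurable_green _ abs_green_le])

lemma green_test_bd: "(\<And>x. \<bar>f x\<bar> \<le> L) \<Longrightarrow> \<bar>green_test f a\<bar> \<le> 2 * L"
proof -
  assume L: "\<And>x. \<bar>f x\<bar> \<le> L"
  have "\<bar>green (x - a) * f x\<bar> \<le> 2 * L" for x
    unfolding abs_mult by (rule mult_mono[OF abs_green_le L]) auto
  then show ?thesis unfolding green_test_def
    using abs_integral_bounded[OF finite_measure_circle, of "\<lambda>x. green (x - a) * f x" "2 * L"]
      order_trans[OF abs_ge_zero L] by simp
qed

text \<open>The damping part of \<open>p'\<close> contributes - lam \<integral> u \<phi>. The rest,
  as an integral over Y, is the left-hand side of \<open>spatial_identity\<close> for the slice of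
  \<phi> at time t; \<open>flux\<close> is its w, because Y has mass M exp (- lam t).\<close>

lemma source_identity:
  assumes \<phi>: "\<phi> \<in> cylinder_test I" and t: "0 \<le> t"
  shows "(LINT y|nu. p' t y * green_test (\<phi> t) (q t y) + p t y * u t (q t y) * green_test (d_x \<phi> t) (q t y)) =
    (LINT x|circle. circle_conv green (flux t) x * d_x \<phi> t x) - (LINT x|circle. u t x * ux t x * \<phi> t x)
      - lam * (LINT x|circle. u t x * \<phi> t x)"
proof -
  note dx = cylinder_test_partials(2)[OF \<phi>] note dxx = cylinder_test_partials(2)[OF dx]
  obtain C0 where C0: "\<And>x. \<bar>\<phi> t x\<bar> \<le> C0" using cylinder_test_bounded[OF \<phi>] by metis
  obtain C2 where C2: "\<And>x. \<bar>d_x \<phi> t x\<bar> \<le> C2" using cylinder_test_bounded[OF dx] by metis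
  let ?A = "green_test (\<phi> t)" and ?A' = "green_test (d_x \<phi> t)"
  have mA: "?A \<in> borel_measurable borel" by (rule green_test_meas[OF test_slice(1)[OF \<phi>] C0])
  have mA': "?A' \<in> borel_measurable borel" by (rule green_test_meas[OF test_slice(1)[OF dx] C2])
  have iA: "integrable (Y t) ?A" by (rule integrable_bounded[OF Y.fin Y_measurable[OF mA] green_test_bd[OF C0]])
  have i1: "integrable (Y t) (\<lambda>a. ux t a * ?A a)"
  proof (rule integrable_bounded[OF Y.fin Y_measurable[OF borel_measurable_times[OF ux_meas mA]]])
    show "\<bar>ux t a * ?A a\<bar> \<le> M * (2 * C0)" for a
      unfolding abs_mult by (rule mult_mono[OF ux_bd[OF t] green_test_bd[OF C0]]) (auto simp: M_nonneg)
  qed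
  have i2: "integrable (Y t) (\<lambda>a. u t a * ?A' a)"
  proof (rule integrable_bounded[OF Y.fin Y_measurable[OF borel_measurable_times[OF u_meas mA']]])
    show "\<bar>u t a * ?A' a\<bar> \<le> 2 * M * (2 * C2)" for a
      unfolding abs_mult by (rule mult_mono[OF u_bd[OF t] green_test_bd[OF C2]]) (auto simp: M_nonneg)
  qed
  have "(LINT y|nu. p' t y * ?A (q t y) + p t y * u t (q t y) * ?A' (q t y)) =
      (LINT y|nu. p t y * (- lam * ?A (q t y) - ux t (q t y) * ?A (q t y) + u t (q t y) * ?A' (q t y)))"
    by (rule Bochner_Integration.integral_cong[OF refl]) (simp add: p'_def algebra_simps)
  also have "\<dots> = (LINT a|Y t. - lam * ?A a - ux t a * ?A a + u t a * ?A' a)"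
    by (rule integral_Y[symmetric])
       (intro borel_measurable_add borel_measurable_diff borel_measurable_times borel_measurable_const mA mA' u_meas ux_meas)
  also have "\<dots> = - lam * (LINT a|Y t. ?A a) - (LINT a|Y t. ux t a * ?A a) + (LINT a|Y t. u t a * ?A' a)"
    using iA i1 i2 by simp
  also have "(LINT a|Y t. ?A a) = (LINT x|circle. u t x * \<phi> t x)"
    unfolding u_def pot_def green_test_def
    by (rule convolution_swap(1)[symmetric, OF Y.fin Y.sets_Y measurable_green test_slice(1)[OF \<phi>] abs_green_le C0])
  finally have e: "(LINT y|nu. p' t y * ?A (q t y) + p t y * u t (q t y) * ?A' (q t y)) =
      - lam * (LINT x|circle. u t x * \<phi> t x) - (LINT a|Y t. ux t a * ?A a) + (LINT a|Y t. u t a * ?A' a)" .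
  have cont: "continuous_on UNIV (d_x (d_x \<phi>) t)"
    using continuous_on_compose2[OF cylinder_testD(3)[OF dxx, of UNIV], of UNIV "\<lambda>x. (t, x)"]
    by (simp add: continuous_on_Pair)
  have fl: "flux t = (\<lambda>y. 2 * Y.mass t * pot (Y t) y + (dpot (Y t) y)\<^sup>2 / 2)"
    by (simp add: flux_def mass_Y[OF t] u_def ux_def fun_eq_iff)
  show ?thesis
    using Y.spatial_identity[OF cylinder_testD(2)[OF \<phi>] cylinder_testD(2)[OF dx] cylinder_testD(2)[OF dxx] cont
      smooth_partials(4)[OF cylinder_testD(1)[OF \<phi>]] smooth_partials(4)[OF cylinder_testD(1)[OF dx]], where t = t]
    unfolding e fl green_test_def[symmetric] by (simp add: u_def ux_def green_test_def)
qed

lemma joint_test_mult: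
  assumes "(\<lambda>(t, x). f t x) \<in> borel_measurable (borel \<Otimes>\<^sub>M borel)" "\<phi> \<in> cylinder_test I"
  shows "(\<lambda>(t, x). f t x * \<phi> t x) \<in> borel_measurable (borel \<Otimes>\<^sub>M borel)"
  using borel_measurable_times[OF assms(1) cylinder_test_measurable[OF assms(2)]] by (simp add: split_beta)

lemma bounded_test_mult:
  fixes f \<phi> :: "real \<Rightarrow> real \<Rightarrow> real"
  assumes "\<And>t x. 0 \<le> t \<Longrightarrow> \<bar>f t x\<bar> \<le> C" "\<And>t x. \<bar>\<phi> t x\<bar> \<le> L" "0 \<le> t"
  shows "\<bar>f t x * \<phi> t x\<bar> \<le> C * L"
  unfolding abs_mult
  by (rule mult_mono[OF assms(1)[OF assms(3)] assms(2)]) (rule order_trans[OF abs_ge_zero assms(1)[OF assms(3)]], simp)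

lemma has_weak_dx_u:
  assumes I: "I \<in> sets borel" "I \<subseteq> {0<..}"
  shows "has_weak_dx I u ux"
  unfolding has_weak_dx_def
proof
  fix \<phi> assume \<phi>: "\<phi> \<in> cylinder_test I"
  note dx = cylinder_test_partials(2)[OF \<phi>]
  obtain T where T: "0 < T" "\<And>x. \<phi> 0 x = 0" "\<And>x. \<phi> T x = 0"
    "\<And>t x. t \<notin> I \<inter> {0..T} \<Longrightarrow> \<phi> t x = 0 \<and> d_t \<phi> t x = 0 \<and> d_x \<phi> t x = 0"
    by (rule cylinder_test_window[OF \<phi> I(2)]) (rule that)
  obtain C0 where C0: "\<And>t x. \<bar>\<phi> t x\<bar> \<le> C0" using cylinder_test_bounded[OF \<phi>] by blast
  obtain C2 where C2: "\<And>t x. \<bar>d_x \<phi> t x\<bar> \<le> C2" using cylinder_test_bounded[OF dx] by blast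
  show "(LINT (t, x)|cylinder I. u t x * d_x \<phi> t x) = - (LINT (t, x)|cylinder I. ux t x * \<phi> t x)"
  proof (rule cylinder_balance[OF I(1) joint_test_mult[OF joint_u dx] joint_test_mult[OF joint_ux \<phi>]
        bounded_test_mult[of u _ "d_x \<phi>", OF u_bd C2] bounded_test_mult[of ux _ \<phi>, OF ux_bd C0]])
    show "(LINT t|restrict_space lborel {0..T}. (LINT x|circle. u t x * d_x \<phi> t x) + (LINT x|circle. ux t x * \<phi> t x)) = 0"
      using Y.pot_by_parts[OF test_slice(2)[OF \<phi>]] by (simp add: u_def ux_def)
  qed (use T(4) in auto)
qed

text \<open>The formal derivative of p green (x - q) under the integral, with q_t = u(t, q). It is
  bounded, which places u in H1 locally in time and space.\<close>

definition ut :: "real \<Rightarrow> real \<Rightarrow> real" where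
  "ut t x = (LINT y|nu. p' t y * green (x - q t y) - p t y * u t (q t y) * dgreen (x - q t y))"

lemma ut_integrand_bd:
  "0 \<le> t \<Longrightarrow> y \<in> {0..<1} \<Longrightarrow>
    \<bar>p' t y * green (x - q t y) - p t y * u t (q t y) * dgreen (x - q t y)\<bar> \<le> (lam + M) * B * 2 + B * (2 * M) * (1 / 2)"
proof -
  assume t: "0 \<le> t" and y: "y \<in> {0..<1}"
  have "\<bar>p' t y * green (x - q t y)\<bar> \<le> (lam + M) * B * 2"
    unfolding abs_mult using lam_pos M_nonneg B_nonneg by (intro mult_mono[OF p'_bd[OF t y] abs_green_le]) auto
  moreover have "\<bar>p t y * u t (q t y) * dgreen (x - q t y)\<bar> \<le> B * (2 * M) * (1 / 2)"
    unfolding abs_mult using M_nonneg B_nonneg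
    by (intro mult_mono[OF mult_mono[OF abs_p_le[OF y] u_bd[OF t]] abs_dgreen_le]) auto
  ultimately show ?thesis by (intro order_trans[OF abs_triangle_ineq4] add_mono)
qed

lemma ut_bd: "0 \<le> t \<Longrightarrow> \<bar>ut t x\<bar> \<le> ((lam + M) * B * 2 + B * (2 * M) * (1 / 2)) * M"
proof -
  assume t: "0 \<le> t"
  have "\<bar>ut t x\<bar> \<le> ((lam + M) * B * 2 + B * (2 * M) * (1 / 2)) * measure nu (space nu)"
    unfolding ut_def
  proof (rule abs_integral_bounded[OF fin_nu])
    show "0 \<le> (lam + M) * B * 2 + B * (2 * M) * (1 / 2)" using lam_pos M_nonneg B_nonneg by simp
  qed (use ut_integrand_bd[OF t] in simp)
  then show ?thesis by (simp add: M_def)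
qed

lemma joint_ut: "(\<lambda>(t, x). ut t x) \<in> borel_measurable (borel \<Otimes>\<^sub>M borel)"
proof -
  have "(\<lambda>(z, y). p' (fst z) y * green (snd z - q (fst z) y) - p (fst z) y * u (fst z) (q (fst z) y) * dgreen (snd z - q (fst z) y))
      \<in> borel_measurable ((borel \<Otimes>\<^sub>M borel) \<Otimes>\<^sub>M nu)"
    unfolding p'_def by measurable
  from nu.borel_measurable_lebesgue_integral[OF this] show ?thesis by (simp add: ut_def split_beta)
qed

text \<open>\<open>green_by_parts\<close> moves the derivative from the kernel to the test function.
  The result is the particle integral of \<open>transport_identity\<close>, which thus also yields
  the weak derivative in time.\<close>

lemma integral_ut:
  assumes \<phi>: "\<phi> \<in> cylinder_test I" and t: "0 \<le> t"
  shows "(LINT x|circle. ut t x * \<phi> t x) =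
    (LINT y|nu. p' t y * green_test (\<phi> t) (q t y) + p t y * u t (q t y) * green_test (d_x \<phi> t) (q t y))"
proof -
  obtain C0 where C0: "\<And>t x. \<bar>\<phi> t x\<bar> \<le> C0" using cylinder_test_bounded[OF \<phi>] by blast
  note [measurable] = test_slice(1)[OF \<phi>]
  let ?K = "(lam + M) * B * 2 + B * (2 * M) * (1 / 2)"
  let ?G = "\<lambda>x y. (p' t y * green (x - q t y) - p t y * u t (q t y) * dgreen (x - q t y)) * \<phi> t x"
  have "(LINT x|circle. ut t x * \<phi> t x) = (LINT x|circle. LINT y|nu. ?G x y)"
    by (simp add: ut_def)
  also have "\<dots> = (LINT y|nu. LINT x|circle. ?G x y)"
  proof (rule fubini_bounded(3)[OF finite_measure_circle fin_nu])
    note [measurable] = q_meas[of t] p_meas[of t]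
    show "(\<lambda>(x, y). ?G x y) \<in> borel_measurable (circle \<Otimes>\<^sub>M nu)" by measurable
    show "\<bar>?G x y\<bar> \<le> ?K * C0" if "y \<in> space nu" for x y
      unfolding abs_mult[of _ "\<phi> t x"] using ut_integrand_bd[OF t, of y x] that C0
      by (intro mult_mono) (auto intro: order_trans[OF abs_ge_zero])
  qed
  also have "\<dots> = (LINT y|nu. p' t y * green_test (\<phi> t) (q t y) + p t y * u t (q t y) * green_test (d_x \<phi> t) (q t y))"
  proof (rule Bochner_Integration.integral_cong[OF refl])
    fix y
    have b1: "\<bar>green (x - q t y) * \<phi> t x\<bar> \<le> 2 * C0" "\<bar>dgreen (x - q t y) * \<phi> t x\<bar> \<le> 1/2 * C0" for x
      unfolding abs_mult by (rule mult_mono[OF abs_green_le C0] mult_mono[OF abs_dgreen_le C0]; simp)+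
    have i: "integrable circle (\<lambda>x. green (x - q t y) * \<phi> t x)" "integrable circle (\<lambda>x. dgreen (x - q t y) * \<phi> t x)"
      by (rule integrable_circle_bounded[OF _ b1(1)] integrable_circle_bounded[OF _ b1(2)]; measurable)+
    have "(LINT x|circle. ?G x y) =
        (LINT x|circle. p' t y * (green (x - q t y) * \<phi> t x) - p t y * u t (q t y) * (dgreen (x - q t y) * \<phi> t x))"
      by (simp add: algebra_simps)
    also have "\<dots> = p' t y * green_test (\<phi> t) (q t y) - p t y * u t (q t y) * (LINT x|circle. dgreen (x - q t y) * \<phi> t x)"
      using i by (simp add: green_test_def)
    also have "(LINT x|circle. dgreen (x - q t y) * \<phi> t x) = - green_test (d_x \<phi> t) (q t y)"
      using green_by_parts[OF test_slice(2)[OF \<phi>, of t], of "q t y"] by (simp add: green_test_def)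
    finally show "(LINT x|circle. ?G x y) =
        p' t y * green_test (\<phi> t) (q t y) + p t y * u t (q t y) * green_test (d_x \<phi> t) (q t y)" by simp
  qed
  finally show ?thesis .
qed

lemma has_weak_dt_u:
  assumes I: "I \<in> sets borel" "I \<subseteq> {0<..}"
  shows "has_weak_dt I u ut"
  unfolding has_weak_dt_def
proof
  fix \<phi> assume \<phi>: "\<phi> \<in> cylinder_test I"
  note dt = cylinder_test_partials(1)[OF \<phi>]
  obtain T where T: "0 < T" "\<And>x. \<phi> 0 x = 0" "\<And>x. \<phi> T x = 0"
    "\<And>t x. t \<notin> I \<inter> {0..T} \<Longrightarrow> \<phi> t x = 0 \<and> d_t \<phi> t x = 0 \<and> d_x \<phi> t x = 0"
    by (rule cylinder_test_window[OF \<phi> I(2)]) (rule that)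
  obtain C0 where C0: "\<And>t x. \<bar>\<phi> t x\<bar> \<le> C0" using cylinder_test_bounded[OF \<phi>] by blast
  obtain C1 where C1: "\<And>t x. \<bar>d_t \<phi> t x\<bar> \<le> C1" using cylinder_test_bounded[OF dt] by blast
  show "(LINT (t, x)|cylinder I. u t x * d_t \<phi> t x) = - (LINT (t, x)|cylinder I. ut t x * \<phi> t x)"
  proof (rule cylinder_balance[OF I(1) joint_test_mult[OF joint_u dt] joint_test_mult[OF joint_ut \<phi>]
        bounded_test_mult[of u _ "d_t \<phi>", OF u_bd C1] bounded_test_mult[of ut _ \<phi>, OF ut_bd C0]])
    have "(LINT t|restrict_space lborel {0..T}. (LINT x|circle. u t x * d_t \<phi> t x) + (LINT x|circle. ut t x * \<phi> t x)) =
      (LINT t|restrict_space lborel {0..T}. (LINT x|circle. u t x * d_t \<phi> t x) +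
        (LINT y|nu. p' t y * green_test (\<phi> t) (q t y) + p t y * u t (q t y) * green_test (d_x \<phi> t) (q t y)))"
      by (rule Bochner_Integration.integral_cong[OF refl]) (simp add: integral_ut[OF \<phi>] space_restrict_space)
    then show "(LINT t|restrict_space lborel {0..T}. (LINT x|circle. u t x * d_t \<phi> t x) + (LINT x|circle. ut t x * \<phi> t x)) = 0"
      using transport_identity[OF \<phi> _ T(2,3)] T(1) by simp
  qed (use T(4) in auto)
qed

lemma joint_flux: "(\<lambda>(t, x). circle_conv green (flux t) x) \<in> borel_measurable (borel \<Otimes>\<^sub>M borel)"
proof -
  interpret C: finite_measure circle by (rule finite_measure_circle)
  have "(\<lambda>(z, y). green (snd z - y) * flux (fst z) y) \<in> borel_measurable ((borel \<Otimes>\<^sub>M borel) \<Otimes>\<^sub>M circle)"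
    unfolding flux_def by measurable
  from C.borel_measurable_lebesgue_integral[OF this] show ?thesis by (simp add: circle_conv_def split_beta)
qed

lemma circle_conv_flux_bd: "0 \<le> t \<Longrightarrow> \<bar>circle_conv green (flux t) x\<bar> \<le> 2 * (2 * M * (2 * M) + M\<^sup>2)"
proof -
  assume t: "0 \<le> t"
  have "\<bar>green (x - y) * flux t y\<bar> \<le> 2 * (2 * M * (2 * M) + M\<^sup>2)" for y
    unfolding abs_mult by (rule mult_mono[OF abs_green_le flux_bd[OF t]]) auto
  then show ?thesis unfolding circle_conv_def
    using abs_integral_bounded[OF finite_measure_circle, of "\<lambda>y. green (x - y) * flux t y" "2 * (2 * M * (2 * M) + M\<^sup>2)"]
      M_nonneg by simp
qed

lemma weak_form:
  assumes \<phi>: "\<phi> \<in> cylinder_test {0<..}"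
  shows "(LINT (t, x)|cylinder {0<..}. - u t x * d_t \<phi> t x + u t x * ux t x * \<phi> t x) =
    (LINT (t, x)|cylinder {0<..}. circle_conv green (flux t) x * d_x \<phi> t x - lam * u t x * \<phi> t x)"
proof -
  note dt = cylinder_test_partials(1)[OF \<phi>] and dx = cylinder_test_partials(2)[OF \<phi>]
  obtain T where T: "0 < T" "\<And>x. \<phi> 0 x = 0" "\<And>x. \<phi> T x = 0"
    "\<And>t x. t \<notin> {0<..} \<inter> {0..T} \<Longrightarrow> \<phi> t x = 0 \<and> d_t \<phi> t x = 0 \<and> d_x \<phi> t x = 0"
    by (rule cylinder_test_window[OF \<phi> order_refl]) (rule that)
  obtain C0 where C0: "\<And>t x. \<bar>\<phi> t x\<bar> \<le> C0" using cylinder_test_bounded[OF \<phi>] by blast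
  obtain C1 where C1: "\<And>t x. \<bar>d_t \<phi> t x\<bar> \<le> C1" using cylinder_test_bounded[OF dt] by blast
  obtain C2 where C2: "\<And>t x. \<bar>d_x \<phi> t x\<bar> \<le> C2" using cylinder_test_bounded[OF dx] by blast
  let ?a = "\<lambda>t x. u t x * d_t \<phi> t x" and ?b = "\<lambda>t x. u t x * ux t x * \<phi> t x"
    and ?c = "\<lambda>t x. circle_conv green (flux t) x * d_x \<phi> t x" and ?d = "\<lambda>t x. u t x * \<phi> t x"
  have juu: "(\<lambda>(t, x). u t x * ux t x) \<in> borel_measurable (borel \<Otimes>\<^sub>M borel)"
    using borel_measurable_times[OF joint_u joint_ux] by (simp add: split_beta)
  have ma: "(\<lambda>(t, x). ?a t x) \<in> borel_measurable (borel \<Otimes>\<^sub>M borel)" by (rule joint_test_mult[OF joint_u dt])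
  have mb: "(\<lambda>(t, x). ?b t x) \<in> borel_measurable (borel \<Otimes>\<^sub>M borel)" by (rule joint_test_mult[OF juu \<phi>])
  have mc: "(\<lambda>(t, x). ?c t x) \<in> borel_measurable (borel \<Otimes>\<^sub>M borel)" by (rule joint_test_mult[OF joint_flux dx])
  have md: "(\<lambda>(t, x). ?d t x) \<in> borel_measurable (borel \<Otimes>\<^sub>M borel)" by (rule joint_test_mult[OF joint_u \<phi>])
  have buu: "\<bar>u t x * ux t x\<bar> \<le> 2 * M * M" if "0 \<le> t" for t x
    unfolding abs_mult by (rule mult_mono[OF u_bd[OF that] ux_bd[OF that]]) (auto simp: M_nonneg)
  have ba: "\<bar>?a t x\<bar> \<le> 2 * M * C1" and bb: "\<bar>?b t x\<bar> \<le> 2 * M * M * C0"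
    and bc: "\<bar>?c t x\<bar> \<le> 2 * (2 * M * (2 * M) + M\<^sup>2) * C2" and bd: "\<bar>?d t x\<bar> \<le> 2 * M * C0"
    if t: "0 \<le> t" for t x
    by (rule bounded_test_mult[OF _ _ t]; (rule u_bd buu circle_conv_flux_bd C0 C1 C2; assumption)?)+
  have slice: "f t \<in> borel_measurable borel" if "(\<lambda>(t, x). f t x) \<in> borel_measurable (borel \<Otimes>\<^sub>M borel)"
    for f :: "real \<Rightarrow> real \<Rightarrow> real" and t
    using measurable_compose[OF measurable_Pair1'[of t borel borel] that] by simp
  \<comment> \<open>The doubled minus sign brings the equation into the form of
    \<open>cylinder_balance\<close>.\<close>
  have "(LINT (t, x)|cylinder {0<..}. - ?a t x + ?b t x) = - (LINT (t, x)|cylinder {0<..}. - (?c t x - lam * ?d t x))"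
  proof (rule cylinder_balance[where T = T])
    show "(\<lambda>(t, x). - ?a t x + ?b t x) \<in> borel_measurable (borel \<Otimes>\<^sub>M borel)"
      using borel_measurable_add[OF borel_measurable_uminus[OF ma] mb] by (simp add: split_beta)
    show "(\<lambda>(t, x). - (?c t x - lam * ?d t x)) \<in> borel_measurable (borel \<Otimes>\<^sub>M borel)"
      using borel_measurable_uminus[OF borel_measurable_diff[OF mc borel_measurable_times[OF borel_measurable_const[of lam] md]]]
      by (simp add: split_beta)
    show "\<bar>- ?a t x + ?b t x\<bar> \<le> 2 * M * C1 + 2 * M * M * C0" if "0 \<le> t" for t x
      using ba[OF that, of x] bb[OF that, of x] abs_triangle_ineq[of "- ?a t x" "?b t x"] by linarith
    show "\<bar>- (?c t x - lam * ?d t x)\<bar> \<le> 2 * (2 * M * (2 * M) + M\<^sup>2) * C2 + lam * (2 * M * C0)" if "0 \<le> t" for t x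
    proof -
      have "\<bar>lam * ?d t x\<bar> \<le> lam * (2 * M * C0)"
        unfolding abs_mult[of lam] using bd[OF that, of x] lam_pos by (intro mult_mono) auto
      then show ?thesis using bc[OF that, of x] abs_triangle_ineq4[of "?c t x" "lam * ?d t x"]
        unfolding abs_minus_cancel by linarith
    qed
    show "- ?a t x + ?b t x = 0" "- (?c t x - lam * ?d t x) = 0" if "t \<notin> {0<..} \<inter> {0..T}" for t x
      using T(4)[OF that, of x] by auto
    \<comment> \<open>By \<open>source_identity\<close>, each slice is minus the integrand of
      \<open>transport_identity\<close>.\<close>
    have "(LINT t|restrict_space lborel {0..T}. (LINT x|circle. - ?a t x + ?b t x) + (LINT x|circle. - (?c t x - lam * ?d t x))) =
      (LINT t|restrict_space lborel {0..T}. - ((LINT x|circle. ?a t x) +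
        (LINT y|nu. p' t y * green_test (\<phi> t) (q t y) + p t y * u t (q t y) * green_test (d_x \<phi> t) (q t y))))"
    proof (rule Bochner_Integration.integral_cong[OF refl])
      fix t assume "t \<in> space (restrict_space lborel {0..T})"
      then have t: "0 \<le> t" by (simp add: space_restrict_space)
      have "integrable circle (?a t)" "integrable circle (?b t)" "integrable circle (?c t)" "integrable circle (?d t)"
        by (rule integrable_circle_bounded[OF slice[OF ma] ba[OF t]] integrable_circle_bounded[OF slice[OF mb] bb[OF t]]
            integrable_circle_bounded[OF slice[OF mc] bc[OF t]] integrable_circle_bounded[OF slice[OF md] bd[OF t]])+
      then show "(LINT x|circle. - ?a t x + ?b t x) + (LINT x|circle. - (?c t x - lam * ?d t x)) =
        - ((LINT x|circle. ?a t x) +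
          (LINT y|nu. p' t y * green_test (\<phi> t) (q t y) + p t y * u t (q t y) * green_test (d_x \<phi> t) (q t y)))"
        unfolding source_identity[OF \<phi> t] by simp
    qed
    also have "\<dots> = 0"
      unfolding Bochner_Integration.integral_minus using transport_identity[OF \<phi> _ T(2,3)] T(1) by simp
    finally show "(LINT t|restrict_space lborel {0..T}. (LINT x|circle. - ?a t x + ?b t x) + (LINT x|circle. - (?c t x - lam * ?d t x))) = 0" .
  qed simp
  moreover have "(LINT (t, x)|cylinder {0<..}. - (?c t x - lam * ?d t x)) = - (LINT (t, x)|cylinder {0<..}. ?c t x - lam * ?d t x)"
  proof -
    have "(\<lambda>(t, x). - (?c t x - lam * ?d t x)) = (\<lambda>z. - (case z of (t, x) \<Rightarrow> ?c t x - lam * ?d t x))" by auto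
    then show ?thesis by (simp only: Bochner_Integration.integral_minus)
  qed
  ultimately show ?thesis by (simp add: mult.assoc)
qed

lemma L2_cylinder_bounded:
  assumes f: "(\<lambda>(t, x). f t x) \<in> borel_measurable (borel \<Otimes>\<^sub>M borel)" and b: "\<And>t x. 0 \<le> t \<Longrightarrow> \<bar>f t x\<bar> \<le> C"
  shows "L2_cylinder {0<..<T} f"
proof -
  have m: "(\<lambda>(t, x). f t x) \<in> borel_measurable (cylinder {0<..<T})"
    unfolding cylinder_def using f by (intro measurable_restrict_space1) (simp add: borel_prod)
  have S: "({0<..<T} \<times> {0..<1::real}) \<in> sets borel"
    by (simp add: borel_prod[symmetric])
  have sub: "{0<..<T} \<times> {0..<1::real} \<subseteq> cbox (0, 0) (T, 1)" by (auto simp: cbox_Pair_eq)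
  have "emeasure lborel ({0<..<T} \<times> {0..<1::real}) \<le> emeasure lborel (cbox (0, 0) (T, 1 :: real))"
    by (rule emeasure_mono[OF sub]) simp
  also have "\<dots> < \<infinity>" by (rule emeasure_lborel_cbox_finite)
  finally have "finite_measure (cylinder {0<..<T})"
    using S by (intro finite_measureI) (simp add: cylinder_def emeasure_restrict_space space_restrict_space)
  then have "integrable (cylinder {0<..<T}) (\<lambda>z. ((\<lambda>(t, x). f t x) z)\<^sup>2)"
  proof (rule integrable_bounded)
    show "\<bar>((\<lambda>(t, x). f t x) z)\<^sup>2\<bar> \<le> C\<^sup>2" if "z \<in> space (cylinder {0<..<T})" for z
    proof -
      have "0 \<le> fst z" using that by (auto simp: cylinder_def space_restrict_space)
      from b[OF this, of "snd z"] have "\<bar>f (fst z) (snd z)\<bar>\<^sup>2 \<le> C\<^sup>2" by (intro power_mono) auto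
      then show ?thesis by (simp add: split_beta)
    qed
  qed (use m in measurable)
  then show ?thesis using m by (simp add: L2_cylinder_def square_integrable_def)
qed

end

theorem theorem1p1:
  fixes lam :: real and u0 :: "real \<Rightarrow> real"
  assumes "lam > 0"
    and "u0 \<in> H1"
    and "\<exists>\<nu>\<in>M_plus. represents \<nu> (momentum u0)"
  shows "\<exists>u. admissible_global_weak_solution lam u0 u \<and>
    (\<forall>T>0. Linf_into {0..T} W1inf W1inf_norm u) \<and>
    (\<forall>T>0. H1_cylinder {0<..<T} u) \<and>
    (\<exists>C::real. AE t in lborel. t \<ge> 0 \<longrightarrow>
       (\<exists>\<nu>\<in>M_plus. represents \<nu> (momentum (u t)) \<and> M_norm \<nu> \<le> ennreal C))"
proof -
  obtain \<nu> where \<nu>: "sets \<nu> = sets circle" "finite_measure \<nu>" and rep: "represents \<nu> (momentum u0)"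
    using assms(3) by (auto simp: M_plus_def)
  interpret labels \<nu> by (rule labels.intro[OF \<nu>(2,1)])
  obtain q p B where "damped_flow \<nu> lam q p B" by (rule damped_flow_exists[OF assms(1)])
  then interpret damped_flow \<nu> lam q p B .
  obtain v0 where v0: "has_weak_deriv u0 v0" using assms(2) by (auto simp: H1_def)
  then have iu0: "integrable circle u0" by (simp add: has_weak_deriv_def)
  have iu: "integrable circle (u 0)" using has_weak_deriv_u[of 0] by (simp add: has_weak_deriv_def)
  \<comment> \<open>The constant test function 1 shows that the mean of the initial function is the
    mass of its momentum.\<close>
  have mean0: "mean u0 = M"
    using rep[unfolded represents_def, rule_format, OF const_circle_test[of 1]]
    by (simp add: momentum_def M_def)
  have "momentum u0 \<phi> = momentum (u 0) \<phi>" if \<phi>: "\<phi> \<in> circle_test" for \<phi>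
  proof -
    have "momentum (u 0) \<phi> = (LINT x|\<nu>. p 0 x * \<phi> (q 0 x))"
      using momentum_u[OF order_refl \<phi>] integral_Y[OF borel_measurable_continuous_onI[OF circle_test_continuous[OF \<phi>]]]
      by simp
    also have "\<dots> = (LINT x|\<nu>. \<phi> x)"
      by (rule Bochner_Integration.integral_cong) (auto simp: p_0 q_0)
    finally show ?thesis using rep \<phi> by (simp add: represents_def)
  qed
  \<comment> \<open>Membership in H1 fixes \<open>u0\<close> only up to null sets, so equality
    almost everywhere is what can be expected; the initial condition and the norms see no
    more.\<close>
  then have AE0: "AE x in circle. u0 x = u 0 x" by (rule momentum_determines[OF iu0 iu])
  have test0: "(LINT x|circle. u0 x * f x) = (LINT x|circle. u 0 x * f x)" if f: "f \<in> circle_test" for f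
  proof (rule integral_cong_AE)
    show "AE x in circle. u0 x * f x = u 0 x * f x" using AE0 by eventually_elim simp
  qed (use integrable_mult_test[OF iu0 f] integrable_mult_test[OF iu f] in \<open>auto dest: borel_measurable_integrable\<close>)
  \<comment> \<open>The L2 norm of the weak derivative of \<open>u0\<close> can therefore be
    computed from \<open>ux 0\<close>, the initial value in \<open>energy_decay\<close>.\<close>
  have wd0: "has_weak_deriv u0 (ux 0)"
    using has_weak_deriv_u[of 0] iu0 test0[OF circle_test_deriv(1)] by (simp add: has_weak_deriv_def)
  have initial: "((\<lambda>t. LINT x|circle. u t x * \<phi> x) \<longlongrightarrow> (LINT x|circle. u0 x * \<phi> x)) (at_right 0)"
    if \<phi>: "\<phi> \<in> circle_test" for \<phi>
    unfolding tendsto_at_iff_sequentially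
  proof (intro allI impI)
    fix X :: "nat \<Rightarrow> real" assume X: "\<forall>i. X i \<in> {0<..} - {0}" "X \<longlonglongrightarrow> 0"
    obtain L where L: "\<And>x. \<bar>\<phi> x\<bar> \<le> L" using circle_test_bounded[OF \<phi>] by blast
    have [measurable]: "\<phi> \<in> borel_measurable borel"
      by (rule borel_measurable_continuous_onI[OF circle_test_continuous[OF \<phi>]])
    have "(\<lambda>i. LINT x|circle. u (X i) x * \<phi> x) \<longlonglongrightarrow> (LINT x|circle. u 0 x * \<phi> x)"
    proof (rule integral_dominated_convergence[where w = "\<lambda>_. 2 * M * L"])
      show "AE x in circle. (\<lambda>i. u (X i) x * \<phi> x) \<longlonglongrightarrow> u 0 x * \<phi> x"
      proof (rule AE_I2)
        fix x :: real
        have "(\<lambda>i. (X i, x)) \<longlonglongrightarrow> (0, x)" by (intro tendsto_Pair X tendsto_const)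
        from continuous_on_tendsto_compose[OF continuous_u this]
        show "(\<lambda>i. u (X i) x * \<phi> x) \<longlonglongrightarrow> u 0 x * \<phi> x" by (intro tendsto_mult) auto
      qed
      show "AE x in circle. norm (u (X i) x * \<phi> x) \<le> 2 * M * L" for i
      proof (rule AE_I2)
        fix x
        have "0 \<le> X i" using X(1) by (simp add: less_imp_le)
        then show "norm (u (X i) x * \<phi> x) \<le> 2 * M * L"
          unfolding real_norm_def abs_mult by (intro mult_mono u_bd L) (auto simp: M_nonneg)
      qed
      show "integrable circle (\<lambda>_. 2 * M * L)" by (rule integrable_circle_bounded) auto
      show "(\<lambda>x. u 0 x * \<phi> x) \<in> borel_measurable circle" by (rule measurable_circleI) measurable
      show "(\<lambda>x. u (X i) x * \<phi> x) \<in> borel_measurable circle" for i by (rule measurable_circleI) measurable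
    qed
    then show "((\<lambda>t. LINT x|circle. u t x * \<phi> x) \<circ> X) \<longlonglongrightarrow> (LINT x|circle. u0 x * \<phi> x)"
      by (simp add: o_def test0[OF \<phi>])
  qed
  have flux_eq: "flux t = (\<lambda>y. 2 * mean u0 * exp (- lam * t) * u t y + (ux t y)\<^sup>2 / 2)" for t
    by (simp add: flux_def mean0 fun_eq_iff)
  have "weak_equation lam u0 u"
    unfolding weak_equation_def
    using L2_cylinder_bounded[OF joint_ux ux_bd] has_weak_dx_u[of "{0<..}"] weak_form[unfolded flux_eq]
    by (intro exI[of _ ux]) auto
  moreover have "Linf_into {0..} H1 H1_norm u"
    unfolding Linf_into_def using u_in_H1 H1_norm_le
    by (intro exI[of _ "sqrt ((2 * M)\<^sup>2 + M\<^sup>2)"] AE_I2) auto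
  moreover have "continuous_on ({0..} \<times> UNIV) (\<lambda>(t, x). u t x)"
    by (rule continuous_on_subset[OF continuous_u]) simp
  moreover have "L2_norm (weak_deriv (u t)) = exp (- lam * t) * L2_norm (weak_deriv u0)" if "0 \<le> t" for t
    unfolding L2_norm_weak_deriv[OF has_weak_deriv_u[OF that]] L2_norm_weak_deriv[OF wd0]
    by (rule energy_decay[OF that])
  ultimately have "admissible_global_weak_solution lam u0 u"
    unfolding admissible_global_weak_solution_def
    using initial periodic1_u mean_u u_in_H1 mean0 by simp
  moreover have "Linf_into {0..T} W1inf W1inf_norm u" for T
    unfolding Linf_into_def using u_W1inf by (intro exI[of _ "3 * M"] AE_I2) auto
  moreover have "H1_cylinder {0<..<T} u" for T
  proof -
    have "{0<..<T} \<in> sets borel" "{0<..<T} \<subseteq> {0<..}" by auto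
    then show ?thesis
      unfolding H1_cylinder_def
      using L2_cylinder_bounded[OF joint_u u_bd] L2_cylinder_bounded[OF joint_ut ut_bd]
        L2_cylinder_bounded[OF joint_ux ux_bd] has_weak_dt_u has_weak_dx_u by blast
  qed
  moreover have "AE t in lborel. t \<ge> 0 \<longrightarrow>
      (\<exists>\<nu>\<in>M_plus. represents \<nu> (momentum (u t)) \<and> M_norm \<nu> \<le> ennreal M)"
    using momentum_measure by (intro AE_I2) blast
  ultimately show ?thesis by blast
qed

end
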